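(* Let $1<p<\infty$ and $0<s<1$. Let $\Omega\subsetneq\mathbb{R}^N$ be an open convex set. For $\beta\in\mathbb{R}$ let $U_\beta=d_\Omega^\beta$ in $\Omega$, extended by $0$ to $\mathbb{R}^N\setminus\Omega$ (for $\beta=0$, $U_0$ is the characteristic function of $\Omega$). Then: (1) if \[ 0\le\beta<\frac{s\,p}{p-1}, \] the function $U_\beta$ is a local weak supersolution of \[ (-\Delta_p)^s u=\lambda\,\frac{|u|^{p-2}u}{d_\Omega^{s\,p}}\quad\text{in }\Omega, \] with $\lambda=C_{N,s\,p}\,\lambda(\beta)$; (2) if $\Omega$ is a half-space and \[ -\frac{1}{p-1}<\beta<\frac{s\,p}{p-1}, \] the function $U_\beta$ is a local weak solution of the same equation, still with $\lambda=C_{N,s\,p}\,\lambda(\beta)$.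
   Context: $d_\Omega(x)=\min_{y\in\partial\Omega}|x-y|$ for $x\in\Omega$; $J_p(t)=|t|^{p-2}t$ for $t\in\mathbb{R}$. The constants are \[ \lambda(\beta)=2\int_0^1\frac{J_p(1-t^\beta)}{(1-t)^{1+s\,p}}\left(1-t^{s\,p-1-\beta(p-1)}\right)dt+\frac{2}{s\,p},\qquad -\frac1{p-1}<\beta<\frac{s\,p}{p-1}, \] \[ C_{N,s\,p}=(N-1)\,\omega_{N-1}\int_0^{+\infty}t^{N-2}(1+t^2)^{-\frac{N+s\,p}{2}}\,dt\ \text{ for } N\ge 2,\qquad C_{1,s\,p}=1, \] with $\omega_k$ the volume of the unit ball of $\mathbb{R}^k$. For open $E\subset\mathbb{R}^N$, $[u]_{W^{s,p}(E)}=\left(\iint_{E\times E}\frac{|u(x)-u(y)|^p}{|x-y|^{N+s\,p}}dx\,dy\right)^{1/p}$, $W^{s,p}(E)=\{u\in L^p(E):[u]_{W^{s,p}(E)}<\infty\}$, and $W^{s,p}_{\rm loc}(\Omega)$ is the set of $u\in L^p_{\rm loc}(\Omega)$ with $u\in W^{s,p}(\Omega')$ for every open $\Omega'$ with $\overline{\Omega'}$ compact in $\Omega$. $L^{p-1}_{s\,p}(\mathbb{R}^N)$ is the set of $u\in L^{p-1}_{\rm loc}(\mathbb{R}^N)$ with $\int_{\mathbb{R}^N}\frac{|u(x)|^{p-1}}{(1+|x|)^{N+s\,p}}dx<\infty$. For $\lambda\in\mathbb{R}$, a function $u\in W^{s,p}_{\rm loc}(\Omega)\cap L^{p-1}_{s\,p}(\mathbb{R}^N)$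 is a local weak supersolution (resp. subsolution) of $(-\Delta_p)^su=\lambda |u|^{p-2}u/d_\Omega^{s\,p}$ in $\Omega$ if \[ \iint_{\mathbb{R}^N\times\mathbb{R}^N}\frac{J_p(u(x)-u(y))(\varphi(x)-\varphi(y))}{|x-y|^{N+s\,p}}dx\,dy\ \ge\ (\text{resp. }\le)\ \lambda\int_\Omega\frac{|u|^{p-2}u}{d_\Omega^{s\,p}}\,\varphi\,dx \] for every non-negative $\varphi\in W^{s,p}(\mathbb{R}^N)$ with compact support in $\Omega$; it is a local weak solution if it is both. *)

theory Defs
  imports "HOL-Analysis.Analysis"
begin

text \<open>
  Functions are considered up to Lebesgue-null sets; conditions on function values are therefore
  imposed almost everywhere. Double integrals over \<open>\<real>\<^sup>N \<times> \<real>\<^sup>N\<close> are taken with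
  respect to Lebesgue measure on the product space. The integrands have value 0 on the diagonal
  (division by zero), which is a null set. All real powers are taken of non-negative bases, and
  \<open>0 powr a = 0\<close> for every \<open>a\<close>.
\<close>

definition J :: "real \<Rightarrow> real \<Rightarrow> real" where
  "J p t = \<bar>t\<bar> powr (p - 2) * t"

definition bdist :: "(real ^ 'n) set \<Rightarrow> real ^ 'n \<Rightarrow> real" where
  "bdist \<Omega> x = infdist x (frontier \<Omega>)"

text \<open>Meaningful for \<open>- 1 / (p - 1) < \<beta> < s * p / (p - 1)\<close>, where the integral
  converges absolutely.\<close>

definition hardy_lambda :: "real \<Rightarrow> real \<Rightarrow> real \<Rightarrow> real" where
  "hardy_lambda s p \<beta> =
     2 * (LBINT t:{0<..<1}. J p (1 - t powr \<beta>) / (1 - t) powr (1 + s * p)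
                              * (1 - t powr (s * p - 1 - \<beta> * (p - 1))))
     + 2 / (s * p)"

text \<open>The second argument is the product \<open>s * p\<close>.\<close>

definition C_const :: "nat \<Rightarrow> real \<Rightarrow> real" where
  "C_const N sp =
     (if N \<ge> 2 then
        real (N - 1) * unit_ball_vol (real (N - 1))
          * (LBINT t:{0<..}. t ^ (N - 2) * (1 + t\<^sup>2) powr (- ((real N + sp) / 2)))
      else 1)"

definition Lp_on :: "real \<Rightarrow> (real ^ 'n) set \<Rightarrow> (real ^ 'n \<Rightarrow> real) set" where
  "Lp_on q E = {u. set_borel_measurable lebesgue E u \<and>
                   set_integrable lebesgue E (\<lambda>x. \<bar>u x\<bar> powr q)}"

definition Lp_loc :: "real \<Rightarrow> (real ^ 'n) set \<Rightarrow> (real ^ 'n \<Rightarrow> real) set" where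
  "Lp_loc q \<Omega> = {u. \<forall>K. compact K \<and> K \<subseteq> \<Omega> \<longrightarrow> u \<in> Lp_on q K}"

text \<open>The \<open>p\<close>-th power of the seminorm of \<open>u\<close> in \<open>W\<^sup>s\<^sup>,\<^sup>p(E)\<close>, possibly infinite.\<close>

definition gagliardo :: "real \<Rightarrow> real \<Rightarrow> (real ^ 'n) set \<Rightarrow> (real ^ 'n \<Rightarrow> real) \<Rightarrow> ennreal" where
  "gagliardo s p E u =
     (\<integral>\<^sup>+ z \<in> E \<times> E.
        ennreal (\<bar>u (fst z) - u (snd z)\<bar> powr p
                 / norm (fst z - snd z) powr (real CARD('n) + s * p)) \<partial>lebesgue)"

definition Wsp :: "real \<Rightarrow> real \<Rightarrow> (real ^ 'n) set \<Rightarrow> (real ^ 'n \<Rightarrow> real) set" where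
  "Wsp s p E = {u \<in> Lp_on p E. gagliardo s p E u < \<infinity>}"

definition Wsp_loc :: "real \<Rightarrow> real \<Rightarrow> (real ^ 'n) set \<Rightarrow> (real ^ 'n \<Rightarrow> real) set" where
  "Wsp_loc s p \<Omega> =
     {u \<in> Lp_loc p \<Omega>. \<forall>\<Omega>'. open \<Omega>' \<and> compact (closure \<Omega>') \<and> closure \<Omega>' \<subseteq> \<Omega>
                              \<longrightarrow> u \<in> Wsp s p \<Omega>'}"

text \<open>The tail space \<open>L\<^sup>p\<^sup>-\<^sup>1\<^sub>s\<^sub>p(\<real>\<^sup>N)\<close>.\<close>

definition tail_space :: "real \<Rightarrow> real \<Rightarrow> (real ^ 'n \<Rightarrow> real) set" where
  "tail_space s p =
     {u \<in> Lp_loc (p - 1) UNIV.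
        integrable lebesgue
          (\<lambda>x. \<bar>u x\<bar> powr (p - 1) / (1 + norm x) powr (real CARD('n) + s * p))}"

definition test_functions :: "real \<Rightarrow> real \<Rightarrow> (real ^ 'n) set \<Rightarrow> (real ^ 'n \<Rightarrow> real) set" where
  "test_functions s p \<Omega> =
     {\<phi> \<in> Wsp s p UNIV.
        (AE x in lebesgue. 0 \<le> \<phi> x) \<and>
        (\<exists>K. compact K \<and> K \<subseteq> \<Omega> \<and> (AE x in lebesgue. x \<notin> K \<longrightarrow> \<phi> x = 0))}"

definition energy_integrand ::
  "real \<Rightarrow> real \<Rightarrow> (real ^ 'n \<Rightarrow> real) \<Rightarrow> (real ^ 'n \<Rightarrow> real) \<Rightarrow> (real ^ 'n) \<times> (real ^ 'n) \<Rightarrow> real" where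
  "energy_integrand s p u \<phi> z =
     J p (u (fst z) - u (snd z)) * (\<phi> (fst z) - \<phi> (snd z))
       / norm (fst z - snd z) powr (real CARD('n) + s * p)"

definition hardy_integrand ::
  "real \<Rightarrow> real \<Rightarrow> (real ^ 'n) set \<Rightarrow> (real ^ 'n \<Rightarrow> real) \<Rightarrow> (real ^ 'n \<Rightarrow> real) \<Rightarrow> real ^ 'n \<Rightarrow> real" where
  "hardy_integrand s p \<Omega> u \<phi> x =
     \<bar>u x\<bar> powr (p - 2) * u x / bdist \<Omega> x powr (s * p) * \<phi> x"

text \<open>
  For \<open>u\<close> in the two function spaces and a test function \<open>\<phi>\<close>, both integrals converge
  absolutely. This is recorded explicitly because the Bochner integral of a non-integrable
  function is 0 by convention.
\<close>

definition local_weak_supersolution ::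
  "real \<Rightarrow> real \<Rightarrow> (real ^ 'n) set \<Rightarrow> real \<Rightarrow> (real ^ 'n \<Rightarrow> real) \<Rightarrow> bool" where
  "local_weak_supersolution s p \<Omega> \<mu> u \<longleftrightarrow>
     u \<in> Wsp_loc s p \<Omega> \<inter> tail_space s p \<and>
     (\<forall>\<phi> \<in> test_functions s p \<Omega>.
        integrable lebesgue (energy_integrand s p u \<phi>) \<and>
        set_integrable lebesgue \<Omega> (hardy_integrand s p \<Omega> u \<phi>) \<and>
        (LINT z|lebesgue. energy_integrand s p u \<phi> z)
          \<ge> \<mu> * (LINT x:\<Omega>|lebesgue. hardy_integrand s p \<Omega> u \<phi> x))"

definition local_weak_subsolution ::
  "real \<Rightarrow> real \<Rightarrow> (real ^ 'n) set \<Rightarrow> real \<Rightarrow> (real ^ 'n \<Rightarrow> real) \<Rightarrow> bool" where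
  "local_weak_subsolution s p \<Omega> \<mu> u \<longleftrightarrow>
     u \<in> Wsp_loc s p \<Omega> \<inter> tail_space s p \<and>
     (\<forall>\<phi> \<in> test_functions s p \<Omega>.
        integrable lebesgue (energy_integrand s p u \<phi>) \<and>
        set_integrable lebesgue \<Omega> (hardy_integrand s p \<Omega> u \<phi>) \<and>
        (LINT z|lebesgue. energy_integrand s p u \<phi> z)
          \<le> \<mu> * (LINT x:\<Omega>|lebesgue. hardy_integrand s p \<Omega> u \<phi> x))"

definition local_weak_solution ::
  "real \<Rightarrow> real \<Rightarrow> (real ^ 'n) set \<Rightarrow> real \<Rightarrow> (real ^ 'n \<Rightarrow> real) \<Rightarrow> bool" where
  "local_weak_solution s p \<Omega> \<mu> u \<longleftrightarrow>
     local_weak_supersolution s p \<Omega> \<mu> u \<and> local_weak_subsolution s p \<Omega> \<mu> u"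

definition U_fun :: "(real ^ 'n) set \<Rightarrow> real \<Rightarrow> real ^ 'n \<Rightarrow> real" where
  "U_fun \<Omega> \<beta> x = (if x \<in> \<Omega> then bdist \<Omega> x powr \<beta> else 0)"

definition open_half_space :: "(real ^ 'n) set \<Rightarrow> bool" where
  "open_half_space H \<longleftrightarrow> (\<exists>a b. a \<noteq> 0 \<and> H = {x. a \<bullet> x > b})"

end

theory Submission
  imports Defs
begin

text \<open>
  Write \<open>\<sigma> = s p\<close> and let \<open>D\<close> be the distance to the complement of \<open>\<Omega>\<close>; it is 1-Lipschitz on the whole space,
  and \<open>U\<^sub>\<beta> = D\<^sup>\<beta>\<close> everywhere. The proof evaluates the inner integral
  \<open>F\<^sub>\<theta>(x) = \<integral> J(U\<^sub>\<beta>(x) - U\<^sub>\<beta>(y)) / |x - y|\<^bsup>N+\<sigma>\<^esup> dy\<close>, where \<open>y\<close> ranges over the points whose ratio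
  \<open>D(y) / D(x)\<close> is outside the interval from \<open>\<theta>\<close> to \<open>1/\<theta>\<close>, and lets \<open>\<theta>\<close> tend to 1. This way of cutting off
  the diagonal has three virtues.

  First, it makes the half-space exact. There the integrand depends on one coordinate of \<open>y - x\<close> only, and
  integrating out the others turns the kernel \<open>|h|\<^bsup>-N-\<sigma>\<^esup>\<close> into \<open>C\<^bsub>N,\<sigma>\<^esub> |\<tau>|\<^bsup>-1-\<sigma>\<^esup>\<close>
  (\<open>nn_integral_kernel_ridge\<close>). On the line, scaling reduces to \<open>D(x) = 1\<close>, the points outside the
  half-line contribute \<open>1/\<sigma>\<close>, and the substitution \<open>t \<mapsto> 1/t\<close> folds the part beyond \<open>1/\<theta>\<close> onto the part below
  \<open>\<theta>\<close>. The sum is precisely the integral defining \<open>\<lambda>(\<beta>)/2\<close>, restricted to \<open>t \<le> \<theta>\<close>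
  (\<open>truncJ_half_line_integral\<close>); no principal value has to be estimated.

  Second, it respects comparison. For convex \<open>\<Omega>\<close>, the half-space supporting \<open>\<Omega>\<close> at the boundary point nearest
  to \<open>x\<close> has a distance function that is at least \<open>D\<close> and agrees with it at \<open>x\<close>
  (\<open>outdist_le_supporting_half_space\<close>). For \<open>\<beta> \<ge> 0\<close> the truncated integrand is a decreasing function of
  \<open>D(y)\<close> (\<open>truncJ_antimono\<close>), so \<open>F\<^sub>\<theta>(x)\<close> is bounded below by its value for the half-space.

  Third, it is symmetric in \<open>x\<close> and \<open>y\<close> and keeps \<open>y\<close> away from \<open>x\<close> when \<open>x\<close> is in the support of a test
  function \<open>\<phi>\<close>. Hence the truncated energy is \<open>2 \<integral> \<phi> F\<^sub>\<theta>\<close> by Fubini (\<open>trunc_energy\<close>). The energy integrand is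
  absolutely integrable (\<open>energy_integrable\<close>) and vanishes where \<open>D(x) = D(y)\<close>, so dominated convergence
  gives the full energy as \<open>\<theta> \<rightarrow> 1\<close> (\<open>energy_limit\<close>), while the bounds for \<open>F\<^sub>\<theta>\<close> converge to
  \<open>C\<^bsub>N,\<sigma>\<^esub> \<lambda>(\<beta>) D\<^bsup>\<beta>(p-1)-\<sigma>\<^esup> / 2\<close>.
\<close>

section \<open>Reduction of the kernel to one dimension\<close>

lemma nn_integral_lborel_translate:
  fixes f :: "'a::euclidean_space \<Rightarrow> ennreal"
  assumes [measurable]: "f \<in> borel_measurable borel"
  shows "(\<integral>\<^sup>+x. f (c + x) \<partial>lborel) = (\<integral>\<^sup>+x. f x \<partial>lborel)"
  by (subst (2) lborel_distr_plus[of c, symmetric]) (simp add: nn_integral_distr)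

lemma nn_integral_lborel_uminus:
  fixes f :: "'a::euclidean_space \<Rightarrow> ennreal"
  assumes [measurable]: "f \<in> borel_measurable borel"
  shows "(\<integral>\<^sup>+x. f (- x) \<partial>lborel) = (\<integral>\<^sup>+x. f x \<partial>lborel)"
  by (subst (2) lborel_affine[of "-1" 0]) (simp_all add: nn_integral_density nn_integral_distr)

text \<open>
  Let \<open>g\<close> be the indicator of the unit ball, which \<open>T\<close> preserves. Fubini and translation invariance give
  \<open>\<integral> f(T x) dx \<cdot> \<integral> g = \<integral>\<integral> f(T x + y) g(y) = \<integral>\<integral> f(y) g(y - T x) = \<integral> f \<cdot> \<integral> g\<close>, and \<open>\<integral> g\<close> is positive
  and finite.
\<close>

lemma nn_integral_lborel_orthogonal:
  fixes f :: "'a::euclidean_space \<Rightarrow> ennreal" and T :: "'a \<Rightarrow> 'a"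
  assumes T: "orthogonal_transformation T" and [measurable]: "f \<in> borel_measurable borel"
  shows "(\<integral>\<^sup>+x. f (T x) \<partial>lborel) = (\<integral>\<^sup>+x. f x \<partial>lborel)"
proof -
  interpret lin: linear T using T by (rule orthogonal_transformation_linear)
  have [measurable]: "T \<in> borel_measurable borel"
    by (intro borel_measurable_continuous_onI linear_continuous_on linear_conv_bounded_linear[THEN iffD1] lin.linear_axioms)
  define g :: "'a \<Rightarrow> ennreal" where "g = indicator (ball 0 1)"
  have [measurable]: "g \<in> borel_measurable borel" unfolding g_def by (intro borel_measurable_indicator) simp
  have gT: "g (T x) = g x" for x
    using T by (simp add: g_def indicator_def orthogonal_transformation_norm)
  have gm: "g (- x) = g x" for x by (simp add: g_def indicator_def)
  have gint: "(\<integral>\<^sup>+x. g x \<partial>lborel) = ennreal (measure lborel (ball (0::'a) 1))"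
    using emeasure_lborel_ball_finite[of "0::'a" 1]
    by (simp add: g_def emeasure_eq_ennreal_measure[symmetric] less_top)
  have pos: "measure lborel (ball (0::'a) 1) > 0" by simp
  have conv: "(\<integral>\<^sup>+x. g (y - T x) \<partial>lborel) = (\<integral>\<^sup>+x. g x \<partial>lborel)" for y
  proof -
    obtain z where z: "T z = y" using orthogonal_transformation_surj[OF T] by (metis surjD)
    have "(\<integral>\<^sup>+x. g (y - T x) \<partial>lborel) = (\<integral>\<^sup>+x. g (- (z - x)) \<partial>lborel)"
      by (simp only: gm) (simp add: z[symmetric] lin.diff[symmetric] gT)
    also have "\<dots> = (\<integral>\<^sup>+x. g (- z + x) \<partial>lborel)" by simp
    also have "\<dots> = (\<integral>\<^sup>+x. g x \<partial>lborel)" by (rule nn_integral_lborel_translate) simp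
    finally show ?thesis .
  qed
  have "(\<integral>\<^sup>+x. f (T x) \<partial>lborel) * (\<integral>\<^sup>+y. g y \<partial>lborel)
      = (\<integral>\<^sup>+y. (\<integral>\<^sup>+x. f (T x) \<partial>lborel) * g y \<partial>lborel)"
    by (simp add: nn_integral_cmult)
  also have "\<dots> = (\<integral>\<^sup>+y. (\<integral>\<^sup>+x. f (T x) * g y \<partial>lborel) \<partial>lborel)"
    by (simp add: nn_integral_multc)
  also have "\<dots> = (\<integral>\<^sup>+y. (\<integral>\<^sup>+x. f (T x + y) * g y \<partial>lborel) \<partial>lborel)"
  proof (rule nn_integral_cong)
    fix y :: 'a
    obtain z where z: "T z = y" using orthogonal_transformation_surj[OF T] by (metis surjD)
    have "(\<integral>\<^sup>+x. f (T x + y) * g y \<partial>lborel) = (\<integral>\<^sup>+x. f (T (z + x)) * g y \<partial>lborel)"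
      by (simp add: z[symmetric] lin.add add.commute)
    then show "(\<integral>\<^sup>+x. f (T x) * g y \<partial>lborel) = (\<integral>\<^sup>+x. f (T x + y) * g y \<partial>lborel)"
      using nn_integral_lborel_translate[of "\<lambda>x. f (T x) * g y" z] by simp
  qed
  also have "\<dots> = (\<integral>\<^sup>+x. (\<integral>\<^sup>+y. f (T x + y) * g y \<partial>lborel) \<partial>lborel)"
    by (rule lborel_pair.Fubini') simp
  also have "\<dots> = (\<integral>\<^sup>+x. (\<integral>\<^sup>+y. f y * g (y - T x) \<partial>lborel) \<partial>lborel)"
  proof (rule nn_integral_cong)
    fix x :: 'a
    show "(\<integral>\<^sup>+y. f (T x + y) * g y \<partial>lborel) = (\<integral>\<^sup>+y. f y * g (y - T x) \<partial>lborel)"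
      using nn_integral_lborel_translate[of "\<lambda>y. f y * g (y - T x)" "T x"] by simp
  qed
  also have "\<dots> = (\<integral>\<^sup>+y. (\<integral>\<^sup>+x. f y * g (y - T x) \<partial>lborel) \<partial>lborel)"
    by (rule lborel_pair.Fubini') simp
  also have "\<dots> = (\<integral>\<^sup>+y. f y \<partial>lborel) * (\<integral>\<^sup>+y. g y \<partial>lborel)"
    by (simp add: nn_integral_cmult nn_integral_multc conv)
  finally show ?thesis
    using pos unfolding gint by (simp add: mult.commute[of _ "ennreal _"] ennreal_mult_cancel_left ennreal_eq_0_iff)
qed

text \<open>
  The volume of balls says that the norm has the distribution function \<open>\<omega>\<^sub>m r\<^sup>m\<close> with \<open>m = card A\<close>; its
  derivative is the density. Coordinates are indexed by a finite set rather than a type because the lemma is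
  applied to the hyperplane spanned by all basis vectors but one.
\<close>

lemma nn_integral_radial_PiM:
  fixes A :: "'a set" and G :: "real \<Rightarrow> ennreal"
  assumes A: "finite A" "A \<noteq> {}" and [measurable]: "G \<in> borel_measurable borel"
  shows "(\<integral>\<^sup>+x. G (sqrt (\<Sum>i\<in>A. (x i)\<^sup>2)) \<partial>Pi\<^sub>M A (\<lambda>_. lborel))
       = (\<integral>\<^sup>+r. G r * (ennreal (real (card A) * unit_ball_vol (card A) * r ^ (card A - 1))
             * indicator {0..} r) \<partial>lborel)"
proof -
  define m where "m = card A"
  have m: "m \<ge> 1" using A by (simp add: m_def Suc_le_eq card_gt_0_iff)
  define w where "w = (\<lambda>r::real. ennreal (real m * unit_ball_vol m * r ^ (m - 1)) * indicator {0..} r)"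
  have [measurable]: "w \<in> borel_measurable borel" by (simp add: w_def)
  define P where "P = Pi\<^sub>M A (\<lambda>_. lborel :: real measure)"
  define n where "n = (\<lambda>x::'a \<Rightarrow> real. sqrt (\<Sum>i\<in>A. (x i)\<^sup>2))"
  have n_meas [measurable]: "n \<in> borel_measurable P" unfolding P_def n_def by measurable
  have eq1: "emeasure (distr P borel n) {..r} = (if r < 0 then 0 else ennreal (unit_ball_vol m * r ^ m))" if "r \<noteq> 0" for r
  proof (cases "r < 0")
    case True
    then have "n -` {..r} \<inter> space P = {}"
      using order_trans[OF real_sqrt_ge_zero[OF sum_nonneg[of A "\<lambda>i. (_ i)\<^sup>2"]]] by (fastforce simp: n_def)
    then show ?thesis using True by (simp add: emeasure_distr)
  next
    case False
    have "emeasure (distr P borel n) {..r} = emeasure P ({f. sqrt (\<Sum>i\<in>A. (f i)\<^sup>2) \<le> r} \<inter> space P)"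
      by (simp add: emeasure_distr) (auto simp: n_def vimage_def)
    also have "\<dots> = ennreal (unit_ball_vol m * r ^ m)"
      using emeasure_cball_aux[OF A(1), of r] False that by (simp add: P_def m_def)
    finally show ?thesis using False by simp
  qed
  have eq2: "emeasure (density lborel w) {..r} = (if r < 0 then 0 else ennreal (unit_ball_vol m * r ^ m))" for r
  proof (cases "r < 0")
    case True
    then show ?thesis
      by (simp add: emeasure_density w_def) (rule nn_integral_0_iff_AE[THEN iffD2], auto simp: indicator_def)
  next
    case False
    have "emeasure (density lborel w) {..r}
        = (\<integral>\<^sup>+x. ennreal (real m * unit_ball_vol m * x ^ (m - 1)) * indicator {0..r} x \<partial>lborel)"
      by (simp add: emeasure_density w_def) (rule nn_integral_cong, auto simp: indicator_def)
    also have "\<dots> = ennreal (unit_ball_vol m * r ^ m - unit_ball_vol m * 0 ^ m)"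
      using False by (intro nn_integral_FTC_Icc) (auto intro!: derivative_eq_intros)
    finally show ?thesis using False m by simp
  qed
  have "distr P borel n = density lborel w"
  proof (rule measure_eqI_generator_eq[where E = "range (\<lambda>r::real. {..r})" and \<Omega> = UNIV and A = "\<lambda>i. {..real (Suc i)}"])
    show "Int_stable (range (\<lambda>r::real. {..r}))"
      by (auto simp: Int_stable_def)
    show "sets (distr P borel n) = sigma_sets UNIV (range (\<lambda>r::real. {..r}))"
      by (simp add: borel_eq_atMost)
    show "sets (density lborel w) = sigma_sets UNIV (range (\<lambda>r::real. {..r}))"
      by (simp add: borel_eq_atMost)
    show "(\<Union>i. {..real (Suc i)}) = UNIV"
    proof safe
      fix x :: real
      obtain i where "x \<le> real i" using real_arch_simple by blast
      then show "x \<in> (\<Union>i. {..real (Suc i)})" by (intro UN_I[of i]) auto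
    qed auto
    fix X assume "X \<in> range (\<lambda>r::real. {..r})"
    then obtain r where X: "X = {..r}" by auto
    show "emeasure (distr P borel n) X = emeasure (density lborel w) X"
    (* The ball formula covers positive radii only; at 0 the balls of radius e shrink to a null set. *)
    proof (cases "r = 0")
      case False
      then show ?thesis by (simp only: X eq1[OF False] eq2)
    next
      case True
      have "emeasure (distr P borel n) {..0} \<le> ennreal (unit_ball_vol m * e)" if e: "0 < e" "e < 1" for e
      proof -
        have "emeasure (distr P borel n) {..0} \<le> emeasure (distr P borel n) {..e}"
          using e by (intro emeasure_mono) auto
        also have "\<dots> = ennreal (unit_ball_vol m * e ^ m)" using eq1[of e] e by simp
        also have "\<dots> \<le> ennreal (unit_ball_vol m * e)"
          using e m power_decreasing[of 1 m e] by (intro ennreal_leI mult_left_mono) auto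
        finally show ?thesis .
      qed
      then have "emeasure (distr P borel n) {..0} \<le> 0"
        by (intro tendsto_lowerbound[where F="at_right 0" and f="\<lambda>e. ennreal (unit_ball_vol m * e)"])
           (auto intro!: tendsto_eq_intros tendsto_ennrealI eventually_at_right_less simp flip: ennreal_0
             simp: eventually_at_right[of 0 1] intro: exI[of _ 1])
      moreover have "emeasure (density lborel w) {..0} = 0" using eq2[of 0] m by simp
      ultimately show ?thesis by (simp add: X True)
    qed
  next
    fix i show "emeasure (distr P borel n) {..real (Suc i)} \<noteq> \<infinity>"
      using eq1[of "real (Suc i)"] by simp
  qed auto
  then have "(\<integral>\<^sup>+r. G r \<partial>distr P borel n) = (\<integral>\<^sup>+r. G r \<partial>density lborel w)" by simp
  then have "(\<integral>\<^sup>+x. G (n x) \<partial>P) = (\<integral>\<^sup>+r. w r * G r \<partial>lborel)"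
    by (simp add: nn_integral_distr nn_integral_density)
  then show ?thesis unfolding P_def n_def w_def m_def by (simp add: mult_ac)
qed

text \<open>
  Since \<open>t\<^bsup>N-2\<^esup> \<le> (1 + t\<^sup>2)\<^bsup>(N-2)/2\<^esup>\<close>, the integrand is at most \<open>1 / (1 + t\<^sup>2)\<close>.
\<close>

lemma C_const_integrable:
  assumes "N \<ge> 2" "\<sigma> > (0::real)"
  shows "set_integrable lborel {0<..} (\<lambda>t. t ^ (N - 2) * (1 + t\<^sup>2) powr (- ((real N + \<sigma>) / 2)))"
proof -
  define f where "f = (\<lambda>t::real. t ^ (N - 2) * (1 + t\<^sup>2) powr (- ((real N + \<sigma>) / 2)))"
  have [measurable]: "f \<in> borel_measurable borel" unfolding f_def by measurable
  have f0: "f t \<ge> 0" if "t > 0" for t using that by (simp add: f_def)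
  have le: "f t \<le> (1 + t\<^sup>2) powr (-1)" if t: "t > 0" for t
  proof -
    have "t ^ (N - 2) = (t\<^sup>2) powr (real (N - 2) / 2)"
      using t by (simp add: powr_powr flip: powr_realpow powr_numeral)
    also have "\<dots> \<le> (1 + t\<^sup>2) powr (real (N - 2) / 2)"
      by (intro powr_mono2) auto
    finally have "f t \<le> (1 + t\<^sup>2) powr (real (N - 2) / 2) * (1 + t\<^sup>2) powr (- ((real N + \<sigma>) / 2))"
      unfolding f_def by (intro mult_right_mono) auto
    also have "\<dots> = (1 + t\<^sup>2) powr (real (N - 2) / 2 + (- ((real N + \<sigma>) / 2)))"
      by (rule powr_add[symmetric])
    also have "\<dots> \<le> (1 + t\<^sup>2) powr (-1)"
      using assms by (intro powr_mono) (auto simp: of_nat_diff field_simps)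
    finally show ?thesis .
  qed
  have le1: "f t \<le> 1" if "t > 0" for t
  proof -
    have "(1 + t\<^sup>2) powr (-1) \<le> (1 + t\<^sup>2) powr 0" by (intro powr_mono) auto
    also have "\<dots> = 1" using sum_power2_gt_zero_iff[of 1 t] by simp
    finally show ?thesis using le[OF that] by simp
  qed
  have le2: "f t \<le> t powr (-2)" if "t > 0" for t
  proof -
    have "(1 + t\<^sup>2) powr (-1) \<le> (t\<^sup>2) powr (-1)" using that by (intro powr_mono2') auto
    also have "\<dots> = (t powr 2) powr (-1)" using that by simp
    also have "\<dots> = t powr (-2)" by (simp only: powr_powr) simp
    finally show ?thesis using le[OF that] by simp
  qed
  have "(\<integral>\<^sup>+t. ennreal (norm (indicator {0<..} t *\<^sub>R f t)) \<partial>lborel)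
      \<le> (\<integral>\<^sup>+t. indicator {0..1} t + ennreal (indicator {1..} t * t powr (-2)) \<partial>lborel)"
  proof (intro nn_integral_mono)
    fix t :: real
    show "ennreal (norm (indicator {0<..} t *\<^sub>R f t))
        \<le> indicator {0..1} t + ennreal (indicator {1..} t * t powr (-2))"
    proof (cases "t > 0")
      case True
      have eq: "norm (indicator {0<..} t *\<^sub>R f t) = f t" using True f0[OF True] by simp
      have b: "ennreal (f t) \<le> 1" "ennreal (f t) \<le> ennreal (t powr (-2))"
        using le1[OF True] le2[OF True] by (simp_all add: ennreal_leI)
      have one: "1 \<le> indicator {0..1} t + ennreal (indicator {1..} t * t powr (-2))" if "t \<le> 1"
        using True that by (simp add: add_increasing2)
      show ?thesis unfolding eq
      proof (cases "t \<le> 1")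
        case True
        then show "ennreal (f t) \<le> indicator {0..1} t + ennreal (indicator {1..} t * t powr (-2))"
          using order_trans[OF b(1) one] by simp
      next
        case False
        then show "ennreal (f t) \<le> indicator {0..1} t + ennreal (indicator {1..} t * t powr (-2))"
          using b(2) by simp
      qed
    qed auto
  qed
  also have "\<dots> = (\<integral>\<^sup>+t. indicator {0..1::real} t \<partial>lborel)
      + (\<integral>\<^sup>+t. ennreal (indicator {1..} t * t powr (-2)) \<partial>lborel)"
    by (rule nn_integral_add) auto
  also have "(\<integral>\<^sup>+t. ennreal (indicator {1..} t * t powr (-2)) \<partial>lborel) = ennreal (- (1 powr (-2 + 1)) / (-2 + 1))"
    by (rule nn_integral_has_integral_lebesgue[OF _ has_integral_powr_to_inf]) auto
  finally have "(\<integral>\<^sup>+t. ennreal (norm (indicator {0<..} t *\<^sub>R f t)) \<partial>lborel) < \<infinity>"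
    by (auto simp: less_top[symmetric] top_unique)
  then show ?thesis
    unfolding set_integrable_def f_def[symmetric] by (intro integrableI_bounded) auto
qed

lemma C_const_nn_integral:
  assumes "N \<ge> 2" "\<sigma> > (0::real)"
  shows "(\<integral>\<^sup>+t. ennreal ((1 + t\<^sup>2) powr (- ((real N + \<sigma>) / 2))) *
             (ennreal (real (N - 1) * unit_ball_vol (real (N - 1)) * t ^ (N - 2)) * indicator {0..} t) \<partial>lborel)
       = ennreal (C_const N \<sigma>)"
proof -
  define f where "f = (\<lambda>t::real. t ^ (N - 2) * (1 + t\<^sup>2) powr (- ((real N + \<sigma>) / 2)))"
  have [measurable]: "f \<in> borel_measurable borel" unfolding f_def by measurable
  define w where "w = real (N - 1) * unit_ball_vol (real (N - 1))"
  have w: "w \<ge> 0" by (simp add: w_def)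
  have "(\<integral>\<^sup>+t. ennreal ((1 + t\<^sup>2) powr (- ((real N + \<sigma>) / 2))) *
             (ennreal (w * t ^ (N - 2)) * indicator {0..} t) \<partial>lborel)
      = (\<integral>\<^sup>+t. ennreal w * ennreal (indicator {0<..} t *\<^sub>R f t) \<partial>lborel)"
    using AE_lborel_singleton[of "0::real"]
    by (intro nn_integral_cong_AE)
       (auto elim!: eventually_mono simp: indicator_def f_def w ennreal_mult[symmetric] mult_ac)
  also have "\<dots> = ennreal w * ennreal (LBINT t:{0<..}. f t)"
    using C_const_integrable[OF assms] unfolding set_integrable_def set_lebesgue_integral_def f_def[symmetric]
    by (subst nn_integral_cmult; simp?; subst nn_integral_eq_integral)
       (auto simp: indicator_def f_def)
  also have "\<dots> = ennreal (C_const N \<sigma>)"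
    using assms w unfolding set_lebesgue_integral_def
    by (subst ennreal_mult[symmetric])
       (auto simp: C_const_def w_def f_def set_lebesgue_integral_def indicator_def intro!: integral_nonneg_AE AE_I2)
  finally show ?thesis by (simp add: w_def)
qed

lemma C_const_nonneg: "\<sigma> > 0 \<Longrightarrow> C_const N \<sigma> \<ge> 0"
  by (auto simp: C_const_def set_lebesgue_integral_def indicator_def intro!: integral_nonneg_AE AE_I2)

text \<open>
  In polar coordinates, \<open>r = |\<tau>| t\<close> collects the power \<open>1 - (N + \<sigma>) + (N - 2) = -1 - \<sigma>\<close> of \<open>|\<tau>|\<close> and leaves
  the integral in \<open>C_const\<close>. For empty \<open>A\<close> the product space is a single point, in accordance with the value 1
  of the constant in dimension 1.
\<close>

lemma nn_integral_kernel_hyperplane: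
  fixes A :: "'a set" and \<sigma> \<tau> :: real
  assumes A: "finite A" and \<sigma>: "\<sigma> > 0" and \<tau>: "\<tau> \<noteq> 0"
  defines "N \<equiv> card A + 1"
  shows "(\<integral>\<^sup>+x. ennreal (1 / sqrt (\<tau>\<^sup>2 + (\<Sum>i\<in>A. (x i)\<^sup>2)) powr (real N + \<sigma>)) \<partial>Pi\<^sub>M A (\<lambda>_. lborel))
       = ennreal (C_const N \<sigma>) * ennreal (1 / \<bar>\<tau>\<bar> powr (1 + \<sigma>))"
proof (cases "A = {}")
  case True
  then show ?thesis
    by (simp add: PiM_empty N_def C_const_def nn_integral_count_space_finite)
next
  case False
  with A have N: "N \<ge> 2" by (simp add: N_def Suc_le_eq card_gt_0_iff)
  define m where "m = real (N - 1) * unit_ball_vol (real (N - 1))"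
  have m: "m \<ge> 0" by (simp add: m_def)
  define G where "G = (\<lambda>r. ennreal (1 / sqrt (\<tau>\<^sup>2 + r\<^sup>2) powr (real N + \<sigma>)))"
  have [measurable]: "G \<in> borel_measurable borel" by (simp add: G_def)
  have "(\<integral>\<^sup>+x. ennreal (1 / sqrt (\<tau>\<^sup>2 + (\<Sum>i\<in>A. (x i)\<^sup>2)) powr (real N + \<sigma>)) \<partial>Pi\<^sub>M A (\<lambda>_. lborel))
      = (\<integral>\<^sup>+x. G (sqrt (\<Sum>i\<in>A. (x i)\<^sup>2)) \<partial>Pi\<^sub>M A (\<lambda>_. lborel))"
    by (simp add: G_def sum_nonneg)
  also have "\<dots> = (\<integral>\<^sup>+r. G r * (ennreal (m * r ^ (N - 2)) * indicator {0..} r) \<partial>lborel)"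
    by (subst nn_integral_radial_PiM) (auto simp: A False N_def m_def)
  also have "\<dots> = \<bar>\<tau>\<bar> * (\<integral>\<^sup>+t. G (0 + \<bar>\<tau>\<bar> * t) * (ennreal (m * (0 + \<bar>\<tau>\<bar> * t) ^ (N - 2)) * indicator {0..} (0 + \<bar>\<tau>\<bar> * t)) \<partial>lborel)"
    using \<tau> by (subst nn_integral_real_affine[of _ "\<bar>\<tau>\<bar>" 0]) auto
  also have "\<dots> = (\<integral>\<^sup>+t. ennreal (1 / \<bar>\<tau>\<bar> powr (1 + \<sigma>)) * (ennreal ((1 + t\<^sup>2) powr (- ((real N + \<sigma>) / 2))) *
             (ennreal (m * t ^ (N - 2)) * indicator {0..} t)) \<partial>lborel)"
  proof (subst nn_integral_cmult[symmetric]; (measurable)?; intro nn_integral_cong)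
    fix t :: real
    show "ennreal \<bar>\<tau>\<bar> * (G (0 + \<bar>\<tau>\<bar> * t) * (ennreal (m * (0 + \<bar>\<tau>\<bar> * t) ^ (N - 2)) * indicator {0..} (0 + \<bar>\<tau>\<bar> * t)))
       = ennreal (1 / \<bar>\<tau>\<bar> powr (1 + \<sigma>)) * (ennreal ((1 + t\<^sup>2) powr (- ((real N + \<sigma>) / 2))) *
             (ennreal (m * t ^ (N - 2)) * indicator {0..} t))"
    proof (cases "t \<ge> 0")
      case False
      then have "\<not> \<bar>\<tau>\<bar> * t \<ge> 0" using \<tau> by (simp add: zero_le_mult_iff)
      with False show ?thesis by simp
    next
      case True
      define a where "a = \<bar>\<tau>\<bar>"
      have a: "a > 0" using \<tau> by (simp add: a_def)
      have "sqrt (\<tau>\<^sup>2 + (a * t)\<^sup>2) = a * sqrt (1 + t\<^sup>2)"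
      proof -
        have "\<tau>\<^sup>2 + (a * t)\<^sup>2 = a\<^sup>2 * (1 + t\<^sup>2)" by (simp add: a_def algebra_simps power_mult_distrib)
        then show ?thesis using a by (simp add: real_sqrt_mult)
      qed
      then have e1: "1 / sqrt (\<tau>\<^sup>2 + (a * t)\<^sup>2) powr (real N + \<sigma>)
          = a powr (- (real N + \<sigma>)) * (1 + t\<^sup>2) powr (- ((real N + \<sigma>) / 2))"
        using a by (simp add: powr_mult powr_minus_divide powr_half_sqrt[symmetric] powr_powr del: minus_add_distrib)
      have e2: "a * (a powr (- (real N + \<sigma>)) * a ^ (N - 2)) = 1 / a powr (1 + \<sigma>)"
      proof -
        have "a * (a powr (- (real N + \<sigma>)) * a ^ (N - 2)) = a powr 1 * (a powr (- (real N + \<sigma>)) * a powr (real (N - 2)))"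
          using a by (simp add: powr_realpow)
        also have "\<dots> = a powr (1 + (- (real N + \<sigma>) + real (N - 2)))" by (simp add: powr_add)
        also have "1 + (- (real N + \<sigma>) + real (N - 2)) = - (1 + \<sigma>)" using N by (simp add: of_nat_diff)
        finally show ?thesis by (simp only: powr_minus_divide)
      qed
      have e3: "a * ((a powr (- (real N + \<sigma>)) * (1 + t\<^sup>2) powr (- ((real N + \<sigma>) / 2))) * (m * (a * t) ^ (N - 2)))
          = (a * (a powr (- (real N + \<sigma>)) * a ^ (N - 2))) * ((1 + t\<^sup>2) powr (- ((real N + \<sigma>) / 2)) * (m * t ^ (N - 2)))"
        by (simp add: power_mult_distrib)
      then show ?thesis using True a m
        unfolding a_def[symmetric] G_def add_0 e1
        by (simp add: ennreal_mult[symmetric] del: ennreal_mult'' minus_add_distrib) (simp only: e3[unfolded e2] times_divide_eq_left mult_1_left)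
    qed
  qed
  also have "\<dots> = ennreal (1 / \<bar>\<tau>\<bar> powr (1 + \<sigma>)) * ennreal (C_const N \<sigma>)"
    by (subst nn_integral_cmult) (simp, simp only: C_const_nn_integral[OF N \<sigma>] m_def)
  finally show ?thesis by (simp add: mult.commute)
qed

lemma nn_integral_kernel_ridge_Basis:
  fixes g :: "real \<Rightarrow> ennreal" and b :: "'a::euclidean_space"
  assumes b: "b \<in> Basis" and \<sigma>: "\<sigma> > 0" and [measurable]: "g \<in> borel_measurable borel"
  shows "(\<integral>\<^sup>+h. g (b \<bullet> h) * ennreal (1 / norm h powr (real DIM('a) + \<sigma>)) \<partial>lborel)
       = ennreal (C_const DIM('a) \<sigma>) * (\<integral>\<^sup>+\<tau>. g \<tau> * ennreal (1 / \<bar>\<tau>\<bar> powr (1 + \<sigma>)) \<partial>lborel)"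
proof -
  define A where "A = Basis - {b}"
  have A: "finite A" "b \<notin> A" "insert b A = Basis" "card A + 1 = DIM('a)"
    using b by (auto simp: A_def card_gt_0_iff)
  interpret product_sigma_finite "\<lambda>_::'a. lborel :: real measure" ..
  define v where "v = (\<lambda>f::'a \<Rightarrow> real. \<Sum>i\<in>Basis. f i *\<^sub>R i)"
  have [measurable]: "v \<in> borel_measurable (Pi\<^sub>M Basis (\<lambda>_. lborel))"
    unfolding v_def by measurable
  have comp: "(\<lambda>f. f i) \<in> borel_measurable (Pi\<^sub>M (insert b A) (\<lambda>_. lborel :: real measure))"
    if "i \<in> insert b A" for i
    using measurable_component_singleton[OF that, of "\<lambda>_. lborel :: real measure"] by simp
  have [measurable]: "(\<lambda>f. (f b, \<Sum>i\<in>A. (f i)\<^sup>2)) \<in> borel_measurable (Pi\<^sub>M (insert b A) (\<lambda>_. lborel :: real measure))"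
    by (intro borel_measurable_Pair borel_measurable_sum borel_measurable_power comp) auto
  have inner_v: "b \<bullet> v f = f b" for f
    using b by (simp add: v_def inner_sum_right inner_Basis if_distrib cong: if_cong)
  have norm_v: "norm (v f) = sqrt ((f b)\<^sup>2 + (\<Sum>i\<in>A. (f i)\<^sup>2))" for f
  proof -
    have "norm (v f) = sqrt (\<Sum>i\<in>Basis. (f i)\<^sup>2)"
      unfolding norm_eq_sqrt_inner
      by (subst euclidean_inner) (simp add: v_def inner_sum_left inner_Basis power2_eq_square if_distrib cong: if_cong)
    also have "(\<Sum>i\<in>Basis. (f i)\<^sup>2) = (\<Sum>i\<in>insert b A. (f i)\<^sup>2)" by (simp only: A(3))
    finally show ?thesis using A(1,2) by simp
  qed
  let ?k = "\<lambda>r. ennreal (1 / r powr (real DIM('a) + \<sigma>))"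
  have "(\<integral>\<^sup>+h. g (b \<bullet> h) * ?k (norm h) \<partial>lborel)
      = (\<integral>\<^sup>+f. g (b \<bullet> v f) * ?k (norm (v f)) \<partial>Pi\<^sub>M Basis (\<lambda>_. lborel))"
    by (subst lborel_eq) (simp add: nn_integral_distr v_def[symmetric])
  also have "\<dots> = (\<integral>\<^sup>+f. g (f b) * ?k (sqrt ((f b)\<^sup>2 + (\<Sum>i\<in>A. (f i)\<^sup>2))) \<partial>Pi\<^sub>M (insert b A) (\<lambda>_. lborel))"
    by (simp add: inner_v norm_v A(3))
  also have "\<dots> = (\<integral>\<^sup>+\<tau>. (\<integral>\<^sup>+f. g \<tau> * ?k (sqrt (\<tau>\<^sup>2 + (\<Sum>i\<in>A. ((f(b:=\<tau>)) i)\<^sup>2))) \<partial>Pi\<^sub>M A (\<lambda>_. lborel)) \<partial>lborel)"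
  proof -
    have "(\<lambda>z. g (fst z) * ?k (sqrt ((fst z)\<^sup>2 + snd z))) \<in> borel_measurable (borel \<Otimes>\<^sub>M borel)"
      by simp
    then have "(\<lambda>z. g (fst z) * ?k (sqrt ((fst z)\<^sup>2 + snd z))) \<in> borel_measurable borel"
      by (simp only: borel_prod)
    from measurable_compose[OF \<open>(\<lambda>f. (f b, \<Sum>i\<in>A. (f i)\<^sup>2)) \<in> _\<close> this]
    show ?thesis
      by (subst product_nn_integral_insert_rev[OF A(1,2)]) (simp_all only: fst_conv snd_conv fun_upd_same)
  qed
  also have "\<dots> = (\<integral>\<^sup>+\<tau>. (\<integral>\<^sup>+f. g \<tau> * ?k (sqrt (\<tau>\<^sup>2 + (\<Sum>i\<in>A. (f i)\<^sup>2))) \<partial>Pi\<^sub>M A (\<lambda>_. lborel)) \<partial>lborel)"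
    using A(2) by (intro nn_integral_cong arg_cong[where f="\<lambda>x. _ * ?k (sqrt (_ + x))"] sum.cong) auto
  also have "\<dots> = (\<integral>\<^sup>+\<tau>. g \<tau> * (\<integral>\<^sup>+f. ?k (sqrt (\<tau>\<^sup>2 + (\<Sum>i\<in>A. (f i)\<^sup>2))) \<partial>Pi\<^sub>M A (\<lambda>_. lborel)) \<partial>lborel)"
    by (intro nn_integral_cong nn_integral_cmult) measurable
  also have "\<dots> = (\<integral>\<^sup>+\<tau>. g \<tau> * (ennreal (C_const DIM('a) \<sigma>) * ennreal (1 / \<bar>\<tau>\<bar> powr (1 + \<sigma>))) \<partial>lborel)"
    using AE_lborel_singleton[of "0::real"]
    by (intro nn_integral_cong_AE, elim eventually_mono)
       (simp add: nn_integral_kernel_hyperplane[OF A(1) \<sigma>, unfolded A(4)])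
  also have "\<dots> = (\<integral>\<^sup>+\<tau>. ennreal (C_const DIM('a) \<sigma>) * (g \<tau> * ennreal (1 / \<bar>\<tau>\<bar> powr (1 + \<sigma>))) \<partial>lborel)"
    by (simp add: mult_ac)
  also have "\<dots> = ennreal (C_const DIM('a) \<sigma>) * (\<integral>\<^sup>+\<tau>. g \<tau> * ennreal (1 / \<bar>\<tau>\<bar> powr (1 + \<sigma>)) \<partial>lborel)"
    by (rule nn_integral_cmult) measurable
  finally show ?thesis .
qed

text \<open>
  The central reduction: integrating out the directions orthogonal to a unit vector \<open>e\<close> leaves the
  one-dimensional kernel of the same order. A rotation carries \<open>e\<close> to a basis vector.
\<close>

lemma nn_integral_kernel_ridge:
  fixes g :: "real \<Rightarrow> ennreal" and e :: "real ^ 'n"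
  assumes e: "norm e = 1" and \<sigma>: "\<sigma> > 0" and [measurable]: "g \<in> borel_measurable borel"
  shows "(\<integral>\<^sup>+h. g (e \<bullet> h) * ennreal (1 / norm h powr (real CARD('n) + \<sigma>)) \<partial>lborel)
       = ennreal (C_const CARD('n) \<sigma>) * (\<integral>\<^sup>+\<tau>. g \<tau> * ennreal (1 / \<bar>\<tau>\<bar> powr (1 + \<sigma>)) \<partial>lborel)"
proof -
  obtain b :: "real ^ 'n" where b: "b \<in> Basis" using nonempty_Basis by blast
  obtain T where T: "orthogonal_transformation T" "T b = e"
    using orthogonal_transformation_exists[of b e] e b by auto
  have "e \<bullet> T h = b \<bullet> h" for h
    using T by (metis orthogonal_transformation_def)
  then show ?thesis
    using nn_integral_kernel_ridge_Basis[OF b \<sigma>, of g]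
      nn_integral_lborel_orthogonal[OF T(1), of "\<lambda>h. g (e \<bullet> h) * ennreal (1 / norm h powr (real CARD('n) + \<sigma>))"]
    by (simp add: orthogonal_transformation_norm[OF T(1)])
qed

text \<open>
  The signed version, obtained from the positive and negative parts.
\<close>

lemma kernel_ridge_integral:
  fixes g :: "real \<Rightarrow> real" and e :: "real ^ 'n"
  assumes e: "norm e = 1" and \<sigma>: "\<sigma> > 0" and g [measurable]: "g \<in> borel_measurable borel"
    and int: "integrable lborel (\<lambda>\<tau>. g \<tau> / \<bar>\<tau>\<bar> powr (1 + \<sigma>))"
  shows "integrable lborel (\<lambda>h. g (e \<bullet> h) / norm h powr (real CARD('n) + \<sigma>))" (is ?A)
    and "(LINT h|lborel. g (e \<bullet> h) / norm h powr (real CARD('n) + \<sigma>))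
       = C_const CARD('n) \<sigma> * (LINT \<tau>|lborel. g \<tau> / \<bar>\<tau>\<bar> powr (1 + \<sigma>))" (is ?B)
proof -
  define C where "C = C_const CARD('n) \<sigma>"
  have C: "C \<ge> 0" using C_const_nonneg[OF \<sigma>] by (simp add: C_def)
  have main: "(\<integral>\<^sup>+h. ennreal (f (e \<bullet> h) / norm h powr (real CARD('n) + \<sigma>)) \<partial>lborel)
      = ennreal C * (\<integral>\<^sup>+\<tau>. ennreal (f \<tau> / \<bar>\<tau>\<bar> powr (1 + \<sigma>)) \<partial>lborel)"
    if [measurable]: "f \<in> borel_measurable borel" for f :: "real \<Rightarrow> real"
  proof -
    have *: "ennreal (a / b) = ennreal a * ennreal (1 / b)" if "b \<ge> 0" for a b :: real
      using that by (simp flip: ennreal_mult'')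
    show ?thesis
      unfolding C_def using nn_integral_kernel_ridge[OF e \<sigma>, of "\<lambda>x. ennreal (f x)"] by (simp add: *[where a = "f _"])
  qed
  have fin: "(\<integral>\<^sup>+\<tau>. ennreal (norm (g \<tau> / \<bar>\<tau>\<bar> powr (1 + \<sigma>))) \<partial>lborel) < \<infinity>"
    using int by (simp add: integrable_iff_bounded)
  show ?A
  proof (intro integrableI_bounded)
    have "(\<integral>\<^sup>+h. ennreal (norm (g (e \<bullet> h) / norm h powr (real CARD('n) + \<sigma>))) \<partial>lborel)
        = ennreal C * (\<integral>\<^sup>+\<tau>. ennreal (norm (g \<tau> / \<bar>\<tau>\<bar> powr (1 + \<sigma>))) \<partial>lborel)"
      using main[of "\<lambda>x. \<bar>g x\<bar>"] by simp
    then show "(\<integral>\<^sup>+h. ennreal (norm (g (e \<bullet> h) / norm h powr (real CARD('n) + \<sigma>))) \<partial>lborel) < \<infinity>"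
      using fin by (simp add: ennreal_mult_less_top)
  qed simp
  then show ?B
    using int main[of g] main[of "\<lambda>x. - g x"] C
    by (simp add: real_lebesgue_integral_def enn2real_mult right_diff_distrib C_def[symmetric])
qed

lemma nn_integral_even_finite:
  fixes f :: "real \<Rightarrow> ennreal"
  assumes [measurable]: "f \<in> borel_measurable borel" and even: "\<And>x. f (- x) = f x"
    and fin: "(\<integral>\<^sup>+x. indicator {0..} x * f x \<partial>lborel) < \<infinity>"
  shows "(\<integral>\<^sup>+x. f x \<partial>lborel) < \<infinity>"
proof -
  have "(\<integral>\<^sup>+x. f x \<partial>lborel) \<le> (\<integral>\<^sup>+x. indicator {0..} x * f x + indicator {0..} (- x) * f (- x) \<partial>lborel)"
    by (rule nn_integral_mono) (auto simp: indicator_def even)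
  also have "\<dots> = (\<integral>\<^sup>+x. indicator {0..} x * f x \<partial>lborel) + (\<integral>\<^sup>+x. indicator {0..} (- x) * f (- x) \<partial>lborel)"
    by (rule nn_integral_add) auto
  also have "(\<integral>\<^sup>+x. indicator {0..} (- x) * f (- x) \<partial>lborel) = (\<integral>\<^sup>+x. indicator {0..} x * f x \<partial>lborel)"
    by (rule nn_integral_lborel_uminus[of "\<lambda>x. indicator {0..} x * f x"]) simp
  finally have "(\<integral>\<^sup>+x. f x \<partial>lborel) \<le> (\<integral>\<^sup>+x. indicator {0..} x * f x \<partial>lborel) + (\<integral>\<^sup>+x. indicator {0..} x * f x \<partial>lborel)" .
  also have "(\<integral>\<^sup>+x. indicator {0..} x * f x \<partial>lborel) + (\<integral>\<^sup>+x. indicator {0..} x * f x \<partial>lborel) < \<infinity>"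
    using fin by (simp add: ennreal_add_less_top)
  finally show ?thesis by simp
qed

text \<open>
  Some coordinate of \<open>h\<close> is comparable to its norm, so finiteness of integrals of radial functions against the
  kernel can be checked on functions of a single coordinate.
\<close>

lemma kernel_sum_of_ridges_finite:
  fixes F :: "real ^ 'n \<Rightarrow> ennreal" and f :: "real \<Rightarrow> ennreal"
  assumes \<sigma>: "\<sigma> > 0" and [measurable]: "f \<in> borel_measurable borel"
    and le: "\<And>h. F h \<le> (\<Sum>b\<in>Basis. f (b \<bullet> h))"
    and fin: "(\<integral>\<^sup>+\<tau>. f \<tau> * ennreal (1 / \<bar>\<tau>\<bar> powr (1 + \<sigma>)) \<partial>lborel) < \<infinity>"
  shows "(\<integral>\<^sup>+h. F h * ennreal (1 / norm h powr (real CARD('n) + \<sigma>)) \<partial>lborel) < \<infinity>"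
proof -
  have "(\<integral>\<^sup>+h. F h * ennreal (1 / norm h powr (real CARD('n) + \<sigma>)) \<partial>lborel)
      \<le> (\<integral>\<^sup>+(h :: real ^ 'n). (\<Sum>b\<in>Basis. f (b \<bullet> h) * ennreal (1 / norm h powr (real CARD('n) + \<sigma>))) \<partial>lborel)"
    by (rule nn_integral_mono) (auto simp: sum_distrib_right[symmetric] intro!: mult_right_mono le)
  also have "\<dots> = (\<Sum>b\<in>(Basis :: (real ^ 'n) set). (\<integral>\<^sup>+h. f (b \<bullet> h) * ennreal (1 / norm h powr (real CARD('n) + \<sigma>)) \<partial>lborel))"
    by (intro nn_integral_sum) simp
  also have "\<dots> < \<infinity>"
    using fin by (simp add: nn_integral_kernel_ridge[OF norm_Basis \<sigma>] ennreal_mult_less_top of_nat_less_top)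
  finally show ?thesis .
qed

text \<open>
  If \<open>|h| \<ge> \<delta>\<close>, some coordinate of \<open>h\<close> is at least \<open>\<delta>/N\<close> in modulus, and \<open>|\<tau>|\<^bsup>-1-\<sigma>\<^esup>\<close> is integrable away
  from 0.
\<close>

lemma kernel_far_finite:
  fixes \<delta> \<sigma> :: real
  assumes \<delta>: "\<delta> > 0" and \<sigma>: "\<sigma> > 0"
  shows "(\<integral>\<^sup>+h. indicator {h. \<delta> \<le> norm h} h * ennreal (1 / norm (h :: real ^ 'n) powr (real CARD('n) + \<sigma>)) \<partial>lborel) < \<infinity>"
proof -
  define c where "c = \<delta> / real CARD('n)"
  have c: "c > 0" using \<delta> by (simp add: c_def)
  show ?thesis
  proof (rule kernel_sum_of_ridges_finite[OF \<sigma>, where f = "indicator {\<tau>. c \<le> \<bar>\<tau>\<bar>}"])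
    show "indicator {\<tau>. c \<le> \<bar>\<tau>\<bar>} \<in> borel_measurable borel" by measurable
    fix h :: "real ^ 'n"
    show "indicator {h. \<delta> \<le> norm h} h \<le> (\<Sum>b\<in>Basis. indicator {\<tau>. c \<le> \<bar>\<tau>\<bar>} (b \<bullet> h) :: ennreal)"
    proof (cases "\<delta> \<le> norm h")
      case True
      have "\<exists>b\<in>Basis. c \<le> \<bar>b \<bullet> h\<bar>"
      proof (rule ccontr)
        assume "\<not> ?thesis"
        then have "(\<Sum>b\<in>Basis. \<bar>h \<bullet> b\<bar>) < (\<Sum>b\<in>(Basis :: (real ^ 'n) set). c)"
          by (intro sum_strict_mono) (auto simp: inner_commute not_le)
        then show False using norm_le_l1[of h] True by (simp add: c_def)
      qed
      then obtain b where b: "b \<in> Basis" "c \<le> \<bar>b \<bullet> h\<bar>" by auto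
      have "indicator {h. \<delta> \<le> norm h} h \<le> (indicator {\<tau>. c \<le> \<bar>\<tau>\<bar>} (b \<bullet> h) :: ennreal)"
        using b by (simp add: indicator_def)
      also have "\<dots> \<le> (\<Sum>b\<in>Basis. indicator {\<tau>. c \<le> \<bar>\<tau>\<bar>} (b \<bullet> h))"
        using b(1) by (intro member_le_sum[where f = "\<lambda>b. indicator {\<tau>. c \<le> \<bar>\<tau>\<bar>} (b \<bullet> h)"]) auto
      finally show ?thesis .
    qed simp
  next
    show "(\<integral>\<^sup>+\<tau>. indicator {\<tau>. c \<le> \<bar>\<tau>\<bar>} \<tau> * ennreal (1 / \<bar>\<tau>\<bar> powr (1 + \<sigma>)) \<partial>lborel) < \<infinity>"
    proof (rule nn_integral_even_finite)
      have "(\<integral>\<^sup>+x. indicator {0..} x * (indicator {\<tau>. c \<le> \<bar>\<tau>\<bar>} x * ennreal (1 / \<bar>x\<bar> powr (1 + \<sigma>))) \<partial>lborel)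
         = (\<integral>\<^sup>+x. ennreal (indicator {c..} x * x powr (- (1 + \<sigma>))) \<partial>lborel)"
        using c by (intro nn_integral_cong) (auto simp: indicator_def powr_minus_divide simp del: minus_add_distrib)
      also have "\<dots> = ennreal (- (c powr (- (1 + \<sigma>) + 1)) / (- (1 + \<sigma>) + 1))"
        by (rule nn_integral_has_integral_lebesgue[OF _ has_integral_powr_to_inf]) (use c \<sigma> in auto)
      finally show "(\<integral>\<^sup>+x. indicator {0..} x * (indicator {\<tau>. c \<le> \<bar>\<tau>\<bar>} x * ennreal (1 / \<bar>x\<bar> powr (1 + \<sigma>))) \<partial>lborel) < \<infinity>"
        by simp
    qed (auto simp: indicator_def)
  qed
qed

text \<open>
  Some coordinate is at least \<open>|h|/N\<close> in modulus, and \<open>|\<tau>|\<^bsup>p-1-\<sigma>\<^esup>\<close> is integrable at 0 because \<open>\<sigma> < p\<close>.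
\<close>

lemma kernel_near_finite:
  fixes R \<sigma> p :: real
  assumes \<sigma>: "\<sigma> > 0" and p: "\<sigma> < p" and R: "R > 0"
  shows "(\<integral>\<^sup>+h. indicator {h. norm h \<le> R} h * ennreal (norm h powr p) * ennreal (1 / norm (h :: real ^ 'n) powr (real CARD('n) + \<sigma>)) \<partial>lborel) < \<infinity>"
proof -
  define N where "N = real CARD('n)"
  have N: "N > 0" by (simp add: N_def)
  show ?thesis
  proof (rule kernel_sum_of_ridges_finite[OF \<sigma>, where f = "\<lambda>\<tau>. indicator {\<tau>. \<bar>\<tau>\<bar> \<le> R} \<tau> * ennreal (N powr p * \<bar>\<tau>\<bar> powr p)"])
    show "(\<lambda>\<tau>. indicator {\<tau>. \<bar>\<tau>\<bar> \<le> R} \<tau> * ennreal (N powr p * \<bar>\<tau>\<bar> powr p)) \<in> borel_measurable borel" by measurable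
    fix h :: "real ^ 'n"
    let ?f = "\<lambda>\<tau>. indicator {\<tau>. \<bar>\<tau>\<bar> \<le> R} \<tau> * ennreal (N powr p * \<bar>\<tau>\<bar> powr p)"
    show "indicator {h. norm h \<le> R} h * ennreal (norm h powr p) \<le> (\<Sum>b\<in>Basis. ?f (b \<bullet> h))"
    proof (cases "norm h \<le> R")
      case True
      have "\<exists>b\<in>Basis. norm h \<le> N * \<bar>b \<bullet> h\<bar>"
      proof (rule ccontr)
        assume "\<not> ?thesis"
        then have "(\<Sum>b\<in>Basis. \<bar>h \<bullet> b\<bar>) < (\<Sum>b\<in>(Basis :: (real ^ 'n) set). norm h / N)"
          using N by (intro sum_strict_mono) (auto simp: inner_commute not_le field_simps)
        then show False using norm_le_l1[of h] by (simp add: N_def)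
      qed
      then obtain b where b: "b \<in> Basis" "norm h \<le> N * \<bar>b \<bullet> h\<bar>" by auto
      have "norm h powr p \<le> (N * \<bar>b \<bullet> h\<bar>) powr p" using b(2) \<sigma> p by (intro powr_mono2) auto
      moreover have "\<bar>b \<bullet> h\<bar> \<le> R" using Basis_le_norm[OF b(1), of h] True by (simp add: inner_commute)
      ultimately have "indicator {h. norm h \<le> R} h * ennreal (norm h powr p) \<le> ?f (b \<bullet> h)"
        using N True by (simp add: powr_mult ennreal_leI)
      also have "\<dots> \<le> (\<Sum>b\<in>Basis. ?f (b \<bullet> h))"
        using b(1) by (intro member_le_sum[where f = "\<lambda>b. ?f (b \<bullet> h)"]) auto
      finally show ?thesis .
    qed simp
  next
    show "(\<integral>\<^sup>+\<tau>. indicator {\<tau>. \<bar>\<tau>\<bar> \<le> R} \<tau> * ennreal (N powr p * \<bar>\<tau>\<bar> powr p) * ennreal (1 / \<bar>\<tau>\<bar> powr (1 + \<sigma>)) \<partial>lborel) < \<infinity>"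
    proof (rule nn_integral_even_finite)
      have "(\<integral>\<^sup>+x. indicator {0..} x * (indicator {\<tau>. \<bar>\<tau>\<bar> \<le> R} x * ennreal (N powr p * \<bar>x\<bar> powr p) * ennreal (1 / \<bar>x\<bar> powr (1 + \<sigma>))) \<partial>lborel)
         = (\<integral>\<^sup>+x. ennreal (N powr p) * ennreal (indicator {0..R} x * x powr (p - 1 - \<sigma>)) \<partial>lborel)"
      proof (rule nn_integral_cong)
        fix x :: real
        have "x powr p * (1 / x powr (1 + \<sigma>)) = x powr (p - 1 - \<sigma>)"
          using powr_diff[of x p "1 + \<sigma>"] by (simp add: diff_diff_eq)
        then have "N powr p * x powr p * (1 / x powr (1 + \<sigma>)) = N powr p * x powr (p - 1 - \<sigma>)"
          by (simp only: mult.assoc)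
        then show "indicator {0..} x * (indicator {\<tau>. \<bar>\<tau>\<bar> \<le> R} x * ennreal (N powr p * \<bar>x\<bar> powr p) * ennreal (1 / \<bar>x\<bar> powr (1 + \<sigma>)))
            = ennreal (N powr p) * ennreal (indicator {0..R} x * x powr (p - 1 - \<sigma>))"
          by (simp add: indicator_def ennreal_mult''[symmetric])
      qed
      also have "\<dots> = ennreal (N powr p) * (\<integral>\<^sup>+x. ennreal (indicator {0..R} x * x powr (p - 1 - \<sigma>)) \<partial>lborel)"
        by (rule nn_integral_cmult) simp
      also have "(\<integral>\<^sup>+x. ennreal (indicator {0..R} x * x powr (p - 1 - \<sigma>)) \<partial>lborel) = ennreal (R powr (p - 1 - \<sigma> + 1) / (p - 1 - \<sigma> + 1))"
        by (rule nn_integral_has_integral_lebesgue[OF _ has_integral_powr_from_0]) (use R p in auto)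
      finally show "(\<integral>\<^sup>+x. indicator {0..} x * (indicator {\<tau>. \<bar>\<tau>\<bar> \<le> R} x * ennreal (N powr p * \<bar>x\<bar> powr p) * ennreal (1 / \<bar>x\<bar> powr (1 + \<sigma>))) \<partial>lborel) < \<infinity>"
        by (simp add: ennreal_mult_less_top)
    qed (auto simp: indicator_def)
  qed
qed

section \<open>The equation on the half-line\<close>

lemma J_0 [simp]: "J p 0 = 0" by (simp add: J_def)

lemma J_minus: "J p (- x) = - J p x" by (simp add: J_def)

lemma abs_J: "\<bar>J p x\<bar> = \<bar>x\<bar> powr (p - 1)"
proof (cases "x = 0")
  case False
  then have "\<bar>x\<bar> powr (p - 1) = \<bar>x\<bar> powr (p - 2) * \<bar>x\<bar> powr 1"
    by (simp only: powr_add[symmetric]) simp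
  then show ?thesis using False by (simp add: J_def abs_mult)
qed simp

lemma J_pos: "x > 0 \<Longrightarrow> J p x = x powr (p - 1)"
  using abs_J[of p x] by (simp add: J_def abs_mult)

lemma J_mult: "c > 0 \<Longrightarrow> J p (c * x) = c powr (p - 1) * J p x"
proof (cases "x = 0")
  case False
  assume c: "c > 0"
  have "c powr (p - 1) = c powr (p - 2) * c powr 1"
    by (simp only: powr_add[symmetric]) simp
  then show ?thesis using c by (simp add: J_def abs_mult powr_mult)
qed simp

lemma J_mono:
  assumes p: "1 < p" and "x \<le> y"
  shows "J p x \<le> J p y"
proof -
  have J: "J p x = (if x \<ge> 0 then x powr (p - 1) else - ((- x) powr (p - 1)))" for x
    using J_pos[of x p] J_pos[of "- x" p] by (cases x "0::real" rule: linorder_cases) (auto simp: J_minus)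
  show ?thesis using assms powr_mono2[of "p - 1" x y] powr_mono2[of "p - 1" "- y" "- x"]
      powr_ge_zero[of y "p - 1"] powr_ge_zero[of "- x" "p - 1"]
    unfolding J by (auto simp del: powr_ge_zero) 
qed

lemma J_measurable [measurable]: "J p \<in> borel_measurable borel"
  unfolding J_def by measurable

text \<open>
  For \<open>0 \<le> a \<le> 1\<close> use \<open>t \<le> t\<^sup>a\<close>, for \<open>a > 1\<close> the mean value theorem, and for \<open>a < 0\<close> pull out the factor
  \<open>t\<^sup>a\<close>. The bound is linear in \<open>1 - t\<close> up to \<open>t = 1\<close> and has the exact order at \<open>t = 0\<close>.
\<close>

lemma abs_one_minus_powr_le:
  fixes t a :: real
  assumes t: "0 < t" "t < 1"
  shows "\<bar>1 - t powr a\<bar> \<le> max 1 \<bar>a\<bar> * (1 - t) * t powr (min a 0)"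
proof -
  have nonneg: "\<bar>1 - t powr b\<bar> \<le> max 1 b * (1 - t)" if b: "b \<ge> 0" for b
  proof -
    have le1: "t powr b \<le> 1" using t b by (simp add: powr_le1)
    have "1 - t powr b \<le> max 1 b * (1 - t)"
    proof (cases "b \<le> 1")
      case True
      have "t powr 1 \<le> t powr b" using t True by (intro powr_mono') auto
      then show ?thesis using t True by simp
    next
      case False
      have "\<exists>z>t. z < 1 \<and> 1 powr b - t powr b = (1 - t) * (b * z powr (b - 1))"
        using t by (intro MVT2) (auto intro!: derivative_eq_intros)
      then obtain z where z: "t < z" "z < 1" "1 - t powr b = (1 - t) * (b * z powr (b - 1))" by auto
      have "z powr (b - 1) \<le> 1" using z t False by (simp add: powr_le1)
      then have "(1 - t) * (b * z powr (b - 1)) \<le> (1 - t) * (b * 1)"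
        using t b by (intro mult_left_mono) auto
      then show ?thesis using z False by (simp add: mult.commute)
    qed
    then show ?thesis using le1 by simp
  qed
  show ?thesis
  proof (cases "a \<ge> 0")
    case True
    then show ?thesis using nonneg[of a] t by simp
  next
    case False
    have "1 - t powr a = - (t powr a * (1 - t powr (- a)))"
      using t by (simp add: right_diff_distrib powr_minus)
    then have "\<bar>1 - t powr a\<bar> = t powr a * \<bar>1 - t powr (- a)\<bar>"
      by (simp add: abs_mult)
    also have "\<dots> \<le> t powr a * (max 1 (- a) * (1 - t))"
      using False by (intro mult_left_mono nonneg) auto
    finally show ?thesis using False by (simp add: mult_ac)
  qed
qed

text \<open>
  Here \<open>a\<close> and \<open>b\<close> are the distances of two points to the complement. Cutting off by their ratio, instead of
  by the distance between the points, keeps symmetry, homogeneity and monotonicity in \<open>b\<close>.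
\<close>

definition truncJ :: "real \<Rightarrow> real \<Rightarrow> real \<Rightarrow> real \<Rightarrow> real \<Rightarrow> real" where
  "truncJ p \<beta> \<theta> a b = (if a \<le> \<theta> * b \<or> b \<le> \<theta> * a then J p (a powr \<beta> - b powr \<beta>) else 0)"

text \<open>
  The integrand in \<open>hardy_lambda\<close>, with \<open>\<sigma> = s p\<close>.
\<close>

definition lambda_integrand :: "real \<Rightarrow> real \<Rightarrow> real \<Rightarrow> real \<Rightarrow> real" where
  "lambda_integrand \<sigma> p \<beta> t =
     J p (1 - t powr \<beta>) / (1 - t) powr (1 + \<sigma>) * (1 - t powr (\<sigma> - 1 - \<beta> * (p - 1)))"

text \<open>
  Half of \<open>\<lambda>(\<beta>)\<close>, with the integral stopped at \<open>\<theta>\<close>.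
\<close>

definition trunc_lambda :: "real \<Rightarrow> real \<Rightarrow> real \<Rightarrow> real \<Rightarrow> real" where
  "trunc_lambda \<sigma> p \<beta> \<theta> = 1 / \<sigma> + (LBINT t:{0<..\<theta>}. lambda_integrand \<sigma> p \<beta> t)"

lemma lambda_integrand_measurable [measurable]:
  "lambda_integrand \<sigma> p \<beta> \<in> borel_measurable borel"
  unfolding lambda_integrand_def by measurable

lemma truncJ_measurable [measurable]:
  assumes [measurable]: "f \<in> borel_measurable M" "g \<in> borel_measurable M"
  shows "(\<lambda>x. truncJ p \<beta> \<theta> (f x) (g x)) \<in> borel_measurable M"
  unfolding truncJ_def by measurable

lemma abs_J_one_minus_powr_le:
  assumes p: "1 < p" and t: "0 < t" "t < 1"
  shows "\<bar>J p (1 - t powr \<beta>)\<bar> \<le> max 1 \<bar>\<beta>\<bar> powr (p - 1) * (1 - t) powr (p - 1) * t powr (min \<beta> 0 * (p - 1))"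
proof -
  have "\<bar>J p (1 - t powr \<beta>)\<bar> \<le> (max 1 \<bar>\<beta>\<bar> * (1 - t) * t powr (min \<beta> 0)) powr (p - 1)"
    unfolding abs_J using p by (intro powr_mono2 abs_one_minus_powr_le t) auto
  also have "\<dots> = max 1 \<bar>\<beta>\<bar> powr (p - 1) * (1 - t) powr (p - 1) * t powr (min \<beta> 0 * (p - 1))"
    using t by (simp add: powr_mult powr_powr)
  finally show ?thesis .
qed

lemma set_integrable_boundI:
  fixes f g :: "'a \<Rightarrow> real"
  assumes "set_integrable M A g" "f \<in> borel_measurable M" "A \<in> sets M" "\<And>x. x \<in> A \<Longrightarrow> \<bar>f x\<bar> \<le> g x"
  shows "set_integrable M A f"
  unfolding set_integrable_def
  by (rule Bochner_Integration.integrable_bound[OF assms(1)[unfolded set_integrable_def]])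
     (use assms(2,3) order_trans[OF assms(4) abs_ge_self] in \<open>auto simp: indicator_def intro!: AE_I2 borel_measurable_times\<close>)

context
  fixes \<sigma> p \<beta> :: real
  assumes p: "1 < p" and \<sigma>: "0 < \<sigma>" "\<sigma> < p" and \<beta>: "- 1 / (p - 1) < \<beta>" "\<beta> < \<sigma> / (p - 1)"
begin

lemma beta_ineqs: "- 1 < \<beta> * (p - 1)" "\<beta> * (p - 1) < \<sigma>"
  using \<beta> p by (simp_all add: field_simps)

text \<open>
  These exponents of \<open>t\<close> occur in the bounds at \<open>t = 0\<close> below; being above \<open>-1\<close> is where both restrictions on
  \<open>\<beta>\<close> enter.
\<close>

lemma beta_exponents:
  "min \<beta> 0 * (p - 1) > - 1" "min \<beta> 0 * (p - 1) + min (\<sigma> - 1 - \<beta> * (p - 1)) 0 > - 1"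
  "min \<beta> 0 * (p - 1) + (\<sigma> - 1 - \<beta> * (p - 1)) > - 1"
  using beta_ineqs \<sigma> p by (auto simp: min_def mult_le_0_iff zero_le_mult_iff not_le)

text \<open>
  The two differences in the integrand vanish at \<open>t = 1\<close> to the orders \<open>p - 1\<close> and 1, leaving
  \<open>(1 - t)\<^bsup>p-1-\<sigma>\<^esup>\<close>, so a Beta integral dominates.
\<close>

lemma lambda_integrand_integrable: "set_integrable lborel {0<..<1} (lambda_integrand \<sigma> p \<beta>)"
proof -
  define \<gamma> where "\<gamma> = \<sigma> - 1 - \<beta> * (p - 1)"
  define K where "K = max 1 \<bar>\<beta>\<bar> powr (p - 1) * max 1 \<bar>\<gamma>\<bar>"
  define m where "m = min \<beta> 0 * (p - 1) + min \<gamma> 0"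
  have m: "m > - 1" using beta_exponents by (simp add: m_def \<gamma>_def)
  have int: "set_integrable lborel {0..1} (\<lambda>t::real. t powr (m + 1 - 1) * (1 - t) powr (p - \<sigma> - 1))"
    using m \<sigma> by (intro integrable_Beta) auto
  have "set_integrable lborel {0<..<1} (\<lambda>t::real. K * (t powr m * (1 - t) powr (p - \<sigma> - 1)))"
    by (rule set_integrable_subset[OF set_integrable_mult_right]) (use int in auto)
  then show ?thesis
  proof (rule set_integrable_boundI)
    fix t :: real assume "t \<in> {0<..<1}"
    then have t: "0 < t" "t < 1" by auto
    have "\<bar>lambda_integrand \<sigma> p \<beta> t\<bar> = \<bar>J p (1 - t powr \<beta>)\<bar> / (1 - t) powr (1 + \<sigma>) * \<bar>1 - t powr \<gamma>\<bar>"
      by (simp add: lambda_integrand_def abs_mult \<gamma>_def)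
    also have "\<dots> \<le> max 1 \<bar>\<beta>\<bar> powr (p - 1) * (1 - t) powr (p - 1) * t powr (min \<beta> 0 * (p - 1)) / (1 - t) powr (1 + \<sigma>)
        * (max 1 \<bar>\<gamma>\<bar> * (1 - t) * t powr (min \<gamma> 0))"
      by (intro mult_mono divide_right_mono abs_J_one_minus_powr_le abs_one_minus_powr_le p t) auto
    also have "\<dots> = K * ((t powr (min \<beta> 0 * (p - 1)) * t powr (min \<gamma> 0)) * ((1 - t) powr (p - 1) * (1 - t) powr 1 / (1 - t) powr (1 + \<sigma>)))"
      using t by (simp add: K_def mult_ac)
    also have "t powr (min \<beta> 0 * (p - 1)) * t powr (min \<gamma> 0) = t powr m"
      by (simp add: powr_add m_def)
    also have "(1 - t) powr (p - 1) * (1 - t) powr 1 / (1 - t) powr (1 + \<sigma>) = (1 - t) powr (p - \<sigma> - 1)"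
      by (simp only: powr_add[symmetric] powr_diff[symmetric]) (simp add: algebra_simps)
    finally show "\<bar>lambda_integrand \<sigma> p \<beta> t\<bar> \<le> K * (t powr m * (1 - t) powr (p - \<sigma> - 1))" .
  qed auto
qed

lemma trunc_lambda_tendsto:
  "(\<lambda>n. 2 * trunc_lambda \<sigma> p \<beta> (real (Suc n) / real (Suc (Suc n)))) \<longlonglongrightarrow> hardy_lambda (\<sigma> / p) p \<beta>"
proof -
  let ?\<theta> = "\<lambda>n. real (Suc n) / real (Suc (Suc n))"
  let ?f = "lambda_integrand \<sigma> p \<beta>"
  have "(\<lambda>n. LINT t|lborel. indicator {0<..?\<theta> n} t *\<^sub>R ?f t) \<longlonglongrightarrow> (LINT t|lborel. indicator {0<..<1} t *\<^sub>R ?f t)"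
  proof (rule integral_dominated_convergence[where w = "\<lambda>t. norm (indicator {0<..<1} t *\<^sub>R ?f t)"])
    show "integrable lborel (\<lambda>t. norm (indicator {0<..<1} t *\<^sub>R ?f t))"
      using lambda_integrand_integrable unfolding set_integrable_def by (rule integrable_norm)
    show "AE t in lborel. (\<lambda>n. indicator {0<..?\<theta> n} t *\<^sub>R ?f t) \<longlonglongrightarrow> indicator {0<..<1} t *\<^sub>R ?f t"
    proof (rule AE_I2)
      fix t :: real
      show "(\<lambda>n. indicator {0<..?\<theta> n} t *\<^sub>R ?f t) \<longlonglongrightarrow> indicator {0<..<1} t *\<^sub>R ?f t"
      proof (cases "0 < t \<and> t < 1")
        case True
        have "?\<theta> \<longlonglongrightarrow> 1" using LIMSEQ_Suc[OF LIMSEQ_n_over_Suc_n] by simp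
        then have "\<forall>\<^sub>F n in sequentially. t < ?\<theta> n" using True by (auto dest: order_tendstoD)
        then have "\<forall>\<^sub>F n in sequentially. indicator {0<..?\<theta> n} t *\<^sub>R ?f t = indicator {0<..<1} t *\<^sub>R ?f t"
          by eventually_elim (use True in auto)
        then show ?thesis by (rule tendsto_eventually)
      next
        case False
        have "?\<theta> n < 1" for n by simp
        then have "t \<notin> {0<..?\<theta> n}" for n
          using False le_less_trans[of t "?\<theta> n" 1] by auto
        then have "indicator {0<..?\<theta> n} t *\<^sub>R ?f t = 0" for n by (metis indicator_simps(2) scaleR_zero_left)
        moreover have "indicator {0<..<1} t *\<^sub>R ?f t = 0" using False by simp
        ultimately show ?thesis by (simp only: tendsto_const)
      qed
    qed
    fix n
    have "?\<theta> n < 1" by simp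
    then have "t \<le> ?\<theta> n \<Longrightarrow> t < 1" for t by (rule le_less_trans[rotated])
    then show "AE t in lborel. norm (indicator {0<..?\<theta> n} t *\<^sub>R ?f t) \<le> norm (indicator {0<..<1} t *\<^sub>R ?f t)"
      by (intro AE_I2) (auto simp: indicator_def simp del: of_nat_Suc)
  qed auto
  then have "(\<lambda>n. 2 * (1 / \<sigma> + (LINT t|lborel. indicator {0<..?\<theta> n} t *\<^sub>R ?f t)))
      \<longlonglongrightarrow> 2 * (1 / \<sigma> + (LINT t|lborel. indicator {0<..<1} t *\<^sub>R ?f t))"
    by (intro tendsto_intros)
  moreover have "2 * (1 / \<sigma> + (LINT t|lborel. indicator {0<..<1} t *\<^sub>R ?f t)) = hardy_lambda (\<sigma> / p) p \<beta>"
    using p by (simp add: hardy_lambda_def lambda_integrand_def set_lebesgue_integral_def)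
  ultimately show ?thesis by (simp add: trunc_lambda_def set_lebesgue_integral_def)
qed

lemma set_integrable_small:
  fixes m K \<theta> :: real and f :: "real \<Rightarrow> real"
  assumes m: "m > - 1" and "\<theta> < 1" and [measurable]: "f \<in> borel_measurable borel"
    and le: "\<And>t. 0 < t \<Longrightarrow> t \<le> \<theta> \<Longrightarrow> \<bar>f t\<bar> \<le> K * t powr m"
  shows "set_integrable lborel {0<..\<theta>} f"
proof (rule set_integrable_boundI)
  have "set_integrable lborel {0..1} (\<lambda>t::real. t powr (m + 1 - 1) * (1 - t) powr (1 - 1))"
    using m by (intro integrable_Beta) auto
  then have "set_integrable lborel {0<..\<theta>} (\<lambda>t::real. K * (t powr (m + 1 - 1) * (1 - t) powr (1 - 1)))"
    using \<open>\<theta> < 1\<close> by (intro set_integrable_mult_right) (auto intro: set_integrable_subset)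
  also have "?this \<longleftrightarrow> set_integrable lborel {0<..\<theta>} (\<lambda>t. K * t powr m)"
    unfolding set_integrable_def using \<open>\<theta> < 1\<close>
    by (intro Bochner_Integration.integrable_cong) (auto simp: indicator_def)
  finally show "set_integrable lborel {0<..\<theta>} (\<lambda>t. K * t powr m)" .
qed (use le in auto)

text \<open>
  Away from \<open>t = 1\<close> the two summands of the integrand are integrable separately; up to 1 only their sum
  need be integrable.
\<close>

lemma trunc_parts_integrable:
  assumes \<theta>: "0 < \<theta>" "\<theta> < 1"
  shows "set_integrable lborel {0<..\<theta>} (\<lambda>t. J p (1 - t powr \<beta>) / (1 - t) powr (1 + \<sigma>))"
    and "set_integrable lborel {0<..\<theta>} (\<lambda>t. J p (1 - t powr \<beta>) / (1 - t) powr (1 + \<sigma>) * t powr (\<sigma> - 1 - \<beta> * (p - 1)))"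
proof -
  define K where "K = max 1 \<bar>\<beta>\<bar> powr (p - 1) * (1 / (1 - \<theta>) powr (1 + \<sigma>))"
  have bound: "\<bar>J p (1 - t powr \<beta>) / (1 - t) powr (1 + \<sigma>)\<bar> \<le> K * t powr (min \<beta> 0 * (p - 1))"
    if t: "0 < t" "t \<le> \<theta>" for t
  proof -
    have "\<bar>J p (1 - t powr \<beta>)\<bar> \<le> max 1 \<bar>\<beta>\<bar> powr (p - 1) * (1 - t) powr (p - 1) * t powr (min \<beta> 0 * (p - 1))"
      using t \<theta> by (intro abs_J_one_minus_powr_le p) auto
    also have "\<dots> \<le> max 1 \<bar>\<beta>\<bar> powr (p - 1) * 1 * t powr (min \<beta> 0 * (p - 1))"
      using t \<theta> p by (intro mult_right_mono mult_left_mono powr_le1) auto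
    finally have "\<bar>J p (1 - t powr \<beta>)\<bar> \<le> max 1 \<bar>\<beta>\<bar> powr (p - 1) * t powr (min \<beta> 0 * (p - 1))" by simp
    moreover have "1 / (1 - t) powr (1 + \<sigma>) \<le> 1 / (1 - \<theta>) powr (1 + \<sigma>)"
      using t \<theta> \<sigma> by (intro divide_left_mono powr_mono2 mult_pos_pos) auto
    ultimately have "\<bar>J p (1 - t powr \<beta>)\<bar> * (1 / (1 - t) powr (1 + \<sigma>))
        \<le> (max 1 \<bar>\<beta>\<bar> powr (p - 1) * t powr (min \<beta> 0 * (p - 1))) * (1 / (1 - \<theta>) powr (1 + \<sigma>))"
      by (intro mult_mono) auto
    then show ?thesis by (simp add: K_def mult_ac)
  qed
  show "set_integrable lborel {0<..\<theta>} (\<lambda>t. J p (1 - t powr \<beta>) / (1 - t) powr (1 + \<sigma>))"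
    by (rule set_integrable_small[OF beta_exponents(1) \<theta>(2) _ bound]) auto
  show "set_integrable lborel {0<..\<theta>} (\<lambda>t. J p (1 - t powr \<beta>) / (1 - t) powr (1 + \<sigma>) * t powr (\<sigma> - 1 - \<beta> * (p - 1)))"
  proof (rule set_integrable_small[OF beta_exponents(3) \<theta>(2)])
    fix t assume t: "0 < t" "t \<le> \<theta>"
    have "\<bar>J p (1 - t powr \<beta>) / (1 - t) powr (1 + \<sigma>)\<bar> * t powr (\<sigma> - 1 - \<beta> * (p - 1))
        \<le> K * t powr (min \<beta> 0 * (p - 1)) * t powr (\<sigma> - 1 - \<beta> * (p - 1))"
      by (intro mult_right_mono bound t) auto
    then show "\<bar>J p (1 - t powr \<beta>) / (1 - t) powr (1 + \<sigma>) * t powr (\<sigma> - 1 - \<beta> * (p - 1))\<bar>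
        \<le> K * t powr (min \<beta> 0 * (p - 1) + (\<sigma> - 1 - \<beta> * (p - 1)))"
      unfolding abs_mult[of _ "_ powr _"] powr_add by (simp add: mult.assoc)
  qed auto
qed

text \<open>
  The points outside the half-line, where \<open>U\<^sub>\<beta>\<close> vanishes, account for the summand \<open>2 / \<sigma>\<close> in \<open>\<lambda>(\<beta>)\<close>.
\<close>

lemma complement_integral:
  "has_bochner_integral lborel (\<lambda>t::real. indicator {..0} t / \<bar>1 - t\<bar> powr (1 + \<sigma>)) (1 / \<sigma>)"
proof -
  have "((\<lambda>u. u powr (- (1 + \<sigma>))) has_integral (- (1 powr (- (1 + \<sigma>) + 1)) / (- (1 + \<sigma>) + 1))) {1..}"
    using \<sigma> by (intro has_integral_powr_to_inf) auto
  then have hi: "((\<lambda>u. u powr (- (1 + \<sigma>))) has_integral (1 / \<sigma>)) {1..}"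
    by simp
  have "(\<integral>\<^sup>+u. ennreal (indicator {1..} u * u powr (- (1 + \<sigma>))) \<partial>lborel) = ennreal (1 / \<sigma>)"
    by (rule nn_integral_has_integral_lebesgue[OF _ hi]) auto
  then have "has_bochner_integral lborel (\<lambda>u::real. indicator {1..} u * u powr (- (1 + \<sigma>))) (1 / \<sigma>)"
    using \<sigma> by (intro has_bochner_integral_nn_integral) auto
  then have "has_bochner_integral lborel (\<lambda>t::real. indicator {1..} (1 + (-1) * t) * (1 + (-1) * t) powr (- (1 + \<sigma>))) ((1 / \<sigma>) /\<^sub>R \<bar>-1\<bar>)"
    by (subst (asm) lborel_has_bochner_integral_real_affine_iff[of "-1" _ _ 1]) auto
  moreover have "(\<lambda>t::real. indicator {1..} (1 + (-1) * t) * (1 + (-1) * t) powr (- (1 + \<sigma>)))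
      = (\<lambda>t::real. indicator {..0} t / \<bar>1 - t\<bar> powr (1 + \<sigma>))"
    by (auto simp: fun_eq_iff indicator_def powr_minus_divide simp del: minus_add_distrib)
  ultimately show ?thesis by simp
qed

lemma image_inverse_interval:
  assumes "0 < (\<theta>::real)"
  shows "(\<lambda>t. 1 / t) ` {0<..\<theta>} = {1 / \<theta>..}"
proof safe
  fix t assume "t \<in> {0<..\<theta>}" then show "1 / t \<ge> 1 / \<theta>" by (auto intro: divide_left_mono)
next
  fix u assume u: "1 / \<theta> \<le> u"
  then have "u > 0" using assms by (meson divide_pos_pos less_le_trans zero_less_one)
  then show "u \<in> (\<lambda>t. 1 / t) ` {0<..\<theta>}"
    using u assms by (intro image_eqI[of _ _ "1 / u"]) (auto simp: field_simps)
qed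

text \<open>
  The substitution \<open>u = 1/t\<close> folds the part beyond \<open>1/\<theta>\<close> onto the interval below \<open>\<theta>\<close>; homogeneity of \<open>J\<close>
  produces the factor \<open>t\<^bsup>\<sigma>-1-\<beta>(p-1)\<^esup>\<close> and its oddness the sign.
\<close>

lemma beyond_integral:
  assumes \<theta>: "0 < \<theta>" "\<theta> < 1"
  shows "has_bochner_integral lborel (\<lambda>u. indicator {1 / \<theta>..} u * (J p (1 - u powr \<beta>) / \<bar>1 - u\<bar> powr (1 + \<sigma>)))
     (- (LBINT t:{0<..\<theta>}. J p (1 - t powr \<beta>) / (1 - t) powr (1 + \<sigma>) * t powr (\<sigma> - 1 - \<beta> * (p - 1))))"
proof -
  define B where "B = (\<lambda>t. J p (1 - t powr \<beta>) / (1 - t) powr (1 + \<sigma>) * t powr (\<sigma> - 1 - \<beta> * (p - 1)))"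
  define f where "f = (\<lambda>u. J p (1 - u powr \<beta>) / \<bar>1 - u\<bar> powr (1 + \<sigma>))"
  have [measurable]: "B \<in> borel_measurable borel" "f \<in> borel_measurable borel"
    by (auto simp: B_def f_def)
  have eq: "\<bar>- (1 / t\<^sup>2)\<bar> * f (1 / t) = - B t" if t: "t \<in> {0<..\<theta>}" for t
  proof -
    have t0: "0 < t" "t < 1" using t \<theta> by auto
    have J: "J p (1 - (1 / t) powr \<beta>) = - (t powr (- \<beta> * (p - 1)) * J p (1 - t powr \<beta>))"
    proof -
      have "1 - (1 / t) powr \<beta> = t powr (- \<beta>) * (- (1 - t powr \<beta>))"
        using t0 by (simp add: powr_divide powr_minus field_simps)
      then have "J p (1 - (1 / t) powr \<beta>) = (t powr (- \<beta>)) powr (p - 1) * J p (- (1 - t powr \<beta>))"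
        using t0 by (simp only: J_mult powr_gt_zero)
      then show ?thesis by (simp only: powr_powr J_minus mult_minus_right)
    qed
    have "\<bar>1 - 1 / t\<bar> = (1 - t) / t" using t0 by (simp add: abs_if field_simps)
    then have k: "\<bar>1 - 1 / t\<bar> powr (1 + \<sigma>) = (1 - t) powr (1 + \<sigma>) / t powr (1 + \<sigma>)"
      using t0 by (simp add: powr_divide)
    have e: "t powr (- \<beta> * (p - 1)) * t powr (1 + \<sigma>) / t\<^sup>2 = t powr (\<sigma> - 1 - \<beta> * (p - 1))"
    proof -
      have "t\<^sup>2 = t powr 2" using t0 by simp
      then show ?thesis by (simp only: powr_add[symmetric] powr_diff[symmetric]) (simp add: algebra_simps)
    qed
    have "\<bar>- (1 / t\<^sup>2)\<bar> * f (1 / t) = - (J p (1 - t powr \<beta>) / (1 - t) powr (1 + \<sigma>) * (t powr (- \<beta> * (p - 1)) * t powr (1 + \<sigma>) / t\<^sup>2))"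
      using t0 by (simp only: f_def J k) (simp add: mult_ac)
    then show ?thesis by (simp only: e B_def)
  qed
  have Bint: "set_integrable lborel {0<..\<theta>} B"
    unfolding B_def by (rule trunc_parts_integrable(2)[OF \<theta>])
  have leb: "set_integrable lebesgue A F \<longleftrightarrow> set_integrable lborel A F"
    "set_lebesgue_integral lebesgue A F = set_lebesgue_integral lborel A F"
    if "A \<in> sets borel" and [measurable]: "F \<in> borel_measurable borel" for A and F :: "real \<Rightarrow> real"
  proof -
    have meas: "(\<lambda>x. indicator A x *\<^sub>R F x) \<in> borel_measurable lborel" using that by simp
    show "set_integrable lebesgue A F \<longleftrightarrow> set_integrable lborel A F"
      "set_lebesgue_integral lebesgue A F = set_lebesgue_integral lborel A F"
      unfolding set_integrable_def set_lebesgue_integral_def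
      using integrable_completion[OF meas] integral_completion[OF meas] by simp_all
  qed
  have "set_integrable lebesgue {0<..\<theta>} B"
    using Bint by (subst leb(1)) auto
  then have abs: "(\<lambda>t. - B t) absolutely_integrable_on {0<..\<theta>}"
    by (simp add: set_integrable_def)
  have "(\<lambda>t. \<bar>- (1 / t\<^sup>2)\<bar> * f (1 / t)) absolutely_integrable_on {0<..\<theta>} \<and>
      integral {0<..\<theta>} (\<lambda>t. \<bar>- (1 / t\<^sup>2)\<bar> * f (1 / t)) = integral {0<..\<theta>} (\<lambda>t. - B t)"
  proof
    show "(\<lambda>t. \<bar>- (1 / t\<^sup>2)\<bar> * f (1 / t)) absolutely_integrable_on {0<..\<theta>}"
      using abs by (rule absolutely_integrable_spike[of _ _ "{}"]) (auto simp: eq[simplified])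
    show "integral {0<..\<theta>} (\<lambda>t. \<bar>- (1 / t\<^sup>2)\<bar> * f (1 / t)) = integral {0<..\<theta>} (\<lambda>t. - B t)"
      by (rule integral_cong) (simp add: eq[simplified])
  qed
  also have "?this \<longleftrightarrow> f absolutely_integrable_on (\<lambda>t. 1 / t) ` {0<..\<theta>} \<and>
      integral ((\<lambda>t. 1 / t) ` {0<..\<theta>}) f = integral {0<..\<theta>} (\<lambda>t. - B t)"
    by (rule has_absolute_integral_change_of_variables_1')
       (auto intro!: derivative_eq_intros inj_onI simp: power2_eq_square)
  finally have f: "f absolutely_integrable_on {1 / \<theta>..}" "integral {1 / \<theta>..} f = integral {0<..\<theta>} (\<lambda>t. - B t)"
    using image_inverse_interval[OF \<theta>(1)] by auto
  have "integral {0<..\<theta>} (\<lambda>t. - B t) = (LINT t:{0<..\<theta>}|lebesgue. - B t)"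
    by (rule set_lebesgue_integral_eq_integral(2)[OF abs, symmetric])
  also have "\<dots> = - (LINT t:{0<..\<theta>}|lebesgue. B t)"
    by (simp add: set_lebesgue_integral_def)
  also have "\<dots> = - (LBINT t:{0<..\<theta>}. B t)"
    by (subst leb(2)) auto
  finally have "(LBINT u:{1 / \<theta>..}. f u) = - (LBINT t:{0<..\<theta>}. B t)"
    using set_lebesgue_integral_eq_integral(2)[OF f(1)] f(2) by (subst leb(2)[symmetric]) auto
  moreover have "set_integrable lborel {1 / \<theta>..} f" using f(1) by (subst leb(1)[symmetric]) auto
  ultimately show ?thesis
    unfolding B_def[symmetric] f_def
    by (simp add: has_bochner_integral_iff set_integrable_def set_lebesgue_integral_def)
qed

text \<open>
  The three parts of the line are the complement of the half-line, the points below \<open>\<theta>\<close> and the points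
  beyond \<open>1/\<theta>\<close>; their contributions add up to \<open>\<lambda>(\<beta>)/2\<close> stopped at \<open>\<theta>\<close>, without any error term.
\<close>

lemma truncJ_line_integral:
  assumes \<theta>: "0 < \<theta>" "\<theta> < 1"
  shows "has_bochner_integral lborel (\<lambda>t. truncJ p \<beta> \<theta> 1 (max 0 t) / \<bar>1 - t\<bar> powr (1 + \<sigma>)) (trunc_lambda \<sigma> p \<beta> \<theta>)"
proof -
  define A where "A = (\<lambda>t. J p (1 - t powr \<beta>) / (1 - t) powr (1 + \<sigma>))"
  define \<gamma> where "\<gamma> = \<sigma> - 1 - \<beta> * (p - 1)"
  have intA: "has_bochner_integral lborel (\<lambda>t. indicator {0<..\<theta>} t * A t) (LBINT t:{0<..\<theta>}. A t)"
    using trunc_parts_integrable(1)[OF \<theta>]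
    by (simp add: has_bochner_integral_iff set_integrable_def set_lebesgue_integral_def A_def)
  have sum: "has_bochner_integral lborel (\<lambda>t. indicator {..0} t / \<bar>1 - t\<bar> powr (1 + \<sigma>)
        + indicator {0<..\<theta>} t * A t
        + indicator {1 / \<theta>..} t * (J p (1 - t powr \<beta>) / \<bar>1 - t\<bar> powr (1 + \<sigma>)))
      (1 / \<sigma> + (LBINT t:{0<..\<theta>}. A t) + - (LBINT t:{0<..\<theta>}. A t * t powr \<gamma>))"
    using beyond_integral[OF \<theta>] unfolding A_def \<gamma>_def
    by (intro has_bochner_integral_add complement_integral intA[unfolded A_def])
  have "(\<lambda>t. indicator {..0} t / \<bar>1 - t\<bar> powr (1 + \<sigma>)
        + indicator {0<..\<theta>} t * A t
        + indicator {1 / \<theta>..} t * (J p (1 - t powr \<beta>) / \<bar>1 - t\<bar> powr (1 + \<sigma>)))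
      = (\<lambda>t. truncJ p \<beta> \<theta> 1 (max 0 t) / \<bar>1 - t\<bar> powr (1 + \<sigma>))"
  proof
    fix t :: real
    have cond: "1 \<le> \<theta> * t \<longleftrightarrow> 1 / \<theta> \<le> t" using \<theta> by (simp add: field_simps)
    have gt1: "1 < 1 / \<theta>" using \<theta> by simp
    consider "t \<le> 0" | "0 < t" "t \<le> \<theta>" | "\<theta> < t" "t < 1 / \<theta>" | "1 / \<theta> \<le> t" by linarith
    then show "indicator {..0} t / \<bar>1 - t\<bar> powr (1 + \<sigma>) + indicator {0<..\<theta>} t * A t
        + indicator {1 / \<theta>..} t * (J p (1 - t powr \<beta>) / \<bar>1 - t\<bar> powr (1 + \<sigma>))
      = truncJ p \<beta> \<theta> 1 (max 0 t) / \<bar>1 - t\<bar> powr (1 + \<sigma>)"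
    proof cases
      case 1
      then have "\<not> 1 / \<theta> \<le> t" using gt1 by linarith
      then show ?thesis using 1 \<theta> by (simp add: truncJ_def J_pos max_def)
    next
      case 2
      then have "\<not> 1 / \<theta> \<le> t" using gt1 \<theta> by linarith
      then show ?thesis using 2 \<theta> by (simp add: truncJ_def A_def max_def)
    next
      case 3
      then show ?thesis using \<theta> cond by (simp add: truncJ_def max_def)
    next
      case 4
      then have "t > \<theta>" "t > 0" using gt1 \<theta> by linarith+
      then show ?thesis using 4 \<theta> cond by (simp add: truncJ_def max_def)
    qed
  qed
  moreover have "(LBINT t:{0<..\<theta>}. A t) - (LBINT t:{0<..\<theta>}. A t * t powr \<gamma>) = (LBINT t:{0<..\<theta>}. lambda_integrand \<sigma> p \<beta> t)"
  proof -
    have "lambda_integrand \<sigma> p \<beta> t = A t - A t * t powr \<gamma>" for t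
      by (simp only: A_def \<gamma>_def lambda_integrand_def right_diff_distrib[of "_ / _"] mult_1_right)
    moreover have "(LBINT t:{0<..\<theta>}. A t - A t * t powr \<gamma>) = (LBINT t:{0<..\<theta>}. A t) - (LBINT t:{0<..\<theta>}. A t * t powr \<gamma>)"
      using trunc_parts_integrable[OF \<theta>] unfolding A_def \<gamma>_def by (rule set_integral_diff(2))
    ultimately show ?thesis by simp
  qed
  ultimately show ?thesis using sum by (simp add: trunc_lambda_def flip: add_diff_eq)
qed

lemma truncJ_homogeneous:
  assumes "d > 0" "b \<ge> 0"
  shows "truncJ p \<beta> \<theta> d (d * b) = d powr (\<beta> * (p - 1)) * truncJ p \<beta> \<theta> 1 b"
proof -
  have "d powr \<beta> - (d * b) powr \<beta> = d powr \<beta> * (1 - b powr \<beta>)"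
    using assms by (simp add: powr_mult algebra_simps)
  then have "J p (d powr \<beta> - (d * b) powr \<beta>) = d powr (\<beta> * (p - 1)) * J p (1 - b powr \<beta>)"
    using assms by (simp only: J_mult powr_gt_zero powr_powr)
  moreover have "d \<le> \<theta> * (d * b) \<longleftrightarrow> 1 \<le> \<theta> * b" "d * b \<le> \<theta> * d \<longleftrightarrow> b \<le> \<theta>"
    using assms mult_le_cancel_left_pos[of d 1 "\<theta> * b"] mult_le_cancel_left_pos[of d b \<theta>] by (simp_all add: mult_ac)
  ultimately show ?thesis by (simp add: truncJ_def)
qed

text \<open>
  A point at distance \<open>d\<close> from the boundary is reduced to \<open>d = 1\<close> by scaling.
\<close>

lemma truncJ_half_line_integral:
  assumes \<theta>: "0 < \<theta>" "\<theta> < 1" and d: "d > 0"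
  shows "has_bochner_integral lborel (\<lambda>\<tau>. truncJ p \<beta> \<theta> d (max 0 (d + \<tau>)) / \<bar>\<tau>\<bar> powr (1 + \<sigma>))
     (d powr (\<beta> * (p - 1) - \<sigma>) * trunc_lambda \<sigma> p \<beta> \<theta>)"
proof -
  let ?h = "\<lambda>t. truncJ p \<beta> \<theta> 1 (max 0 t) / \<bar>1 - t\<bar> powr (1 + \<sigma>)"
  have "has_bochner_integral lborel (\<lambda>\<tau>. ?h (1 + (1 / d) * \<tau>)) (trunc_lambda \<sigma> p \<beta> \<theta> /\<^sub>R \<bar>1 / d\<bar>)"
    using d truncJ_line_integral[OF \<theta>]
    by (subst (asm) lborel_has_bochner_integral_real_affine_iff[of "1 / d" _ _ 1]) auto
  then have int: "has_bochner_integral lborel (\<lambda>\<tau>. d powr (\<beta> * (p - 1) - \<sigma> - 1) * ?h (1 + (1 / d) * \<tau>))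
      (d powr (\<beta> * (p - 1) - \<sigma> - 1) * (trunc_lambda \<sigma> p \<beta> \<theta> /\<^sub>R \<bar>1 / d\<bar>))"
    by (intro has_bochner_integral_mult_right) auto
  have "d powr (\<beta> * (p - 1) - \<sigma> - 1) * (trunc_lambda \<sigma> p \<beta> \<theta> /\<^sub>R \<bar>1 / d\<bar>)
      = (d powr (\<beta> * (p - 1) - \<sigma> - 1) * d powr 1) * trunc_lambda \<sigma> p \<beta> \<theta>"
    using d by simp
  also have "d powr (\<beta> * (p - 1) - \<sigma> - 1) * d powr 1 = d powr (\<beta> * (p - 1) - \<sigma>)"
    by (simp only: powr_add[symmetric]) simp
  finally have val: "d powr (\<beta> * (p - 1) - \<sigma> - 1) * (trunc_lambda \<sigma> p \<beta> \<theta> /\<^sub>R \<bar>1 / d\<bar>)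
      = d powr (\<beta> * (p - 1) - \<sigma>) * trunc_lambda \<sigma> p \<beta> \<theta>" .
  have fn: "d powr (\<beta> * (p - 1) - \<sigma> - 1) * ?h (1 + (1 / d) * \<tau>)
      = truncJ p \<beta> \<theta> d (max 0 (d + \<tau>)) / \<bar>\<tau>\<bar> powr (1 + \<sigma>)" for \<tau>
  proof -
    have m: "max 0 (d + \<tau>) = d * max 0 (1 + (1 / d) * \<tau>)"
      using d by (simp add: max_mult_distrib_left distrib_left)
    have k: "\<bar>1 - (1 + (1 / d) * \<tau>)\<bar> powr (1 + \<sigma>) = \<bar>\<tau>\<bar> powr (1 + \<sigma>) / d powr (1 + \<sigma>)"
      using d by (simp add: powr_divide)
    have e: "d powr (\<beta> * (p - 1) - \<sigma> - 1) * d powr (1 + \<sigma>) = d powr (\<beta> * (p - 1))"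
      by (simp only: powr_add[symmetric]) simp
    have "d powr (\<beta> * (p - 1) - \<sigma> - 1) * ?h (1 + (1 / d) * \<tau>)
        = (d powr (\<beta> * (p - 1) - \<sigma> - 1) * d powr (1 + \<sigma>)) * truncJ p \<beta> \<theta> 1 (max 0 (1 + (1 / d) * \<tau>)) / \<bar>\<tau>\<bar> powr (1 + \<sigma>)"
      by (simp only: k) simp
    then show ?thesis by (simp only: e m truncJ_homogeneous[OF d max.cobounded1])
  qed
  show ?thesis using int by (simp only: val fn)
qed

end

text \<open>
  As a function of \<open>b\<close>, the truncated difference is non-negative for \<open>b \<le> \<theta> a\<close>, zero between \<open>\<theta> a\<close> and
  \<open>a/\<theta>\<close>, and non-positive beyond; on the two outer pieces it decreases because \<open>J\<close> increases.
\<close>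

lemma truncJ_antimono:
  assumes p: "1 < p" and "0 \<le> \<beta>" "0 < \<theta>" "\<theta> < 1" "0 < a" "0 \<le> b" "b \<le> b'"
  shows "truncJ p \<beta> \<theta> a b' \<le> truncJ p \<beta> \<theta> a b"
proof -
  have \<theta>a: "\<theta> * a \<le> a" using assms by simp
  have inc: "b powr \<beta> \<le> b' powr \<beta>" using assms by (intro powr_mono2) auto
  have *: "J p (a powr \<beta> - b' powr \<beta>) \<le> J p (a powr \<beta> - b powr \<beta>)"
    using inc by (intro J_mono p) auto
  have pos: "0 \<le> J p (a powr \<beta> - x powr \<beta>)" if "0 \<le> x" "x \<le> \<theta> * a" for x
  proof -
    have "x \<le> a" using that \<theta>a by linarith
    then have "x powr \<beta> \<le> a powr \<beta>" using that assms by (intro powr_mono2) auto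
    then show ?thesis using J_mono[OF p, of 0 "a powr \<beta> - x powr \<beta>"] by simp
  qed
  have neg: "J p (a powr \<beta> - x powr \<beta>) \<le> 0" if "0 \<le> x" "a \<le> \<theta> * x" for x
  proof -
    have "\<theta> * x \<le> x" using that assms by (simp add: mult_left_le_one_le)
    then have "a powr \<beta> \<le> x powr \<beta>" using that assms by (intro powr_mono2) auto
    then show ?thesis using J_mono[OF p, of "a powr \<beta> - x powr \<beta>" 0] by simp
  qed
  have "a \<le> \<theta> * b \<Longrightarrow> a \<le> \<theta> * b'"
    using assms mult_left_mono[of b b' \<theta>] by linarith
  moreover have "b' \<le> \<theta> * a \<Longrightarrow> b \<le> \<theta> * a" using assms by linarith
  ultimately show ?thesis
    using * pos[of b] neg[of b'] assms unfolding truncJ_def by auto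
qed

section \<open>Distance to the complement of a convex set\<close>

text \<open>
  Inside \<open>\<Omega>\<close> this is the distance to the boundary; unlike that one it vanishes outside, so that extension by
  zero is built in.
\<close>

definition outdist :: "(real ^ 'n) set \<Rightarrow> real ^ 'n \<Rightarrow> real" where
  "outdist \<Omega> x = infdist x (- \<Omega>)"

lemma outdist_lipschitz: "\<bar>outdist \<Omega> x - outdist \<Omega> y\<bar> \<le> norm (x - y)"
  unfolding outdist_def using infdist_triangle_abs[of x "- \<Omega>" y] by (simp add: dist_norm)

lemma outdist_nonneg [simp]: "0 \<le> outdist \<Omega> x"
  by (simp add: outdist_def infdist_nonneg)

lemma outdist_outside: "x \<notin> \<Omega> \<Longrightarrow> outdist \<Omega> x = 0"
  by (simp add: outdist_def)

lemma outdist_pos: "open \<Omega> \<Longrightarrow> \<Omega> \<noteq> UNIV \<Longrightarrow> x \<in> \<Omega> \<Longrightarrow> 0 < outdist \<Omega> x"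
  unfolding outdist_def by (intro infdist_pos_not_in_closed) auto

lemma in_if_dist_less_outdist: "norm (y - w) < outdist \<Omega> y \<Longrightarrow> w \<in> \<Omega>"
  using infdist_le[of w "- \<Omega>" y] by (force simp: outdist_def dist_norm)

lemma continuous_outdist: "continuous_on UNIV (outdist \<Omega>)"
  unfolding outdist_def by (intro continuous_intros)

lemma outdist_measurable [measurable]: "outdist \<Omega> \<in> borel_measurable borel"
  using continuous_outdist by (rule borel_measurable_continuous_onI)

text \<open>
  A segment from a point of \<open>\<Omega>\<close> to a point of the complement crosses the boundary.
\<close>

lemma bdist_eq_outdist:
  assumes \<Omega>: "open \<Omega>" "\<Omega> \<noteq> UNIV" and x: "x \<in> \<Omega>"
  shows "bdist \<Omega> x = outdist \<Omega> x"
proof -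
  have fr: "frontier \<Omega> \<noteq> {}" using x \<Omega>(2) frontier_eq_empty[of \<Omega>] by auto
  have sub: "frontier \<Omega> \<subseteq> - \<Omega>" using \<Omega>(1) by (auto simp: frontier_def interior_open)
  have "infdist x (frontier \<Omega>) \<le> dist x y" if y: "y \<in> - \<Omega>" for y
  proof -
    have "closed_segment x y \<inter> frontier \<Omega> \<noteq> {}"
      using x y by (intro connected_Int_frontier) auto
    then obtain z where z: "z \<in> closed_segment x y" "z \<in> frontier \<Omega>" by auto
    have "infdist x (frontier \<Omega>) \<le> dist x z" by (rule infdist_le[OF z(2)])
    also have "\<dots> \<le> dist x y" using z(1) segment_bound(1)[of z x y] by (simp add: dist_norm norm_minus_commute)
    finally show ?thesis .
  qed
  then have "infdist x (frontier \<Omega>) \<le> infdist x (- \<Omega>)"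
    using \<Omega>(2) by (subst (2) infdist_notempty) (auto intro!: cINF_greatest)
  moreover have "infdist x (- \<Omega>) \<le> infdist x (frontier \<Omega>)" by (rule infdist_mono[OF sub fr])
  ultimately show ?thesis by (simp add: bdist_def outdist_def)
qed

text \<open>
  Outside \<open>\<Omega>\<close> this rests on \<open>0 powr \<beta> = 0\<close>, which holds for \<open>\<beta> = 0\<close> and for negative \<open>\<beta>\<close> too.
\<close>

lemma U_fun_eq_outdist:
  assumes \<Omega>: "open \<Omega>" "\<Omega> \<noteq> UNIV"
  shows "U_fun \<Omega> \<beta> = (\<lambda>x. outdist \<Omega> x powr \<beta>)"
  using bdist_eq_outdist[OF \<Omega>] by (auto simp: U_fun_def outdist_outside)

text \<open>
  Let \<open>z\<close> be a nearest point of the complement and \<open>e\<close> the inner normal of a hyperplane separating \<open>z\<close> from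
  \<open>\<Omega>\<close>. From \<open>y \<in> \<Omega>\<close> one can move by any length below the distance in the direction \<open>-e\<close> without leaving
  \<open>\<Omega>\<close>, so the distance at \<open>y\<close> is at most \<open>e \<bullet> (y - z)\<close>. At \<open>x\<close> this quantity is also at most
  \<open>|x - z|\<close>, which is the distance, and so equality holds there.
\<close>

lemma outdist_le_supporting_half_space:
  assumes \<Omega>: "open \<Omega>" "convex \<Omega>" "\<Omega> \<noteq> UNIV" and x: "x \<in> \<Omega>"
  obtains e where "norm e = 1" "\<And>y. outdist \<Omega> y \<le> max 0 (outdist \<Omega> x + e \<bullet> (y - x))"
proof -
  have cl: "closed (- \<Omega>)" "- \<Omega> \<noteq> {}" using \<Omega> by auto
  obtain z where z: "z \<in> - \<Omega>" "infdist x (- \<Omega>) = dist x z"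
    using infdist_attains_inf[OF cl] by blast
  define d where "d = outdist \<Omega> x"
  have d: "d = norm (x - z)" by (simp add: d_def outdist_def z dist_norm)
  have "\<Omega> \<inter> {z} = {}" using z by auto
  then obtain a b where ab: "a \<noteq> 0" "\<forall>y\<in>\<Omega>. a \<bullet> y \<le> b" "\<forall>y\<in>{z}. a \<bullet> y \<ge> b"
    using separating_hyperplane_sets[of \<Omega> "{z}"] \<Omega>(2) x by auto
  define e where "e = - (a /\<^sub>R norm a)"
  have e: "norm e = 1" using ab(1) by (simp add: e_def)
  have ee: "e \<bullet> e = 1" using e by (simp add: dot_square_norm)
  have sup: "e \<bullet> z \<le> e \<bullet> y" if "y \<in> \<Omega>" for y
  proof -
    have "a \<bullet> y \<le> a \<bullet> z" using ab that by (auto intro: order_trans)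
    then show ?thesis by (simp add: e_def mult_left_mono)
  qed
  have inside: "outdist \<Omega> y \<le> e \<bullet> (y - z)" if "y \<in> \<Omega>" for y
  proof (rule dense_le)
    fix r assume r: "r < outdist \<Omega> y"
    show "r \<le> e \<bullet> (y - z)"
    proof (cases "r \<ge> 0")
      case True
      have "y - r *\<^sub>R e \<in> \<Omega>" using r True e by (intro in_if_dist_less_outdist[of y]) simp
      from sup[OF this] show ?thesis using ee by (simp add: inner_diff_right)
    next
      case False
      then show ?thesis using sup[OF that] by (simp add: inner_diff_right)
    qed
  qed
  have "e \<bullet> (x - z) \<le> d" using norm_cauchy_schwarz[of e "x - z"] e by (simp add: d)
  with inside[OF x] have eq: "e \<bullet> (x - z) = d" by (simp add: d_def)
  show thesis
  proof
    show "norm e = 1" by fact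
    fix y
    show "outdist \<Omega> y \<le> max 0 (outdist \<Omega> x + e \<bullet> (y - x))"
    proof (cases "y \<in> \<Omega>")
      case True
      from inside[OF this] eq show ?thesis by (simp add: inner_diff_right d_def[symmetric])
    qed (simp add: outdist_outside)
  qed
qed

lemma outdist_half_space:
  assumes "open_half_space \<Omega>"
  obtains e where "norm e = 1" "\<And>x y. x \<in> \<Omega> \<Longrightarrow> outdist \<Omega> y = max 0 (outdist \<Omega> x + e \<bullet> (y - x))"
proof -
  obtain a b where ab: "a \<noteq> 0" "\<Omega> = {x. a \<bullet> x > b}"
    using assms by (auto simp: open_half_space_def)
  define e where "e = a /\<^sub>R norm a"
  define c where "c = b / norm a"
  have e: "norm e = 1" using ab(1) by (simp add: e_def)
  have ee: "e \<bullet> e = 1" using e by (simp add: dot_square_norm)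
  have \<Omega>: "\<Omega> = {x. e \<bullet> x > c}" using ab by (auto simp: e_def c_def field_simps)
  have dist: "outdist \<Omega> y = e \<bullet> y - c" if y: "y \<in> \<Omega>" for y
  proof (rule antisym)
    have "y - (e \<bullet> y - c) *\<^sub>R e \<in> - \<Omega>" using ee by (simp add: \<Omega> inner_diff_right)
    from infdist_le[OF this, of y] show "outdist \<Omega> y \<le> e \<bullet> y - c"
      using y e by (simp add: outdist_def dist_norm \<Omega>)
    show "e \<bullet> y - c \<le> outdist \<Omega> y"
    proof (rule ccontr)
      assume "\<not> ?thesis"
      then have less: "outdist \<Omega> y < e \<bullet> y - c" by simp
      have "- \<Omega> \<noteq> {}" using \<open>y - (e \<bullet> y - c) *\<^sub>R e \<in> - \<Omega>\<close> by blast
      then obtain w where w: "w \<in> - \<Omega>" "dist y w < e \<bullet> y - c"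
        using less by (auto simp: outdist_def infdist_notempty cINF_less_iff)
      have "e \<bullet> (y - w) \<le> dist y w" using norm_cauchy_schwarz[of e "y - w"] e by (simp add: dist_norm)
      then show False using w by (simp add: \<Omega> inner_diff_right)
    qed
  qed
  show thesis
  proof
    show "norm e = 1" by fact
    fix x y assume x: "x \<in> \<Omega>"
    show "outdist \<Omega> y = max 0 (outdist \<Omega> x + e \<bullet> (y - x))"
    proof (cases "y \<in> \<Omega>")
      case True
      then show ?thesis using dist[OF x] dist[OF True] by (simp add: \<Omega> inner_diff_right)
    next
      case False
      then have "e \<bullet> y \<le> c" by (simp add: \<Omega>)
      then show ?thesis using dist[OF x] outdist_outside[OF False] by (simp add: inner_diff_right)
    qed
  qed
qed

lemma has_bochner_integral_lborel_translate:
  fixes f :: "'a::euclidean_space \<Rightarrow> real"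
  assumes "has_bochner_integral lborel (\<lambda>h. f (x + h)) I" and [measurable]: "f \<in> borel_measurable borel"
  shows "has_bochner_integral lborel f I"
proof -
  have "integrable (distr lborel borel ((+) x)) f" "integral\<^sup>L (distr lborel borel ((+) x)) f = I"
    using assms(1) by (simp_all add: integrable_distr_eq integral_distr has_bochner_integral_iff)
  then show ?thesis by (simp add: lborel_distr_plus has_bochner_integral_iff)
qed

text \<open>
  \<open>F\<^sub>\<theta>(x)\<close> for a half-space with inner normal \<open>e\<close>.
\<close>

lemma truncJ_half_space_integral:
  fixes e x :: "real ^ 'n" and \<sigma> p \<beta> \<theta> d :: real
  assumes p: "1 < p" and \<sigma>: "0 < \<sigma>" "\<sigma> < p" and \<beta>: "- 1 / (p - 1) < \<beta>" "\<beta> < \<sigma> / (p - 1)"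
    and \<theta>: "0 < \<theta>" "\<theta> < 1" and e: "norm e = 1" and d: "0 < d"
  shows "has_bochner_integral lborel
     (\<lambda>y. truncJ p \<beta> \<theta> d (max 0 (d + e \<bullet> (y - x))) / norm (x - y) powr (real CARD('n) + \<sigma>))
     (C_const CARD('n) \<sigma> * (d powr (\<beta> * (p - 1) - \<sigma>) * trunc_lambda \<sigma> p \<beta> \<theta>))"
proof -
  let ?g = "\<lambda>\<tau>. truncJ p \<beta> \<theta> d (max 0 (d + \<tau>))"
  note int = truncJ_half_line_integral[OF p \<sigma> \<beta> \<theta> d]
  have "has_bochner_integral lborel (\<lambda>h. ?g (e \<bullet> h) / norm h powr (real CARD('n) + \<sigma>))
     (C_const CARD('n) \<sigma> * (d powr (\<beta> * (p - 1) - \<sigma>) * trunc_lambda \<sigma> p \<beta> \<theta>))"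
    using kernel_ridge_integral[OF e \<sigma>(1), of ?g] int by (simp add: has_bochner_integral_iff)
  then show ?thesis
    using has_bochner_integral_lborel_translate[where x = x
        and f = "\<lambda>y. ?g (e \<bullet> (y - x)) / norm (x - y) powr (real CARD('n) + \<sigma>)"] by simp
qed

section \<open>Membership in the function spaces\<close>

lemma add_powr_le:
  fixes a b r :: real
  assumes "0 \<le> a" "0 \<le> b" "0 \<le> r"
  shows "(a + b) powr r \<le> 2 powr r * (a powr r + b powr r)"
proof -
  have "(a + b) powr r \<le> (2 * max a b) powr r" using assms by (intro powr_mono2) auto
  also have "\<dots> = 2 powr r * (max a b) powr r" using assms by (simp add: powr_mult)
  also have "\<dots> \<le> 2 powr r * (a powr r + b powr r)" by (intro mult_left_mono) (auto simp: max_def)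
  finally show ?thesis .
qed

lemma integrable_bracket:
  fixes \<sigma> :: real
  assumes \<sigma>: "\<sigma> > 0"
  shows "integrable lborel (\<lambda>y :: real ^ 'n. 1 / (1 + norm y) powr (real CARD('n) + \<sigma>))"
proof (rule integrableI_bounded)
  let ?q = "real CARD('n) + \<sigma>"
  have [measurable]: "indicator (ball (0 :: real ^ 'n) 1) \<in> borel_measurable borel"
    by (intro borel_measurable_indicator) simp
  have "(\<integral>\<^sup>+y. ennreal (norm (1 / (1 + norm (y :: real ^ 'n)) powr ?q)) \<partial>lborel)
      \<le> (\<integral>\<^sup>+y. indicator (ball 0 1) y + indicator {h. 1 \<le> norm h} y * ennreal (1 / norm (y :: real ^ 'n) powr ?q) \<partial>lborel)"
  proof (rule nn_integral_mono)
    fix y :: "real ^ 'n"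
    show "ennreal (norm (1 / (1 + norm y) powr ?q))
        \<le> indicator (ball 0 1) y + indicator {h. 1 \<le> norm h} y * ennreal (1 / norm y powr ?q)"
    proof (cases "norm y < 1")
      case True
      have "1 powr ?q \<le> (1 + norm y) powr ?q" using \<sigma> by (intro powr_mono2) auto
      then show ?thesis using True by (simp add: divide_le_eq_1)
    next
      case False
      have "norm y powr ?q \<le> (1 + norm y) powr ?q" using \<sigma> by (intro powr_mono2) auto
      moreover have "norm y \<noteq> 0" using False by linarith
      ultimately have "1 / (1 + norm y) powr ?q \<le> 1 / norm y powr ?q"
        by (intro divide_left_mono mult_pos_pos) (auto simp: add_nonneg_eq_0_iff)
      then show ?thesis using False by (simp add: ennreal_leI)
    qed
  qed
  also have "\<dots> = emeasure lborel (ball (0 :: real ^ 'n) 1) + (\<integral>\<^sup>+y. indicator {h. 1 \<le> norm h} y * ennreal (1 / norm (y :: real ^ 'n) powr ?q) \<partial>lborel)"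
    by (subst nn_integral_add) auto
  also have "\<dots> < \<infinity>"
    using kernel_far_finite[OF zero_less_one \<sigma>] emeasure_lborel_ball_finite[of "0 :: real ^ 'n" 1]
    by (simp add: ennreal_add_less_top)
  finally show "(\<integral>\<^sup>+y. ennreal (norm (1 / (1 + norm (y :: real ^ 'n)) powr ?q)) \<partial>lborel) < \<infinity>" .
qed simp

text \<open>
  Where the ratio of \<open>R y\<close> and \<open>d\<close> is outside the interval from \<open>1/2\<close> to 2, the power \<open>R\<^bsup>\<beta>(p-1)\<^esup>\<close> is
  controlled by \<open>|J(d\<^sup>\<beta> - R\<^sup>\<beta>)|\<close> plus a constant, and the truncated integral for \<open>\<theta> = 1/2\<close> converges; elsewhere
  the power is bounded. This covers at once the growth at infinity for \<open>\<beta> > 0\<close> and the singularity along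
  the boundary for \<open>\<beta> < 0\<close>.
\<close>

lemma half_space_tail_integrable:
  fixes e x :: "real ^ 'n" and \<sigma> p \<beta> d :: real
  assumes p: "1 < p" and \<sigma>: "0 < \<sigma>" "\<sigma> < p" and \<beta>: "- 1 / (p - 1) < \<beta>" "\<beta> < \<sigma> / (p - 1)"
    and e: "norm e = 1" and d: "0 < d"
  shows "integrable lborel (\<lambda>y. (max 0 (d + e \<bullet> (y - x)) powr \<beta>) powr (p - 1) / (1 + norm y) powr (real CARD('n) + \<sigma>))"
proof -
  let ?q = "real CARD('n) + \<sigma>"
  define R where "R = (\<lambda>y. max 0 (d + e \<bullet> (y - x)))"
  define w where "w = (\<lambda>y. (R y powr \<beta>) powr (p - 1))"
  define t where "t = (\<lambda>y. truncJ p \<beta> (1/2) d (R y))"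
  have [measurable]: "R \<in> borel_measurable borel" by (simp add: R_def)
  have [measurable]: "w \<in> borel_measurable borel" "t \<in> borel_measurable borel" by (simp_all add: w_def t_def)
  (* The two summands of M are the additive constants for the two ranges of R y. *)
  define M where "M = 2 powr (p - 1) * (d powr \<beta>) powr (p - 1) + ((d / 2) powr \<beta> + (2 * d) powr \<beta>) powr (p - 1)"
  define K where "K = (1 + norm x) powr ?q"
  have int: "integrable lborel (\<lambda>y. t y / norm (x - y) powr ?q)"
    using truncJ_half_space_integral[OF p \<sigma> \<beta> _ _ e d, of "1/2" x] by (simp add: t_def R_def has_bochner_integral_iff)
  have w_le: "w y \<le> 2 powr (p - 1) * \<bar>t y\<bar> + M" for y
  proof (cases "d \<le> 1/2 * R y \<or> R y \<le> 1/2 * d")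
    case True
    then have t: "\<bar>t y\<bar> = \<bar>d powr \<beta> - R y powr \<beta>\<bar> powr (p - 1)" by (simp add: t_def truncJ_def abs_J)
    have "w y \<le> (\<bar>d powr \<beta> - R y powr \<beta>\<bar> + d powr \<beta>) powr (p - 1)"
      unfolding w_def using p by (intro powr_mono2) auto
    also have "\<dots> \<le> 2 powr (p - 1) * (\<bar>d powr \<beta> - R y powr \<beta>\<bar> powr (p - 1) + (d powr \<beta>) powr (p - 1))"
      using p by (intro add_powr_le) auto
    finally have "w y \<le> 2 powr (p - 1) * \<bar>t y\<bar> + 2 powr (p - 1) * (d powr \<beta>) powr (p - 1)"
      unfolding t by (simp only: distrib_left)
    then show ?thesis unfolding M_def using powr_ge_zero[of "(d / 2) powr \<beta> + (2 * d) powr \<beta>" "p - 1"] by linarith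
  next
    case False
    then have R: "d / 2 \<le> R y" "R y \<le> 2 * d" by auto
    have "R y powr \<beta> \<le> (d / 2) powr \<beta> + (2 * d) powr \<beta>"
    proof (cases "\<beta> \<ge> 0")
      case True
      then have "R y powr \<beta> \<le> (2 * d) powr \<beta>" using R d by (intro powr_mono2) auto
      then show ?thesis by (simp add: add_increasing)
    next
      case False
      then have "R y powr \<beta> \<le> (d / 2) powr \<beta>" using R d by (intro powr_mono2') auto
      then show ?thesis by (simp add: add_increasing2)
    qed
    then have "w y \<le> ((d / 2) powr \<beta> + (2 * d) powr \<beta>) powr (p - 1)"
      unfolding w_def using p by (intro powr_mono2) auto
    also have "\<dots> \<le> 2 powr (p - 1) * \<bar>t y\<bar> + M" unfolding M_def by (simp add: add_increasing)
    finally show ?thesis .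
  qed
  have "integrable lborel (\<lambda>y. w y / (1 + norm y) powr ?q)"
  proof (rule Bochner_Integration.integrable_bound)
    show "integrable lborel (\<lambda>y. 2 powr (p - 1) * K * norm (t y / norm (x - y) powr ?q) + M * (1 / (1 + norm y) powr ?q))"
      using int integrable_bracket[OF \<sigma>(1), where 'n = 'n]
      by (intro Bochner_Integration.integrable_add integrable_mult_right integrable_norm)
    show "AE y in lborel. norm (w y / (1 + norm y) powr ?q) \<le> norm (2 powr (p - 1) * K * norm (t y / norm (x - y) powr ?q) + M * (1 / (1 + norm y) powr ?q))"
      using AE_lborel_singleton[of x]
    proof eventually_elim
      fix y assume "y \<noteq> x"
      then have pos: "norm (x - y) > 0" by simp
      have "norm (x - y) \<le> norm x + norm y" by (rule norm_triangle_ineq4)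
      also have "\<dots> \<le> (1 + norm x) * (1 + norm y)" by (simp add: algebra_simps)
      finally have "norm (x - y) powr ?q \<le> ((1 + norm x) * (1 + norm y)) powr ?q"
        using \<sigma> by (intro powr_mono2) auto
      then have "norm (x - y) powr ?q \<le> K * (1 + norm y) powr ?q"
        by (simp add: K_def powr_mult)
      then have k: "1 / (1 + norm y) powr ?q \<le> K / norm (x - y) powr ?q"
        using pos by (simp add: field_simps add_nonneg_eq_0_iff)
      have "w y / (1 + norm y) powr ?q \<le> (2 powr (p - 1) * \<bar>t y\<bar> + M) * (1 / (1 + norm y) powr ?q)"
        using w_le[of y] by (simp add: divide_right_mono)
      also have "\<dots> = 2 powr (p - 1) * \<bar>t y\<bar> * (1 / (1 + norm y) powr ?q) + M * (1 / (1 + norm y) powr ?q)"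
        by (rule distrib_right)
      also have "\<dots> \<le> 2 powr (p - 1) * \<bar>t y\<bar> * (K / norm (x - y) powr ?q) + M * (1 / (1 + norm y) powr ?q)"
        by (intro add_right_mono mult_left_mono k) auto
      also have "\<dots> = 2 powr (p - 1) * K * norm (t y / norm (x - y) powr ?q) + M * (1 / (1 + norm y) powr ?q)"
        by simp
      finally have *: "w y / (1 + norm y) powr ?q \<le> 2 powr (p - 1) * K * norm (t y / norm (x - y) powr ?q) + M * (1 / (1 + norm y) powr ?q)" .
      have "norm (w y / (1 + norm y) powr ?q) = w y / (1 + norm y) powr ?q" by (simp add: w_def)
      with * show "norm (w y / (1 + norm y) powr ?q) \<le> norm (2 powr (p - 1) * K * norm (t y / norm (x - y) powr ?q) + M * (1 / (1 + norm y) powr ?q))"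
        by (simp only: real_norm_def)
    qed
  qed simp
  then show ?thesis by (simp add: w_def R_def)
qed

text \<open>
  On a compact set the weight is bounded below, which gives local integrability.
\<close>

lemma tail_spaceI:
  fixes u :: "real ^ 'n \<Rightarrow> real"
  assumes [measurable]: "u \<in> borel_measurable borel" and q: "s * p > 0"
    and int: "integrable lborel (\<lambda>x. \<bar>u x\<bar> powr (p - 1) / (1 + norm x) powr (real CARD('n) + s * p))"
  shows "u \<in> tail_space s p"
proof -
  let ?q = "real CARD('n) + s * p"
  have "u \<in> Lp_on (p - 1) K" if K: "compact K" for K
  proof -
    obtain B where B: "\<And>x. x \<in> K \<Longrightarrow> norm x \<le> B"
      using compact_imp_bounded[OF K] by (auto simp: bounded_iff)
    have [measurable]: "K \<in> sets borel" using K by (simp add: borel_compact)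
    have "integrable lborel (\<lambda>x. indicator K x *\<^sub>R \<bar>u x\<bar> powr (p - 1))"
    proof (rule Bochner_Integration.integrable_bound)
      show "integrable lborel (\<lambda>x. (1 + \<bar>B\<bar>) powr ?q * (\<bar>u x\<bar> powr (p - 1) / (1 + norm x) powr ?q))"
        using int by (rule integrable_mult_right)
      show "AE x in lborel. norm (indicator K x *\<^sub>R \<bar>u x\<bar> powr (p - 1))
          \<le> norm ((1 + \<bar>B\<bar>) powr ?q * (\<bar>u x\<bar> powr (p - 1) / (1 + norm x) powr ?q))"
      proof (rule AE_I2)
        fix x :: "real ^ 'n"
        show "norm (indicator K x *\<^sub>R \<bar>u x\<bar> powr (p - 1))
          \<le> norm ((1 + \<bar>B\<bar>) powr ?q * (\<bar>u x\<bar> powr (p - 1) / (1 + norm x) powr ?q))"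
        proof (cases "x \<in> K")
          case True
          have "(1 + norm x) powr ?q \<le> (1 + \<bar>B\<bar>) powr ?q"
            using q B[OF True] by (intro powr_mono2) auto
          moreover have "(1 + norm x) powr ?q > 0" by (simp add: add_nonneg_eq_0_iff)
          ultimately have "1 \<le> (1 + \<bar>B\<bar>) powr ?q / (1 + norm x) powr ?q"
            by simp
          then have "1 * \<bar>u x\<bar> powr (p - 1) \<le> (1 + \<bar>B\<bar>) powr ?q / (1 + norm x) powr ?q * \<bar>u x\<bar> powr (p - 1)"
            by (rule mult_right_mono) simp
          then show ?thesis using True by simp
        qed simp
      qed
    qed simp
    then show ?thesis
      unfolding Lp_on_def set_integrable_def set_borel_measurable_def
      by (auto intro!: measurable_completion integrable_completion[THEN iffD2])
  qed
  then show ?thesis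
    unfolding tail_space_def Lp_loc_def using int by (auto simp: integrable_completion)
qed

text \<open>
  For \<open>\<beta> \<ge> 0\<close> the function is dominated by that of a supporting half-space.
\<close>

lemma U_tail_space:
  fixes \<Omega> :: "(real ^ 'n) set"
  assumes p: "1 < p" and s: "0 < s" "s < 1" and \<Omega>: "open \<Omega>" "convex \<Omega>" "\<Omega> \<noteq> UNIV"
    and \<beta>: "- 1 / (p - 1) < \<beta>" "\<beta> < s * p / (p - 1)" and or: "0 \<le> \<beta> \<or> open_half_space \<Omega>"
  shows "(\<lambda>x. outdist \<Omega> x powr \<beta>) \<in> tail_space s p"
    "integrable lborel (\<lambda>y. \<bar>outdist \<Omega> y powr \<beta>\<bar> powr (p - 1) / (1 + norm y) powr (real CARD('n) + s * p))"
proof -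
  have \<sigma>: "0 < s * p" "s * p < p" using s p by simp_all
  have "integrable lborel (\<lambda>y. \<bar>outdist \<Omega> y powr \<beta>\<bar> powr (p - 1) / (1 + norm y) powr (real CARD('n) + s * p))"
  proof (cases "\<Omega> = {}")
    case True
    then show ?thesis by (simp add: outdist_outside)
  next
    case False
    then obtain x where x: "x \<in> \<Omega>" by auto
    define d where "d = outdist \<Omega> x"
    have d: "d > 0" using outdist_pos[OF \<Omega>(1,3) x] by (simp add: d_def)
    have "\<exists>e. norm e = 1 \<and> (\<forall>y. outdist \<Omega> y powr \<beta> \<le> max 0 (d + e \<bullet> (y - x)) powr \<beta>)"
    proof (cases "0 \<le> \<beta>")
      case True
      obtain e where "norm e = 1" "\<And>y. outdist \<Omega> y \<le> max 0 (d + e \<bullet> (y - x))"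
        using outdist_le_supporting_half_space[OF \<Omega> x] unfolding d_def by blast
      then show ?thesis using True by (intro exI[of _ e]) (auto intro!: powr_mono2)
    next
      case False
      then have "open_half_space \<Omega>" using or by simp
      then obtain e where "norm e = 1" "\<And>y. outdist \<Omega> y = max 0 (d + e \<bullet> (y - x))"
        using outdist_half_space[of \<Omega>] x unfolding d_def by metis
      then show ?thesis by (intro exI[of _ e]) auto
    qed
    then obtain e where e: "norm e = 1" "\<And>y. outdist \<Omega> y powr \<beta> \<le> max 0 (d + e \<bullet> (y - x)) powr \<beta>" by auto
    show ?thesis
    proof (rule Bochner_Integration.integrable_bound[OF half_space_tail_integrable[OF p \<sigma> \<beta> e(1) d, of x]])
      show "AE y in lborel. norm (\<bar>outdist \<Omega> y powr \<beta>\<bar> powr (p - 1) / (1 + norm y) powr (real CARD('n) + s * p))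
         \<le> norm ((max 0 (d + e \<bullet> (y - x)) powr \<beta>) powr (p - 1) / (1 + norm y) powr (real CARD('n) + s * p))"
        using p by (intro AE_I2) (auto intro!: divide_right_mono powr_mono2[of "p - 1" "_ powr \<beta>"] e(2))
    qed simp
  qed
  then show "integrable lborel (\<lambda>y. \<bar>outdist \<Omega> y powr \<beta>\<bar> powr (p - 1) / (1 + norm y) powr (real CARD('n) + s * p))" .
  then show "(\<lambda>x. outdist \<Omega> x powr \<beta>) \<in> tail_space s p"
    using \<sigma> by (intro tail_spaceI) auto
qed

lemma fst_borel_measurable [measurable]:
  "(fst :: 'a::euclidean_space \<times> 'b::euclidean_space \<Rightarrow> 'a) \<in> borel_measurable borel"
  by (intro borel_measurable_continuous_onI continuous_intros)

lemma snd_borel_measurable [measurable]: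
  "(snd :: 'a::euclidean_space \<times> 'b::euclidean_space \<Rightarrow> 'b) \<in> borel_measurable borel"
  by (intro borel_measurable_continuous_onI continuous_intros)

lemma nn_integral_lborel_iterated:
  fixes f :: "'a::euclidean_space \<times> 'b::euclidean_space \<Rightarrow> ennreal"
  assumes [measurable]: "f \<in> borel_measurable borel"
  shows "(\<integral>\<^sup>+z. f z \<partial>lborel) = (\<integral>\<^sup>+x. (\<integral>\<^sup>+y. f (x, y) \<partial>lborel) \<partial>lborel)"
proof -
  have "f \<in> borel_measurable (lborel \<Otimes>\<^sub>M lborel)" by (simp add: lborel_prod)
  from lborel.nn_integral_fst[OF this] show ?thesis by (simp add: lborel_prod)
qed

text \<open>
  Exchanging the two components is an orthogonal transformation of the product space.
\<close>

lemma nn_integral_lborel_swap: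
  fixes f :: "'a::euclidean_space \<times> 'a \<Rightarrow> ennreal"
  assumes [measurable]: "f \<in> borel_measurable borel"
  shows "(\<integral>\<^sup>+z. f (snd z, fst z) \<partial>lborel) = (\<integral>\<^sup>+z. f z \<partial>lborel)"
proof (rule nn_integral_lborel_orthogonal)
  have "linear (\<lambda>z :: 'a \<times> 'a. (snd z, fst z))"
    by (rule linearI) auto
  then show "orthogonal_transformation (\<lambda>z :: 'a \<times> 'a. (snd z, fst z))"
    by (auto simp: orthogonal_transformation_def inner_prod_def)
qed simp

lemma powr_lipschitz_on_Icc:
  fixes m M \<beta> :: real
  assumes m: "0 < m"
  obtains L where "0 \<le> L" "\<And>a b. m \<le> a \<Longrightarrow> a \<le> M \<Longrightarrow> m \<le> b \<Longrightarrow> b \<le> M \<Longrightarrow> \<bar>a powr \<beta> - b powr \<beta>\<bar> \<le> L * \<bar>a - b\<bar>"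
proof
  define L where "L = \<bar>\<beta>\<bar> * (m powr (\<beta> - 1) + M powr (\<beta> - 1))"
  show "0 \<le> L" by (simp add: L_def)
  fix a b assume ab: "m \<le> a" "a \<le> M" "m \<le> b" "b \<le> M"
  have "norm (a powr \<beta> - b powr \<beta>) \<le> L * norm (a - b)"
  proof (rule field_differentiable_bound[where S = "{m..M}" and f' = "\<lambda>z. \<beta> * z powr (\<beta> - 1)"])
    fix z assume z: "z \<in> {m..M}"
    then show "((\<lambda>z. z powr \<beta>) has_field_derivative \<beta> * z powr (\<beta> - 1)) (at z within {m..M})"
      using m by (auto intro!: derivative_eq_intros)
    have "z powr (\<beta> - 1) \<le> m powr (\<beta> - 1) + M powr (\<beta> - 1)"
    proof (cases "\<beta> \<ge> 1")
      case True
      then have "z powr (\<beta> - 1) \<le> M powr (\<beta> - 1)" using z m by (intro powr_mono2) auto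
      then show ?thesis by (simp add: add_increasing)
    next
      case False
      then have "z powr (\<beta> - 1) \<le> m powr (\<beta> - 1)" using z m by (intro powr_mono2') auto
      then show ?thesis by (simp add: add_increasing2)
    qed
    then show "norm (\<beta> * z powr (\<beta> - 1)) \<le> L"
      by (simp add: L_def abs_mult mult_left_mono)
  qed (use ab in auto)
  then show "\<bar>a powr \<beta> - b powr \<beta>\<bar> \<le> L * \<bar>a - b\<bar>" by simp
qed

lemma powr_bounded_on_Icc:
  fixes m M \<beta> a :: real
  assumes "0 < m" "m \<le> a" "a \<le> M"
  shows "a powr \<beta> \<le> m powr \<beta> + M powr \<beta>"
proof (cases "\<beta> \<ge> 0")
  case True
  then have "a powr \<beta> \<le> M powr \<beta>" using assms by (intro powr_mono2) auto
  then show ?thesis by (simp add: add_increasing)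
next
  case False
  then have "a powr \<beta> \<le> m powr \<beta>" using assms by (intro powr_mono2') auto
  then show ?thesis by (simp add: add_increasing2)
qed

lemma outdist_bounds_on_compact:
  assumes "open \<Omega>" "\<Omega> \<noteq> UNIV" "compact K" "K \<subseteq> \<Omega>"
  obtains m M where "0 < m" "m \<le> M" "\<And>x. x \<in> K \<Longrightarrow> m \<le> outdist \<Omega> x \<and> outdist \<Omega> x \<le> M"
proof (cases "K = {}")
  case True
  then show ?thesis using that[of 1 1] by simp
next
  case False
  have cont: "continuous_on K (outdist \<Omega>)" using continuous_outdist continuous_on_subset by blast
  obtain x0 where x0: "x0 \<in> K" "\<And>x. x \<in> K \<Longrightarrow> outdist \<Omega> x0 \<le> outdist \<Omega> x"
    using continuous_attains_inf[OF assms(3) False cont] by blast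
  obtain x1 where x1: "x1 \<in> K" "\<And>x. x \<in> K \<Longrightarrow> outdist \<Omega> x \<le> outdist \<Omega> x1"
    using continuous_attains_sup[OF assms(3) False cont] by blast
  show ?thesis
    by (rule that[of "outdist \<Omega> x0" "outdist \<Omega> x1"])
       (use x0 x1 assms outdist_pos[OF assms(1,2)] in auto)
qed

text \<open>
  By translation invariance the value does not depend on the centre.
\<close>

lemma kernel_near_integral_const:
  fixes R \<sigma> p :: real
  assumes \<sigma>: "0 < \<sigma>" and p: "\<sigma> < p" and R: "0 < R"
  obtains S where "\<And>x. (\<integral>\<^sup>+y. indicator {y. norm (x - y) \<le> R} y *
       ennreal (norm (x - y) powr p / norm (x - y :: real ^ 'n) powr (real CARD('n) + \<sigma>)) \<partial>lborel) = ennreal S" "0 \<le> S"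
proof -
  let ?q = "real CARD('n) + \<sigma>"
  let ?I = "\<integral>\<^sup>+h. indicator {h. norm h \<le> R} h * ennreal (norm h powr p) * ennreal (1 / norm (h :: real ^ 'n) powr ?q) \<partial>lborel"
  have fin: "?I < \<infinity>" by (rule kernel_near_finite[OF \<sigma> p R])
  have eq: "(\<integral>\<^sup>+y. indicator {y. norm (x - y) \<le> R} y *
       ennreal (norm (x - y) powr p / norm (x - y :: real ^ 'n) powr ?q) \<partial>lborel) = ?I" for x
  proof -
    let ?f = "\<lambda>y. indicator {y. norm (x - y) \<le> R} y * ennreal (norm (x - y) powr p / norm (x - y :: real ^ 'n) powr ?q)"
    have "{y. norm (x - y) \<le> R} \<in> sets borel" by measurable
    then have "?f \<in> borel_measurable borel" by measurable
    from nn_integral_lborel_translate[OF this, of x]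
    have "(\<integral>\<^sup>+y. ?f y \<partial>lborel) = (\<integral>\<^sup>+h. ?f (x + h) \<partial>lborel)" by simp
    also have "\<dots> = ?I"
    proof (rule nn_integral_cong)
      fix h :: "real ^ 'n"
      have "ennreal (norm h powr p / norm h powr ?q) = ennreal (norm h powr p) * ennreal (1 / norm h powr ?q)"
        by (simp flip: ennreal_mult'')
      then show "?f (x + h) = indicator {h. norm h \<le> R} h * ennreal (norm h powr p) * ennreal (1 / norm h powr ?q)"
        by (simp add: indicator_def mult.assoc)
    qed
    finally show ?thesis .
  qed
  obtain S where "?I = ennreal S" "0 \<le> S" using fin by (cases ?I) auto
  then show thesis using that[of S] eq by simp
qed

abbreviation kden :: "real \<Rightarrow> real \<Rightarrow> (real ^ 'n) \<times> (real ^ 'n) \<Rightarrow> real" where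
  "kden s p z \<equiv> norm (fst z - snd z) powr (real CARD('n) + s * p)"

text \<open>
  For a Lipschitz function the integrand is at most \<open>L\<^sup>p |x - y|\<^bsup>p-N-\<sigma>\<^esup>\<close>, which is integrable near the
  diagonal. The set \<open>B\<close> is taken to be \<open>A\<close> for the seminorm on a bounded set, and the whole space for pairs
  with only one point in the support of a test function.
\<close>

lemma near_gagliardo_finite:
  fixes u :: "real ^ 'n \<Rightarrow> real" and A :: "(real ^ 'n) set"
  assumes p: "1 < p" and s: "0 < s" "s < 1" and R: "0 < R" and L: "0 \<le> L"
    and [measurable]: "u \<in> borel_measurable borel" "A \<in> sets borel" and A: "emeasure lborel A < \<infinity>"
    and lip: "\<And>x y. x \<in> A \<Longrightarrow> y \<in> B \<Longrightarrow> norm (x - y) \<le> R \<Longrightarrow> \<bar>u x - u y\<bar> \<le> L * norm (x - y)"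
    and [measurable]: "B \<in> sets borel"
  shows "(\<integral>\<^sup>+z. indicator {z. fst z \<in> A \<and> snd z \<in> B \<and> norm (fst z - snd z) \<le> R} z *
            ennreal (\<bar>u (fst z) - u (snd z)\<bar> powr p / kden s p z) \<partial>lborel) < \<infinity>"
proof -
  have \<sigma>: "0 < s * p" "s * p < p" using s p by simp_all
  let ?q = "real CARD('n) + s * p"
  obtain S where S: "\<And>x. (\<integral>\<^sup>+y. indicator {y. norm (x - y) \<le> R} y *
       ennreal (norm (x - y) powr p / norm (x - y :: real ^ 'n) powr ?q) \<partial>lborel) = ennreal S" "0 \<le> S"
    using kernel_near_integral_const[OF \<sigma> R, where 'n = 'n] by blast
  have [measurable]: "{z :: (real ^ 'n) \<times> (real ^ 'n). fst z \<in> A \<and> snd z \<in> B \<and> norm (fst z - snd z) \<le> R} \<in> sets borel"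
    by measurable
  have "(\<integral>\<^sup>+z. indicator {z. fst z \<in> A \<and> snd z \<in> B \<and> norm (fst z - snd z) \<le> R} z *
            ennreal (\<bar>u (fst z) - u (snd z)\<bar> powr p / kden s p z) \<partial>lborel)
     = (\<integral>\<^sup>+x. (\<integral>\<^sup>+y. indicator {z. fst z \<in> A \<and> snd z \<in> B \<and> norm (fst z - snd z) \<le> R} (x, y) *
            ennreal (\<bar>u x - u y\<bar> powr p / norm (x - y) powr ?q) \<partial>lborel) \<partial>lborel)"
    by (subst nn_integral_lborel_iterated) simp_all
  also have "\<dots> \<le> (\<integral>\<^sup>+x. indicator A x * (ennreal (L powr p) * ennreal S) \<partial>lborel)"
  proof (rule nn_integral_mono)
    fix x :: "real ^ 'n"
    show "(\<integral>\<^sup>+y. indicator {z. fst z \<in> A \<and> snd z \<in> B \<and> norm (fst z - snd z) \<le> R} (x, y) *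
            ennreal (\<bar>u x - u y\<bar> powr p / norm (x - y) powr ?q) \<partial>lborel) \<le> indicator A x * (ennreal (L powr p) * ennreal S)"
    proof (cases "x \<in> A")
      case True
      have [measurable]: "{y. norm (x - y) \<le> R} \<in> sets borel" by measurable
      have "(\<integral>\<^sup>+y. indicator {z. fst z \<in> A \<and> snd z \<in> B \<and> norm (fst z - snd z) \<le> R} (x, y) *
            ennreal (\<bar>u x - u y\<bar> powr p / norm (x - y) powr ?q) \<partial>lborel)
         \<le> (\<integral>\<^sup>+y. ennreal (L powr p) * (indicator {y. norm (x - y) \<le> R} y *
       ennreal (norm (x - y) powr p / norm (x - y :: real ^ 'n) powr ?q)) \<partial>lborel)"
      proof (rule nn_integral_mono)
        fix y :: "real ^ 'n"
        show "indicator {z. fst z \<in> A \<and> snd z \<in> B \<and> norm (fst z - snd z) \<le> R} (x, y) *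
            ennreal (\<bar>u x - u y\<bar> powr p / norm (x - y) powr ?q)
          \<le> ennreal (L powr p) * (indicator {y. norm (x - y) \<le> R} y * ennreal (norm (x - y) powr p / norm (x - y) powr ?q))"
        proof (cases "y \<in> B \<and> norm (x - y) \<le> R")
          case yB: True
          then have "\<bar>u x - u y\<bar> powr p \<le> (L * norm (x - y)) powr p"
            using lip[OF True] p by (intro powr_mono2) auto
          also have "\<dots> = L powr p * norm (x - y) powr p" using L by (simp add: powr_mult)
          finally have "\<bar>u x - u y\<bar> powr p / norm (x - y) powr ?q \<le> L powr p * (norm (x - y) powr p / norm (x - y) powr ?q)"
            by (simp add: divide_right_mono)
          then show ?thesis using yB True by (simp add: ennreal_mult'[symmetric] ennreal_leI)
        qed auto
      qed
      also have "\<dots> = ennreal (L powr p) * ennreal S"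
        by (subst nn_integral_cmult) (simp_all add: S)
      finally show ?thesis using True by simp
    qed simp
  qed
  also have "\<dots> = emeasure lborel A * (ennreal (L powr p) * ennreal S)"
    by (simp add: nn_integral_multc)
  also have "\<dots> < \<infinity>" using A by (simp add: ennreal_mult_less_top)
  finally show ?thesis .
qed

text \<open>
  On a compact subset of \<open>\<Omega>\<close> the distance stays between two positive constants, where the power function is
  bounded and Lipschitz.
\<close>

lemma outdist_powr_Wsp_loc:
  fixes \<Omega> :: "(real ^ 'n) set"
  assumes p: "1 < p" and s: "0 < s" "s < 1" and \<Omega>: "open \<Omega>" "\<Omega> \<noteq> UNIV"
  shows "(\<lambda>x. outdist \<Omega> x powr \<beta>) \<in> Wsp_loc s p \<Omega>"
proof -
  define u where "u = (\<lambda>x. outdist \<Omega> x powr \<beta>)"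
  have [measurable]: "u \<in> borel_measurable borel" by (simp add: u_def)
  have Lp: "u \<in> Lp_on p A" if [measurable]: "A \<in> sets borel" and A: "A \<subseteq> K" and K: "compact K" "K \<subseteq> \<Omega>" for A K
  proof -
    obtain m M where mM: "0 < m" "m \<le> M" "\<And>x. x \<in> K \<Longrightarrow> m \<le> outdist \<Omega> x \<and> outdist \<Omega> x \<le> M"
      using outdist_bounds_on_compact[OF \<Omega> K] by metis
    have fin: "emeasure lborel A < \<infinity>"
      using emeasure_bounded_finite[of A] bounded_subset[OF compact_imp_bounded[OF K(1)] A] by simp
    have "integrable lborel (\<lambda>x. indicator A x *\<^sub>R \<bar>u x\<bar> powr p)"
    proof (rule Bochner_Integration.integrable_bound)
      show "integrable lborel (\<lambda>x. indicator A x *\<^sub>R ((m powr \<beta> + M powr \<beta>) powr p))"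
        using fin by (intro integrable_scaleR_left) (simp add: integrable_indicator_iff)
      show "AE x in lborel. norm (indicator A x *\<^sub>R \<bar>u x\<bar> powr p) \<le> norm (indicator A x *\<^sub>R ((m powr \<beta> + M powr \<beta>) powr p))"
      proof (rule AE_I2)
        fix x
        show "norm (indicator A x *\<^sub>R \<bar>u x\<bar> powr p) \<le> norm (indicator A x *\<^sub>R ((m powr \<beta> + M powr \<beta>) powr p))"
        proof (cases "x \<in> A")
          case True
          then have "\<bar>u x\<bar> \<le> m powr \<beta> + M powr \<beta>"
            using powr_bounded_on_Icc[OF mM(1), of "outdist \<Omega> x" M \<beta>] mM(3) A by (auto simp: u_def)
          then show ?thesis using True p by (simp add: powr_mono2)
        qed simp
      qed
    qed simp
    then show ?thesis
      unfolding Lp_on_def set_integrable_def set_borel_measurable_def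
      by (auto intro!: measurable_completion integrable_completion[THEN iffD2])
  qed
  have gag: "gagliardo s p A u < \<infinity>" if "open A" and K: "compact (closure A)" "closure A \<subseteq> \<Omega>" for A
  proof -
    have [measurable]: "A \<in> sets borel" using \<open>open A\<close> by simp
    obtain m M where mM: "0 < m" "m \<le> M" "\<And>x. x \<in> closure A \<Longrightarrow> m \<le> outdist \<Omega> x \<and> outdist \<Omega> x \<le> M"
      using outdist_bounds_on_compact[OF \<Omega> K] by metis
    obtain L where L: "0 \<le> L" "\<And>a b. m \<le> a \<Longrightarrow> a \<le> M \<Longrightarrow> m \<le> b \<Longrightarrow> b \<le> M \<Longrightarrow> \<bar>a powr \<beta> - b powr \<beta>\<bar> \<le> L * \<bar>a - b\<bar>"
      using powr_lipschitz_on_Icc[OF mM(1), of M \<beta>] by metis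
    have bA: "bounded A" using compact_imp_bounded[OF K(1)] bounded_subset closure_subset by blast
    then obtain R where R: "0 < R" "\<And>x. x \<in> A \<Longrightarrow> norm x \<le> R" by (auto simp: bounded_pos)
    have fin: "emeasure lborel A < \<infinity>" using emeasure_bounded_finite[OF bA] by simp
    have R2: "0 < 2 * R" using R by simp
    have dA: "norm (x - y) \<le> 2 * R" if "x \<in> A" "y \<in> A" for x y
      using norm_triangle_ineq4[of x y] R(2)[OF that(1)] R(2)[OF that(2)] by linarith
    have lip: "\<bar>u x - u y\<bar> \<le> L * norm (x - y)" if "x \<in> A" "y \<in> A" for x y
    proof -
      have "x \<in> closure A" "y \<in> closure A" using that closure_subset by auto
      then have "\<bar>u x - u y\<bar> \<le> L * \<bar>outdist \<Omega> x - outdist \<Omega> y\<bar>"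
        unfolding u_def using mM(3) by (intro L(2)) auto
      also have "\<dots> \<le> L * norm (x - y)" by (intro mult_left_mono outdist_lipschitz L)
      finally show ?thesis .
    qed
    have "gagliardo s p A u = (\<integral>\<^sup>+z. indicator {z. fst z \<in> A \<and> snd z \<in> A \<and> norm (fst z - snd z) \<le> 2 * R} z *
            ennreal (\<bar>u (fst z) - u (snd z)\<bar> powr p / kden s p z) \<partial>lborel)"
      unfolding gagliardo_def nn_integral_completion
      by (intro nn_integral_cong) (auto simp: indicator_def dA)
    also have "\<dots> < \<infinity>"
      by (rule near_gagliardo_finite[OF p s R2 L(1)]) (use fin lip in auto)
    finally show ?thesis .
  qed
  have "u \<in> Lp_on p K" if "compact K" "K \<subseteq> \<Omega>" for K
    using Lp[of K K] that by (simp add: borel_compact)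
  moreover have "u \<in> Lp_on p A" if "open A" "compact (closure A)" "closure A \<subseteq> \<Omega>" for A
    using Lp[of A "closure A"] that closure_subset by auto
  ultimately have "u \<in> Wsp_loc s p \<Omega>"
    unfolding Wsp_loc_def Wsp_def Lp_loc_def using gag by auto
  then show ?thesis by (simp add: u_def)
qed

section \<open>The energy as a limit of truncated inner integrals\<close>

lemma J_diff_le:
  assumes p: "1 < p" and "0 \<le> a" "0 \<le> b"
  shows "\<bar>J p (a - b)\<bar> \<le> 2 powr (p - 1) * (a powr (p - 1) + b powr (p - 1))"
proof -
  have "\<bar>J p (a - b)\<bar> \<le> (a + b) powr (p - 1)"
    unfolding abs_J using assms by (intro powr_mono2) auto
  also have "\<dots> \<le> 2 powr (p - 1) * (a powr (p - 1) + b powr (p - 1))"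
    using assms by (intro add_powr_le) auto
  finally show ?thesis .
qed

text \<open>
  A crude form of Young's inequality, which splits the energy density near the diagonal into the seminorm
  densities of \<open>u\<close> and \<open>\<phi>\<close>.
\<close>

lemma powr_mult_le_add:
  assumes p: "1 < p" and ab: "0 \<le> a" "0 \<le> (b::real)"
  shows "a powr (p - 1) * b \<le> a powr p + b powr p"
proof -
  define c where "c = max a b"
  have "a powr (p - 1) * b \<le> c powr (p - 1) * c powr 1"
    using p ab by (intro mult_mono powr_mono2) (auto simp: c_def)
  also have "\<dots> = c powr p" by (simp only: powr_add[symmetric]) simp
  also have "\<dots> \<le> a powr p + b powr p" by (auto simp: c_def max_def)
  finally show ?thesis .
qed

lemma abs_truncJ_le: "\<bar>truncJ p \<beta> \<theta> a b\<bar> \<le> \<bar>J p (a powr \<beta> - b powr \<beta>)\<bar>"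
  by (simp add: truncJ_def)

lemma truncJ_antisym: "truncJ p \<beta> \<theta> b a = - truncJ p \<beta> \<theta> a b"
proof -
  have "J p (b powr \<beta> - a powr \<beta>) = - J p (a powr \<beta> - b powr \<beta>)"
    using J_minus[of p "a powr \<beta> - b powr \<beta>"] by simp
  then show ?thesis by (auto simp: truncJ_def)
qed

text \<open>
  A Borel test function \<open>\<phi>\<close> with support in \<open>K\<close>, together with bounds \<open>m\<close> and \<open>M\<close> for the distance on
  \<open>K\<close>; \<open>tail\<close> says that \<open>D\<^sup>\<beta>\<close> is in the tail space.
\<close>

locale hardy_test =
  fixes s p \<beta> :: real and \<Omega> K :: "(real ^ 'n) set" and \<phi> :: "real ^ 'n \<Rightarrow> real" and m M :: real
  assumes p: "1 < p" and s: "0 < s" "s < 1"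
    and K: "compact K" and m: "0 < m"
    and mM: "\<And>x. x \<in> K \<Longrightarrow> m \<le> outdist \<Omega> x" "\<And>x. x \<in> K \<Longrightarrow> outdist \<Omega> x \<le> M"
    and tail: "integrable lborel (\<lambda>y. \<bar>outdist \<Omega> y powr \<beta>\<bar> powr (p - 1) / (1 + norm y) powr (real CARD('n) + s * p))"
    and phi_borel [measurable]: "\<phi> \<in> borel_measurable borel" and phi_nonneg: "\<And>x. 0 \<le> \<phi> x"
    and phi_support: "\<And>x. x \<notin> K \<Longrightarrow> \<phi> x = 0"
    and phi_integrable: "integrable lborel \<phi>"
    and phi_gagliardo: "(\<integral>\<^sup>+z. ennreal (\<bar>\<phi> (fst z) - \<phi> (snd z)\<bar> powr p / kden s p z) \<partial>lborel) < \<infinity>"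
begin

definition u where "u x = outdist \<Omega> x powr \<beta>"

lemma u_measurable [measurable]: "u \<in> borel_measurable borel"
  unfolding u_def by measurable

lemma u_nonneg: "0 \<le> u x" by (simp add: u_def)

lemma sp: "0 < s * p" "s * p < p" using p s by simp_all

lemma K_borel [measurable]: "K \<in> sets borel" using K by (simp add: borel_compact)

lemma u_le: "x \<in> K \<Longrightarrow> u x \<le> m powr \<beta> + M powr \<beta>"
  unfolding u_def using powr_bounded_on_Icc[OF m mM(1,2)] by simp

text \<open>
  For \<open>x \<in> K\<close> and \<open>|x - y| \<ge> r\<close> the kernel is at most a constant times \<open>(1 + |y|)\<^bsup>-N-\<sigma>\<^esup>\<close>, and the tail
  condition applies.
\<close>

lemma far_inner_bound:
  assumes r: "0 < r"
  obtains S where "0 \<le> S"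
    "\<And>x. x \<in> K \<Longrightarrow> (\<integral>\<^sup>+y. indicator {y. r \<le> norm (x - y)} y *
        ennreal (\<bar>J p (u x - u y)\<bar> / norm (x - y) powr (real CARD('n) + s * p)) \<partial>lborel) \<le> ennreal S"
proof -
  let ?q = "real CARD('n) + s * p"
  obtain B where B: "0 < B" "\<And>x. x \<in> K \<Longrightarrow> norm x \<le> B"
    using compact_imp_bounded[OF K] by (auto simp: bounded_pos)
  define c where "c = ((1 + B) / r + 1) powr ?q"
  define U where "U = (m powr \<beta> + M powr \<beta>) powr (p - 1)"
  define w where "w = (\<lambda>y. c * 2 powr (p - 1) * (U * (1 / (1 + norm y) powr ?q) + \<bar>u y\<bar> powr (p - 1) / (1 + norm y) powr ?q))"
  have w0: "0 \<le> w y" for y by (simp add: w_def c_def U_def)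
  have w_int: "integrable lborel w"
    unfolding w_def using tail integrable_bracket[OF sp(1), where 'n = 'n]
    by (intro integrable_mult_right Bochner_Integration.integrable_add) (simp_all add: u_def)
  have "(\<integral>\<^sup>+y. indicator {y. r \<le> norm (x - y)} y *
        ennreal (\<bar>J p (u x - u y)\<bar> / norm (x - y) powr ?q) \<partial>lborel) \<le> ennreal (integral\<^sup>L lborel w)" if x: "x \<in> K" for x
  proof -
    have "(\<integral>\<^sup>+y. indicator {y. r \<le> norm (x - y)} y *
        ennreal (\<bar>J p (u x - u y)\<bar> / norm (x - y) powr ?q) \<partial>lborel) \<le> (\<integral>\<^sup>+y. ennreal (w y) \<partial>lborel)"
    proof (rule nn_integral_mono)
      fix y
      show "indicator {y. r \<le> norm (x - y)} y * ennreal (\<bar>J p (u x - u y)\<bar> / norm (x - y) powr ?q) \<le> ennreal (w y)"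
      proof (cases "r \<le> norm (x - y)")
        case True
        have pos: "0 < norm (x - y)" using True r by linarith
        have "norm y \<le> norm x + norm (x - y)" using norm_triangle_ineq4[of x "x - y"] by simp
        then have "1 + norm y \<le> (1 + B) + norm (x - y)" using B(2)[OF x] by simp
        also have "\<dots> \<le> (1 + B) * (norm (x - y) / r) + norm (x - y)"
          using True r B(1) mult_left_mono[of 1 "norm (x - y) / r" "1 + B"] by simp
        also have "\<dots> = ((1 + B) / r + 1) * norm (x - y)" by (simp add: algebra_simps)
        finally have "(1 + norm y) powr ?q \<le> (((1 + B) / r + 1) * norm (x - y)) powr ?q"
          using sp by (intro powr_mono2) auto
        also have "\<dots> = c * norm (x - y) powr ?q" using B r by (simp add: c_def powr_mult)
        finally have le: "(1 + norm y) powr ?q \<le> c * norm (x - y) powr ?q" .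
        have "0 < (1 + norm y) powr ?q" by (simp add: add_nonneg_eq_0_iff)
        then have k: "1 / norm (x - y) powr ?q \<le> c / (1 + norm y) powr ?q"
          using le pos by (simp add: field_simps)
        have "\<bar>J p (u x - u y)\<bar> \<le> 2 powr (p - 1) * (u x powr (p - 1) + u y powr (p - 1))"
          by (rule J_diff_le[OF p u_nonneg u_nonneg])
        also have "\<dots> \<le> 2 powr (p - 1) * (U + \<bar>u y\<bar> powr (p - 1))"
          unfolding U_def using u_le[OF x] u_nonneg p by (intro mult_left_mono add_mono powr_mono2) auto
        finally have "\<bar>J p (u x - u y)\<bar> * (1 / norm (x - y) powr ?q)
            \<le> (2 powr (p - 1) * (U + \<bar>u y\<bar> powr (p - 1))) * (c / (1 + norm y) powr ?q)"
          by (rule mult_mono[OF _ k]) (auto simp: U_def)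
        also have "\<dots> = w y" by (simp add: w_def distrib_left distrib_right add_divide_distrib mult_ac)
        finally show ?thesis using True by (simp add: ennreal_leI)
      qed (simp add: w0)
    qed
    also have "\<dots> = ennreal (integral\<^sup>L lborel w)"
      using w_int w0 by (intro nn_integral_eq_integral) auto
    finally show ?thesis .
  qed
  then show thesis using that[of "integral\<^sup>L lborel w"] w0 by simp
qed

lemma far_energy_finite:
  assumes r: "0 < r"
  shows "(\<integral>\<^sup>+z. indicator {z. r \<le> norm (fst z - snd z)} z *
      ennreal (\<bar>J p (u (fst z) - u (snd z))\<bar> * \<phi> (fst z) / kden s p z) \<partial>lborel) < \<infinity>"
proof -
  let ?q = "real CARD('n) + s * p"
  obtain S where S: "0 \<le> S"
    "\<And>x. x \<in> K \<Longrightarrow> (\<integral>\<^sup>+y. indicator {y. r \<le> norm (x - y)} y *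
        ennreal (\<bar>J p (u x - u y)\<bar> / norm (x - y) powr ?q) \<partial>lborel) \<le> ennreal S"
    using far_inner_bound[OF r] by blast
  have [measurable]: "{z :: (real ^ 'n) \<times> (real ^ 'n). r \<le> norm (fst z - snd z)} \<in> sets borel" by measurable
  have "(\<integral>\<^sup>+z. indicator {z. r \<le> norm (fst z - snd z)} z *
      ennreal (\<bar>J p (u (fst z) - u (snd z))\<bar> * \<phi> (fst z) / kden s p z) \<partial>lborel)
    = (\<integral>\<^sup>+x. (\<integral>\<^sup>+y. indicator {z. r \<le> norm (fst z - snd z)} (x, y) *
      ennreal (\<bar>J p (u x - u y)\<bar> * \<phi> x / norm (x - y) powr ?q) \<partial>lborel) \<partial>lborel)"
    by (subst nn_integral_lborel_iterated) simp_all
  also have "\<dots> \<le> (\<integral>\<^sup>+x. ennreal (\<phi> x) * ennreal S \<partial>lborel)"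
  proof (rule nn_integral_mono)
    fix x :: "real ^ 'n"
    have [measurable]: "{y. r \<le> norm (x - y)} \<in> sets borel" by measurable
    show "(\<integral>\<^sup>+y. indicator {z. r \<le> norm (fst z - snd z)} (x, y) *
      ennreal (\<bar>J p (u x - u y)\<bar> * \<phi> x / norm (x - y) powr ?q) \<partial>lborel) \<le> ennreal (\<phi> x) * ennreal S"
    proof (cases "x \<in> K")
      case True
      have "(\<integral>\<^sup>+y. indicator {z. r \<le> norm (fst z - snd z)} (x, y) *
          ennreal (\<bar>J p (u x - u y)\<bar> * \<phi> x / norm (x - y) powr ?q) \<partial>lborel)
        = (\<integral>\<^sup>+y. ennreal (\<phi> x) * (indicator {y. r \<le> norm (x - y)} y *
          ennreal (\<bar>J p (u x - u y)\<bar> / norm (x - y) powr ?q)) \<partial>lborel)"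
      proof (rule nn_integral_cong)
        fix y
        have "ennreal (\<bar>J p (u x - u y)\<bar> * \<phi> x / norm (x - y) powr ?q)
            = ennreal (\<phi> x) * ennreal (\<bar>J p (u x - u y)\<bar> / norm (x - y) powr ?q)"
          using phi_nonneg[of x] by (simp add: ennreal_mult[symmetric] mult.commute)
        then show "indicator {z. r \<le> norm (fst z - snd z)} (x, y) *
          ennreal (\<bar>J p (u x - u y)\<bar> * \<phi> x / norm (x - y) powr ?q)
          = ennreal (\<phi> x) * (indicator {y. r \<le> norm (x - y)} y *
          ennreal (\<bar>J p (u x - u y)\<bar> / norm (x - y) powr ?q))"
          by (simp add: indicator_def)
      qed
      also have "\<dots> = ennreal (\<phi> x) * (\<integral>\<^sup>+y. indicator {y. r \<le> norm (x - y)} y *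
          ennreal (\<bar>J p (u x - u y)\<bar> / norm (x - y) powr ?q) \<partial>lborel)"
        by (rule nn_integral_cmult) simp
      also have "\<dots> \<le> ennreal (\<phi> x) * ennreal S" by (intro mult_left_mono S True) simp
      finally show ?thesis .
    qed (simp add: phi_support)
  qed
  also have "\<dots> = ennreal (integral\<^sup>L lborel \<phi>) * ennreal S"
    using phi_integrable phi_nonneg by (simp add: nn_integral_multc nn_integral_eq_integral)
  also have "\<dots> < \<infinity>" by (simp add: ennreal_mult_less_top)
  finally show ?thesis .
qed

lemma near_energy_finite:
  "(\<integral>\<^sup>+z. indicator {z. fst z \<in> K \<and> norm (fst z - snd z) \<le> m / 2} z *
      ennreal (\<bar>u (fst z) - u (snd z)\<bar> powr p / kden s p z) \<partial>lborel) < \<infinity>"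
proof -
  define M' where "M' = max M m + m"
  have m2: "0 < m / 2" using m by simp
  obtain L where L: "0 \<le> L" "\<And>a b. m / 2 \<le> a \<Longrightarrow> a \<le> M' \<Longrightarrow> m / 2 \<le> b \<Longrightarrow> b \<le> M' \<Longrightarrow> \<bar>a powr \<beta> - b powr \<beta>\<bar> \<le> L * \<bar>a - b\<bar>"
    using powr_lipschitz_on_Icc[OF m2, of M' \<beta>] by metis
  have lip: "\<bar>u x - u y\<bar> \<le> L * norm (x - y)" if x: "x \<in> K" and xy: "norm (x - y) \<le> m / 2" for x y
  proof -
    have "\<bar>outdist \<Omega> x - outdist \<Omega> y\<bar> \<le> m / 2" using outdist_lipschitz[of \<Omega> x y] xy by linarith
    then have "m / 2 \<le> outdist \<Omega> x" "outdist \<Omega> x \<le> M'" "m / 2 \<le> outdist \<Omega> y" "outdist \<Omega> y \<le> M'"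
      using mM[OF x] m unfolding M'_def by linarith+
    then have "\<bar>u x - u y\<bar> \<le> L * \<bar>outdist \<Omega> x - outdist \<Omega> y\<bar>"
      unfolding u_def by (intro L(2))
    also have "\<dots> \<le> L * norm (x - y)" by (intro mult_left_mono outdist_lipschitz L)
    finally show ?thesis .
  qed
  have fin: "emeasure lborel K < \<infinity>" using emeasure_bounded_finite[OF compact_imp_bounded[OF K]] by simp
  have "(\<integral>\<^sup>+z. indicator {z. fst z \<in> K \<and> snd z \<in> UNIV \<and> norm (fst z - snd z) \<le> m / 2} z *
            ennreal (\<bar>u (fst z) - u (snd z)\<bar> powr p / kden s p z) \<partial>lborel) < \<infinity>"
    by (rule near_gagliardo_finite[OF p s m2 L(1)]) (use fin lip in auto)
  then show ?thesis by simp
qed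

lemma energy_integrand_measurable [measurable]:
  "energy_integrand s p u \<phi> \<in> borel_measurable borel"
  unfolding energy_integrand_def by measurable

text \<open>
  The integrand vanishes unless one of the points is in \<open>K\<close>. Up to distance \<open>m/2\<close>, Young's inequality
  leaves the seminorm density of \<open>\<phi>\<close> and that of \<open>u\<close>, where \<open>u\<close> is Lipschitz because both distances are at
  least \<open>m/2\<close>. Farther away, \<open>|\<phi>(x) - \<phi>(y)| \<le> \<phi>(x) + \<phi>(y)\<close> and the tail bound suffice.
\<close>

lemma energy_integrable: "integrable lborel (energy_integrand s p u \<phi>)"
proof (rule integrableI_bounded)
  define near where "near = (\<lambda>z. indicator {z. fst z \<in> K \<and> norm (fst z - snd z) \<le> m / 2} z *
      ennreal (\<bar>u (fst z) - u (snd z)\<bar> powr p / kden s p z))"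
  define far where "far = (\<lambda>z. indicator {z. m / 2 \<le> norm (fst z - snd z)} z *
      ennreal (\<bar>J p (u (fst z) - u (snd z))\<bar> * \<phi> (fst z) / kden s p z))"
  define gag where "gag = (\<lambda>z. ennreal (\<bar>\<phi> (fst z) - \<phi> (snd z)\<bar> powr p / kden s p z))"
  have [measurable]: "{z :: (real ^ 'n) \<times> (real ^ 'n). fst z \<in> K \<and> norm (fst z - snd z) \<le> m / 2} \<in> sets borel"
    "{z :: (real ^ 'n) \<times> (real ^ 'n). m / 2 \<le> norm (fst z - snd z)} \<in> sets borel"
    by measurable
  have [measurable]: "near \<in> borel_measurable borel" "far \<in> borel_measurable borel" "gag \<in> borel_measurable borel"
    unfolding near_def far_def gag_def by measurable
  have le: "ennreal (norm (energy_integrand s p u \<phi> (x, y)))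
      \<le> (near (x, y) + near (y, x)) + ((far (x, y) + far (y, x)) + gag (x, y))" for x y
  proof (cases "x \<in> K \<or> y \<in> K")
    case False
    then show ?thesis by (simp add: energy_integrand_def phi_support)
  next
    case True
    define k where "k = norm (x - y) powr (real CARD('n) + s * p)"
    have k: "k \<ge> 0" by (simp add: k_def)
    have sym: "norm (y - x) = norm (x - y)" "\<bar>u y - u x\<bar> = \<bar>u x - u y\<bar>" "\<bar>J p (u y - u x)\<bar> = \<bar>J p (u x - u y)\<bar>"
      by (simp_all add: norm_minus_commute abs_minus_commute abs_J)
    have en: "norm (energy_integrand s p u \<phi> (x, y)) = \<bar>u x - u y\<bar> powr (p - 1) * \<bar>\<phi> x - \<phi> y\<bar> / k"
      by (simp add: energy_integrand_def k_def abs_mult abs_J)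
    show ?thesis
    proof (cases "norm (x - y) \<le> m / 2")
      case near: True
      have "norm (energy_integrand s p u \<phi> (x, y)) \<le> (\<bar>u x - u y\<bar> powr p + \<bar>\<phi> x - \<phi> y\<bar> powr p) / k"
        unfolding en using k by (intro divide_right_mono powr_mult_le_add p) auto
      then have "ennreal (norm (energy_integrand s p u \<phi> (x, y))) \<le> ennreal (\<bar>u x - u y\<bar> powr p / k) + gag (x, y)"
        using k by (simp add: gag_def k_def[symmetric] ennreal_plus[symmetric] add_divide_distrib del: ennreal_plus)
      moreover have "ennreal (\<bar>u x - u y\<bar> powr p / k) \<le> near (x, y) + near (y, x)"
        using True near by (auto simp: near_def sym k_def[symmetric] intro: add_increasing add_increasing2)
      ultimately show ?thesis by (meson add_mono add_increasing zero_le order_trans order_refl)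
    next
      case far: False
      have "\<bar>u x - u y\<bar> powr (p - 1) * \<bar>\<phi> x - \<phi> y\<bar> \<le> \<bar>u x - u y\<bar> powr (p - 1) * (\<phi> x + \<phi> y)"
        using phi_nonneg[of x] phi_nonneg[of y] by (intro mult_left_mono) auto
      then have "norm (energy_integrand s p u \<phi> (x, y)) \<le> \<bar>u x - u y\<bar> powr (p - 1) * (\<phi> x + \<phi> y) / k"
        unfolding en using k by (intro divide_right_mono) auto
      also have "\<dots> = \<bar>J p (u x - u y)\<bar> * \<phi> x / k + \<bar>J p (u x - u y)\<bar> * \<phi> y / k"
        by (simp add: abs_J distrib_left add_divide_distrib)
      finally have "ennreal (norm (energy_integrand s p u \<phi> (x, y)))
          \<le> ennreal (\<bar>J p (u x - u y)\<bar> * \<phi> x / k) + ennreal (\<bar>J p (u x - u y)\<bar> * \<phi> y / k)"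
        using k phi_nonneg[of x] phi_nonneg[of y] by (simp add: ennreal_leI ennreal_plus[symmetric] del: ennreal_plus)
      also have "\<dots> = far (x, y) + far (y, x)"
        using far by (simp add: far_def sym k_def[symmetric])
      finally show ?thesis by (meson add_increasing add_increasing2 zero_le order_trans order_refl)
    qed
  qed
  have "(\<integral>\<^sup>+z. ennreal (norm (energy_integrand s p u \<phi> z)) \<partial>lborel)
      \<le> (\<integral>\<^sup>+z. (near z + near (snd z, fst z)) + ((far z + far (snd z, fst z)) + gag z) \<partial>lborel)"
  proof (rule nn_integral_mono)
    fix z :: "(real ^ 'n) \<times> (real ^ 'n)"
    show "ennreal (norm (energy_integrand s p u \<phi> z)) \<le> (near z + near (snd z, fst z)) + ((far z + far (snd z, fst z)) + gag z)"
      using le[of "fst z" "snd z"] by simp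
  qed
  also have "\<dots> = ((\<integral>\<^sup>+z. near z \<partial>lborel) + (\<integral>\<^sup>+z. near z \<partial>lborel))
      + (((\<integral>\<^sup>+z. far z \<partial>lborel) + (\<integral>\<^sup>+z. far z \<partial>lborel)) + (\<integral>\<^sup>+z. gag z \<partial>lborel))"
    by (simp add: nn_integral_add nn_integral_lborel_swap)
  also have "\<dots> < \<infinity>"
    using near_energy_finite far_energy_finite[of "m / 2"] phi_gagliardo m
    by (simp add: near_def far_def gag_def)
  finally show "(\<integral>\<^sup>+z. ennreal (norm (energy_integrand s p u \<phi> z)) \<partial>lborel) < \<infinity>" .
qed simp

text \<open>
  Since the distance is 1-Lipschitz, points with far apart distances are far apart.
\<close>

lemma trunc_gap:
  assumes \<theta>: "0 < \<theta>" "\<theta> < 1" and x: "x \<in> K"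
    and t: "outdist \<Omega> x \<le> \<theta> * outdist \<Omega> y \<or> outdist \<Omega> y \<le> \<theta> * outdist \<Omega> x"
  shows "(1 - \<theta>) * m \<le> norm (x - y)"
proof -
  define a b where "a = outdist \<Omega> x" and "b = outdist \<Omega> y"
  have ab: "\<bar>a - b\<bar> \<le> norm (x - y)" unfolding a_def b_def by (rule outdist_lipschitz)
  have a: "m \<le> a" using mM(1)[OF x] by (simp add: a_def)
  have b0: "0 \<le> b" by (simp add: b_def)
  from t have "(1 - \<theta>) * m \<le> \<bar>a - b\<bar>"
  proof
    assume "outdist \<Omega> x \<le> \<theta> * outdist \<Omega> y"
    then have le: "a \<le> \<theta> * b" by (simp add: a_def b_def)
    also have "\<theta> * b \<le> b" using \<theta> b0 by (simp add: mult_left_le_one_le)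
    finally have "m \<le> b" using a by simp
    then have "(1 - \<theta>) * m \<le> (1 - \<theta>) * b" using \<theta> by (intro mult_left_mono) auto
    also have "\<dots> \<le> b - a" using le by (simp add: algebra_simps)
    finally show ?thesis by simp
  next
    assume "outdist \<Omega> y \<le> \<theta> * outdist \<Omega> x"
    then have le: "b \<le> \<theta> * a" by (simp add: a_def b_def)
    have "(1 - \<theta>) * m \<le> (1 - \<theta>) * a" using \<theta> a by (intro mult_left_mono) auto
    also have "\<dots> \<le> a - b" using le by (simp add: algebra_simps)
    finally show ?thesis by simp
  qed
  with ab show ?thesis by linarith
qed

text \<open>
  The integral called \<open>F\<^sub>\<theta>(x)\<close> in the introduction.
\<close>

definition inner_trunc where
  "inner_trunc \<theta> x = (LINT y|lborel. truncJ p \<beta> \<theta> (outdist \<Omega> x) (outdist \<Omega> y) / norm (x - y) powr (real CARD('n) + s * p))"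

lemma inner_trunc_integrable:
  assumes \<theta>: "0 < \<theta>" "\<theta> < 1" and x: "x \<in> K"
  shows "integrable lborel (\<lambda>y. truncJ p \<beta> \<theta> (outdist \<Omega> x) (outdist \<Omega> y) / norm (x - y) powr (real CARD('n) + s * p))"
proof (rule integrableI_bounded)
  let ?q = "real CARD('n) + s * p"
  have r: "0 < (1 - \<theta>) * m" using \<theta> m by simp
  obtain S where S: "0 \<le> S"
    "\<And>x. x \<in> K \<Longrightarrow> (\<integral>\<^sup>+y. indicator {y. (1 - \<theta>) * m \<le> norm (x - y)} y *
        ennreal (\<bar>J p (u x - u y)\<bar> / norm (x - y) powr ?q) \<partial>lborel) \<le> ennreal S"
    using far_inner_bound[OF r] by blast
  have "(\<integral>\<^sup>+y. ennreal (norm (truncJ p \<beta> \<theta> (outdist \<Omega> x) (outdist \<Omega> y) / norm (x - y) powr ?q)) \<partial>lborel)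
      \<le> (\<integral>\<^sup>+y. indicator {y. (1 - \<theta>) * m \<le> norm (x - y)} y *
        ennreal (\<bar>J p (u x - u y)\<bar> / norm (x - y) powr ?q) \<partial>lborel)"
  proof (rule nn_integral_mono)
    fix y
    show "ennreal (norm (truncJ p \<beta> \<theta> (outdist \<Omega> x) (outdist \<Omega> y) / norm (x - y) powr ?q))
      \<le> indicator {y. (1 - \<theta>) * m \<le> norm (x - y)} y * ennreal (\<bar>J p (u x - u y)\<bar> / norm (x - y) powr ?q)"
    proof (cases "(1 - \<theta>) * m \<le> norm (x - y)")
      case True
      then show ?thesis using abs_truncJ_le[of p \<beta> \<theta> "outdist \<Omega> x" "outdist \<Omega> y"]
        by (simp add: u_def ennreal_leI divide_right_mono)
    next
      case False
      then have "truncJ p \<beta> \<theta> (outdist \<Omega> x) (outdist \<Omega> y) = 0"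
        using trunc_gap[OF \<theta> x, of y] by (auto simp: truncJ_def)
      then show ?thesis by simp
    qed
  qed
  also have "\<dots> \<le> ennreal S" by (rule S(2)[OF x])
  finally show "(\<integral>\<^sup>+y. ennreal (norm (truncJ p \<beta> \<theta> (outdist \<Omega> x) (outdist \<Omega> y) / norm (x - y) powr ?q)) \<partial>lborel) < \<infinity>"
    by (rule le_less_trans) simp
qed simp

text \<open>
  By antisymmetry of \<open>truncJ\<close>, the terms with \<open>\<phi>(x)\<close> and with \<open>-\<phi>(y)\<close> are exchanged by swapping the
  variables. The cut-off makes each of them integrable on its own, so Fubini applies.
\<close>

lemma trunc_energy:
  assumes \<theta>: "0 < \<theta>" "\<theta> < 1"
  shows "integrable lborel (\<lambda>x. \<phi> x * inner_trunc \<theta> x)"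
    and "(LINT z|lborel. truncJ p \<beta> \<theta> (outdist \<Omega> (fst z)) (outdist \<Omega> (snd z)) * (\<phi> (fst z) - \<phi> (snd z)) / kden s p z)
       = 2 * (LINT x|lborel. \<phi> x * inner_trunc \<theta> x)"
proof -
  let ?q = "real CARD('n) + s * p"
  define T where "T = (\<lambda>x y. truncJ p \<beta> \<theta> (outdist \<Omega> x) (outdist \<Omega> y))"
  define H where "H = (\<lambda>z. T (fst z) (snd z) * \<phi> (fst z) / kden s p z)"
  have [measurable]: "H \<in> borel_measurable borel" unfolding H_def T_def by measurable
  have r: "0 < (1 - \<theta>) * m" using \<theta> m by simp
  have H_int: "integrable lborel H"
  proof (rule integrableI_bounded)
    have "(\<integral>\<^sup>+z. ennreal (norm (H z)) \<partial>lborel)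
        \<le> (\<integral>\<^sup>+z. indicator {z. (1 - \<theta>) * m \<le> norm (fst z - snd z)} z *
            ennreal (\<bar>J p (u (fst z) - u (snd z))\<bar> * \<phi> (fst z) / kden s p z) \<partial>lborel)"
    proof (rule nn_integral_mono)
      fix z :: "(real ^ 'n) \<times> (real ^ 'n)"
      obtain x y where z: "z = (x, y)" by (cases z)
      have n: "norm (H z) = \<bar>T x y\<bar> * \<phi> x / norm (x - y) powr ?q"
        using phi_nonneg[of x] by (simp add: H_def z abs_mult)
      show "ennreal (norm (H z)) \<le> indicator {z. (1 - \<theta>) * m \<le> norm (fst z - snd z)} z *
            ennreal (\<bar>J p (u (fst z) - u (snd z))\<bar> * \<phi> (fst z) / kden s p z)"
      proof (cases "x \<in> K")
        case True
        show ?thesis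
        proof (cases "(1 - \<theta>) * m \<le> norm (x - y)")
          case far: True
          have "\<bar>T x y\<bar> * \<phi> x / norm (x - y) powr ?q \<le> \<bar>J p (u x - u y)\<bar> * \<phi> x / norm (x - y) powr ?q"
            unfolding T_def u_def using phi_nonneg by (intro divide_right_mono mult_right_mono abs_truncJ_le) auto
          then show ?thesis unfolding n using far by (simp add: z ennreal_leI)
        next
          case False
          then have "T x y = 0"
            using trunc_gap[OF \<theta> True, of y] by (auto simp: T_def truncJ_def)
          then show ?thesis unfolding n by simp
        qed
      next
        case False
        then show ?thesis unfolding n by (simp add: phi_support)
      qed
    qed
    then show "(\<integral>\<^sup>+z. ennreal (norm (H z)) \<partial>lborel) < \<infinity>"
      using far_energy_finite[OF r] by (rule le_less_trans)
  qed simp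
  have HP: "integrable (lborel \<Otimes>\<^sub>M lborel) H" using H_int by (simp add: lborel_prod)
  have inner: "(LINT y|lborel. H (x, y)) = \<phi> x * inner_trunc \<theta> x" for x
  proof -
    have "H (x, y) = \<phi> x * (T x y / norm (x - y) powr ?q)" for y by (simp add: H_def)
    then show ?thesis by (simp only: inner_trunc_def T_def integral_mult_right_zero)
  qed
  show "integrable lborel (\<lambda>x. \<phi> x * inner_trunc \<theta> x)"
    using lborel_pair.integrable_fst'[OF HP] by (simp add: inner)
  have IH: "integral\<^sup>L lborel H = (LINT x|lborel. \<phi> x * inner_trunc \<theta> x)"
    using lborel_pair.integral_fst'[OF HP] by (simp add: inner lborel_prod)
  have swap: "integrable lborel (\<lambda>z. H (snd z, fst z))" "(LINT z|lborel. H (snd z, fst z)) = integral\<^sup>L lborel H"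
    using lborel_pair.integrable_product_swap[OF HP] lborel_pair.integral_product_swap[of H] HP
    by (simp_all add: lborel_prod case_prod_beta' borel_measurable_integrable)
  have eq: "truncJ p \<beta> \<theta> (outdist \<Omega> (fst z)) (outdist \<Omega> (snd z)) * (\<phi> (fst z) - \<phi> (snd z)) / kden s p z
      = H z + H (snd z, fst z)" for z
    using truncJ_antisym[of p \<beta> \<theta> "outdist \<Omega> (snd z)" "outdist \<Omega> (fst z)"]
    by (simp add: H_def T_def norm_minus_commute[of "snd z"] right_diff_distrib diff_divide_distrib)
  show "(LINT z|lborel. truncJ p \<beta> \<theta> (outdist \<Omega> (fst z)) (outdist \<Omega> (snd z)) * (\<phi> (fst z) - \<phi> (snd z)) / kden s p z)
       = 2 * (LINT x|lborel. \<phi> x * inner_trunc \<theta> x)"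
    unfolding eq using H_int swap by (simp add: IH)
qed

text \<open>
  A pair of points with different distances is eventually not cut off, and for equal distances the
  integrand is zero; the energy integrand itself dominates.
\<close>

lemma energy_limit:
  "(\<lambda>n. 2 * (LINT x|lborel. \<phi> x * inner_trunc (real (Suc n) / real (Suc (Suc n))) x))
     \<longlonglongrightarrow> (LINT z|lborel. energy_integrand s p u \<phi> z)"
proof -
  let ?\<theta> = "\<lambda>n. real (Suc n) / real (Suc (Suc n))"
  have \<theta>: "0 < ?\<theta> n" "?\<theta> n < 1" for n by simp_all
  have \<theta>1: "?\<theta> \<longlonglongrightarrow> 1" using LIMSEQ_Suc[OF LIMSEQ_n_over_Suc_n] by simp
  define e where "e = (\<lambda>\<theta> z. truncJ p \<beta> \<theta> (outdist \<Omega> (fst z)) (outdist \<Omega> (snd z)) * (\<phi> (fst z) - \<phi> (snd z)) / kden s p z)"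
  have [measurable]: "e \<theta> \<in> borel_measurable borel" for \<theta> unfolding e_def by measurable
  have "(\<lambda>n. LINT z|lborel. e (?\<theta> n) z) \<longlonglongrightarrow> (LINT z|lborel. energy_integrand s p u \<phi> z)"
  proof (rule integral_dominated_convergence[where w = "\<lambda>z. norm (energy_integrand s p u \<phi> z)"])
    show "integrable lborel (\<lambda>z. norm (energy_integrand s p u \<phi> z))"
      by (intro integrable_norm energy_integrable)
    show "AE z in lborel. (\<lambda>n. e (?\<theta> n) z) \<longlonglongrightarrow> energy_integrand s p u \<phi> z"
    proof (rule AE_I2)
      fix z
      define a b where "a = outdist \<Omega> (fst z)" and "b = outdist \<Omega> (snd z)"
      have ev: "\<forall>\<^sub>F n in sequentially. truncJ p \<beta> (?\<theta> n) a b = J p (a powr \<beta> - b powr \<beta>)"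
      proof (cases a b rule: linorder_cases)
        case equal
        then show ?thesis by (simp add: truncJ_def)
      next
        case less
        have "(\<lambda>n. ?\<theta> n * b) \<longlonglongrightarrow> 1 * b" by (intro tendsto_intros \<theta>1)
        then have "\<forall>\<^sub>F n in sequentially. a < ?\<theta> n * b" using less by (auto dest: order_tendstoD)
        then show ?thesis by eventually_elim (simp add: truncJ_def)
      next
        case greater
        have "(\<lambda>n. ?\<theta> n * a) \<longlonglongrightarrow> 1 * a" by (intro tendsto_intros \<theta>1)
        then have "\<forall>\<^sub>F n in sequentially. b < ?\<theta> n * a" using greater by (auto dest: order_tendstoD)
        then show ?thesis by eventually_elim (simp add: truncJ_def)
      qed
      then have "\<forall>\<^sub>F n in sequentially. e (?\<theta> n) z = energy_integrand s p u \<phi> z"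
        by eventually_elim (simp add: e_def energy_integrand_def u_def a_def b_def)
      then show "(\<lambda>n. e (?\<theta> n) z) \<longlonglongrightarrow> energy_integrand s p u \<phi> z" by (rule tendsto_eventually)
    qed
    fix n
    show "AE z in lborel. norm (e (?\<theta> n) z) \<le> norm (energy_integrand s p u \<phi> z)"
      by (intro AE_I2)
         (auto simp: e_def energy_integrand_def u_def abs_mult intro!: divide_right_mono mult_right_mono abs_truncJ_le)
  qed simp_all
  then show ?thesis unfolding e_def using trunc_energy(2)[OF \<theta>] by (simp only:)
qed

lemma hardy_integrable:
  "integrable lborel (\<lambda>x. outdist \<Omega> x powr (\<beta> * (p - 1) - s * p) * \<phi> x)"
proof (rule Bochner_Integration.integrable_bound)
  define c where "c = m powr (\<beta> * (p - 1) - s * p) + M powr (\<beta> * (p - 1) - s * p)"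
  show "integrable lborel (\<lambda>x. c * \<phi> x)" using phi_integrable by (rule integrable_mult_right)
  show "AE x in lborel. norm (outdist \<Omega> x powr (\<beta> * (p - 1) - s * p) * \<phi> x) \<le> norm (c * \<phi> x)"
  proof (rule AE_I2)
    fix x
    show "norm (outdist \<Omega> x powr (\<beta> * (p - 1) - s * p) * \<phi> x) \<le> norm (c * \<phi> x)"
    proof (cases "x \<in> K")
      case True
      then have "outdist \<Omega> x powr (\<beta> * (p - 1) - s * p) \<le> c"
        unfolding c_def by (intro powr_bounded_on_Icc m mM)
      then show ?thesis using phi_nonneg[of x] by (auto simp: abs_mult intro!: mult_right_mono)
    qed (simp add: phi_support)
  qed
qed simp

lemma trunc_lambda_limit:
  assumes "- 1 / (p - 1) < \<beta>" "\<beta> < s * p / (p - 1)"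
  shows "(\<lambda>n. 2 * trunc_lambda (s * p) p \<beta> (real (Suc n) / real (Suc (Suc n)))) \<longlonglongrightarrow> hardy_lambda s p \<beta>"
  using trunc_lambda_tendsto[OF p sp assms] p by simp

text \<open>
  A bound for \<open>F\<^sub>\<theta>\<close> on the support of \<open>\<phi>\<close> by the half-space value passes to the limit \<open>\<theta> \<rightarrow> 1\<close>, in which
  \<open>2 trunc_lambda\<close> tends to \<open>\<lambda>(\<beta>)\<close>.
\<close>

lemma energy_lower_bound:
  assumes \<beta>: "- 1 / (p - 1) < \<beta>" "\<beta> < s * p / (p - 1)"
    and le: "\<And>\<theta> x. 0 < \<theta> \<Longrightarrow> \<theta> < 1 \<Longrightarrow> x \<in> K \<Longrightarrow>
      C * (outdist \<Omega> x powr (\<beta> * (p - 1) - s * p) * trunc_lambda (s * p) p \<beta> \<theta>) \<le> inner_trunc \<theta> x"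
  shows "C * hardy_lambda s p \<beta> * (LINT x|lborel. outdist \<Omega> x powr (\<beta> * (p - 1) - s * p) * \<phi> x)
      \<le> (LINT z|lborel. energy_integrand s p u \<phi> z)"
proof -
  let ?\<theta> = "\<lambda>n. real (Suc n) / real (Suc (Suc n))"
  define I where "I = (LINT x|lborel. outdist \<Omega> x powr (\<beta> * (p - 1) - s * p) * \<phi> x)"
  have "(\<lambda>n. C * (2 * trunc_lambda (s * p) p \<beta> (?\<theta> n)) * I) \<longlonglongrightarrow> C * hardy_lambda s p \<beta> * I"
    by (intro tendsto_intros trunc_lambda_limit \<beta>)
  moreover have "C * (2 * trunc_lambda (s * p) p \<beta> (?\<theta> n)) * I \<le> 2 * (LINT x|lborel. \<phi> x * inner_trunc (?\<theta> n) x)" for n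
  proof -
    define \<theta> where "\<theta> = ?\<theta> n"
    have \<theta>: "0 < \<theta>" "\<theta> < 1" by (simp_all add: \<theta>_def)
    have "C * trunc_lambda (s * p) p \<beta> \<theta> * I
        = (LINT x|lborel. C * trunc_lambda (s * p) p \<beta> \<theta> * (outdist \<Omega> x powr (\<beta> * (p - 1) - s * p) * \<phi> x))"
      by (simp add: I_def)
    also have "\<dots> \<le> (LINT x|lborel. \<phi> x * inner_trunc \<theta> x)"
    proof (rule integral_mono)
      show "integrable lborel (\<lambda>x. C * trunc_lambda (s * p) p \<beta> \<theta> * (outdist \<Omega> x powr (\<beta> * (p - 1) - s * p) * \<phi> x))"
        by (intro integrable_mult_right hardy_integrable)
      show "integrable lborel (\<lambda>x. \<phi> x * inner_trunc \<theta> x)" by (rule trunc_energy(1)[OF \<theta>])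
      fix x
      show "C * trunc_lambda (s * p) p \<beta> \<theta> * (outdist \<Omega> x powr (\<beta> * (p - 1) - s * p) * \<phi> x) \<le> \<phi> x * inner_trunc \<theta> x"
      proof (cases "x \<in> K")
        case True
        from mult_left_mono[OF le[OF \<theta> True] phi_nonneg[of x]] show ?thesis by (simp add: mult_ac)
      qed (simp add: phi_support)
    qed
    finally show ?thesis by (simp add: \<theta>_def)
  qed
  ultimately have "C * hardy_lambda s p \<beta> * I \<le> (LINT z|lborel. energy_integrand s p u \<phi> z)"
    by (intro LIMSEQ_le[OF _ energy_limit]) auto
  then show ?thesis by (simp add: I_def)
qed

lemma energy_equality:
  assumes \<beta>: "- 1 / (p - 1) < \<beta>" "\<beta> < s * p / (p - 1)"
    and eq: "\<And>\<theta> x. 0 < \<theta> \<Longrightarrow> \<theta> < 1 \<Longrightarrow> x \<in> K \<Longrightarrow>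
      inner_trunc \<theta> x = C * (outdist \<Omega> x powr (\<beta> * (p - 1) - s * p) * trunc_lambda (s * p) p \<beta> \<theta>)"
  shows "(LINT z|lborel. energy_integrand s p u \<phi> z)
      = C * hardy_lambda s p \<beta> * (LINT x|lborel. outdist \<Omega> x powr (\<beta> * (p - 1) - s * p) * \<phi> x)"
proof -
  let ?\<theta> = "\<lambda>n. real (Suc n) / real (Suc (Suc n))"
  define I where "I = (LINT x|lborel. outdist \<Omega> x powr (\<beta> * (p - 1) - s * p) * \<phi> x)"
  have "(\<lambda>n. C * (2 * trunc_lambda (s * p) p \<beta> (?\<theta> n)) * I) \<longlonglongrightarrow> C * hardy_lambda s p \<beta> * I"
    by (intro tendsto_intros trunc_lambda_limit \<beta>)
  moreover have "C * (2 * trunc_lambda (s * p) p \<beta> (?\<theta> n)) * I = 2 * (LINT x|lborel. \<phi> x * inner_trunc (?\<theta> n) x)" for n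
  proof -
    have \<theta>: "0 < ?\<theta> n" "?\<theta> n < 1" by simp_all
    have "\<phi> x * inner_trunc (?\<theta> n) x = C * trunc_lambda (s * p) p \<beta> (?\<theta> n) * (outdist \<Omega> x powr (\<beta> * (p - 1) - s * p) * \<phi> x)" for x
      using eq[OF \<theta>, of x] by (cases "x \<in> K") (simp_all add: phi_support)
    then show ?thesis by (simp only: I_def integral_mult_right_zero)
  qed
  ultimately have "C * hardy_lambda s p \<beta> * I = (LINT z|lborel. energy_integrand s p u \<phi> z)"
    by (intro LIMSEQ_unique[OF _ energy_limit]) (simp del: of_nat_Suc)
  then show ?thesis by (simp add: I_def)
qed

end

section \<open>Arbitrary test functions and conclusion\<close>

lemma borel_measurable_lebesgue_cong_AE:
  fixes f g :: "'a::euclidean_space \<Rightarrow> real"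
  assumes [measurable]: "g \<in> borel_measurable borel" and ae: "AE x in lborel. f x = g x"
  shows "f \<in> borel_measurable lebesgue"
  unfolding borel_measurable_iff_greater
proof
  fix a
  have "{x \<in> space lebesgue. a < f x} \<in> sets lebesgue"
  proof (rule completion.in_sets_AE)
    show "AE x in lebesgue. x \<in> {x \<in> space lebesgue. a < g x} \<longleftrightarrow> x \<in> {x \<in> space lebesgue. a < f x}"
      using AE_completion[OF ae] by eventually_elim simp
    have "{x. a < g x} \<in> sets borel" by measurable
    then show "{x \<in> space lebesgue. a < g x} \<in> sets lebesgue" by simp
  qed auto
  then show "{w \<in> space lebesgue. a < f w} \<in> sets lebesgue" .
qed

lemma lebesgue_integral_cong_lborel:
  fixes f g :: "'a::euclidean_space \<Rightarrow> real"
  assumes g [measurable]: "g \<in> borel_measurable borel" and ae: "AE x in lborel. f x = g x"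
  shows "integrable lebesgue f \<longleftrightarrow> integrable lborel g" "integral\<^sup>L lebesgue f = integral\<^sup>L lborel g"
proof -
  have f: "f \<in> borel_measurable lebesgue" by (rule borel_measurable_lebesgue_cong_AE[OF g ae])
  have g': "g \<in> borel_measurable lebesgue" by (simp add: measurable_completion)
  have "integrable lebesgue f \<longleftrightarrow> integrable lebesgue g"
    by (rule integrable_cong_AE[OF f g' AE_completion[OF ae]])
  then show "integrable lebesgue f \<longleftrightarrow> integrable lborel g" by (simp add: integrable_completion)
  have "integral\<^sup>L lebesgue f = integral\<^sup>L lebesgue g"
    by (rule integral_cong_AE[OF f g' AE_completion[OF ae]])
  then show "integral\<^sup>L lebesgue f = integral\<^sup>L lborel g" by (simp add: integral_completion)
qed

lemma AE_lborel_fst_snd: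
  fixes P :: "'a::euclidean_space \<Rightarrow> bool"
  assumes "AE x in lborel. P x"
  shows "AE z in lborel. P (fst z) \<and> P (snd z)"
proof -
  obtain N where N: "{x \<in> space lborel. \<not> P x} \<subseteq> N" "emeasure lborel N = 0" "N \<in> sets lborel"
    using AE_E[OF assms] by blast
  have [measurable]: "N \<in> sets borel" using N by simp
  have NA: "AE x in lborel. x \<notin> N" using N by (intro AE_not_in) (auto simp: null_sets_def)
  have "AE z in (lborel \<Otimes>\<^sub>M lborel). fst z \<notin> N \<and> snd z \<notin> N"
  proof (rule lborel_pair.AE_pair_measure)
    show "AE x in lborel. AE y in lborel. fst (x, y) \<notin> N \<and> snd (x, y) \<notin> N"
      using NA by eventually_elim (use NA in simp)
  qed measurable
  then have "AE z in lborel. fst z \<notin> N \<and> snd z \<notin> N" by (simp only: lborel_prod)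
  then show ?thesis by eventually_elim (use N(1) in auto)
qed

text \<open>
  All integrals in the weak formulation ignore null sets, so a test function may be replaced by a Borel
  function that is non-negative and supported in \<open>K\<close> without exception. It is integrable because
  \<open>\<psi> \<le> 1 + \<psi>\<^sup>p\<close> on the bounded set \<open>K\<close>.
\<close>

lemma test_function_borel_version:
  fixes \<Omega> :: "(real ^ 'n) set"
  assumes p: "1 < p" and \<phi>: "\<phi> \<in> test_functions s p \<Omega>"
  obtains \<psi> K where "compact K" "K \<subseteq> \<Omega>" "\<psi> \<in> borel_measurable borel" "\<And>x. 0 \<le> \<psi> x" "\<And>x. x \<notin> K \<Longrightarrow> \<psi> x = 0"
    "integrable lborel \<psi>" "(\<integral>\<^sup>+z. ennreal (\<bar>\<psi> (fst z) - \<psi> (snd z)\<bar> powr p / kden s p z) \<partial>lborel) < \<infinity>"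
    "AE x in lborel. \<phi> x = \<psi> x"
proof -
  have W: "\<phi> \<in> Wsp s p UNIV" and nn: "AE x in lborel. 0 \<le> \<phi> x"
    using \<phi> by (auto simp: test_functions_def AE_completion_iff)
  obtain K where K: "compact K" "K \<subseteq> \<Omega>" and K0: "AE x in lborel. x \<notin> K \<longrightarrow> \<phi> x = 0"
    using \<phi> by (auto simp: test_functions_def AE_completion_iff)
  have [measurable]: "K \<in> sets borel" using K(1) by (rule borel_compact)
  have meas: "\<phi> \<in> borel_measurable lebesgue" and intp: "integrable lebesgue (\<lambda>x. \<bar>\<phi> x\<bar> powr p)"
    and gag: "gagliardo s p UNIV \<phi> < \<infinity>"
    using W by (auto simp: Wsp_def Lp_on_def set_borel_measurable_def set_integrable_def)
  obtain \<phi>0 where \<phi>0 [measurable]: "\<phi>0 \<in> borel_measurable lborel" and ae0: "AE x in lborel. \<phi> x = \<phi>0 x"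
    using completion_ex_borel_measurable_real[OF meas] by blast
  define \<psi> where "\<psi> = (\<lambda>x. indicator K x * max 0 (\<phi>0 x))"
  have [measurable]: "\<psi> \<in> borel_measurable borel" using \<phi>0 by (simp add: \<psi>_def)
  have ae: "AE x in lborel. \<phi> x = \<psi> x"
    using ae0 nn K0 by eventually_elim (auto simp: \<psi>_def indicator_def)
  have fin: "emeasure lborel K < \<infinity>"
    using emeasure_bounded_finite[OF compact_imp_bounded[OF K(1)]] by simp
  have "integrable lborel (\<lambda>x. \<bar>\<psi> x\<bar> powr p)"
  proof -
    have "AE x in lborel. \<bar>\<phi> x\<bar> powr p = \<bar>\<psi> x\<bar> powr p" using ae by eventually_elim simp
    then show ?thesis using intp by (subst (asm) lebesgue_integral_cong_lborel(1)) auto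
  qed
  moreover have "integrable lborel (indicator K :: _ \<Rightarrow> real)" using fin by (simp add: integrable_indicator_iff)
  ultimately have int_sum: "integrable lborel (\<lambda>x. indicator K x + \<bar>\<psi> x\<bar> powr p)"
    by (intro Bochner_Integration.integrable_add)
  have int: "integrable lborel \<psi>"
  proof (rule Bochner_Integration.integrable_bound[OF int_sum])
    show "AE x in lborel. norm (\<psi> x) \<le> norm (indicator K x + \<bar>\<psi> x\<bar> powr p)"
    proof (rule AE_I2)
      fix x
      show "norm (\<psi> x) \<le> norm (indicator K x + \<bar>\<psi> x\<bar> powr p)"
      proof (cases "x \<in> K")
        case True
        then show ?thesis using powr_mult_le_add[OF p, of 1 "\<bar>\<psi> x\<bar>"] by simp
      qed (simp add: \<psi>_def)
    qed
  qed simp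
  have "(\<integral>\<^sup>+z. ennreal (\<bar>\<psi> (fst z) - \<psi> (snd z)\<bar> powr p / kden s p z) \<partial>lborel) = gagliardo s p UNIV \<phi>"
    unfolding gagliardo_def nn_integral_completion
    by (rule nn_integral_cong_AE) (use AE_lborel_fst_snd[OF ae] in eventually_elim, simp)
  with gag have gag': "(\<integral>\<^sup>+z. ennreal (\<bar>\<psi> (fst z) - \<psi> (snd z)\<bar> powr p / kden s p z) \<partial>lborel) < \<infinity>" by simp
  show thesis
    by (rule that[OF K _ _ _ int gag' ae]) (simp_all add: \<psi>_def)
qed

lemma hardy_integrand_eq:
  fixes \<Omega> :: "(real ^ 'n) set"
  assumes \<Omega>: "open \<Omega>" "\<Omega> \<noteq> UNIV" and x: "x \<in> \<Omega>"
  shows "hardy_integrand s p \<Omega> (\<lambda>x. outdist \<Omega> x powr \<beta>) \<phi> x = outdist \<Omega> x powr (\<beta> * (p - 1) - s * p) * \<phi> x"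
proof -
  have "outdist \<Omega> x > 0" by (rule outdist_pos[OF \<Omega> x])
  have "(outdist \<Omega> x powr \<beta>) powr (p - 2) * outdist \<Omega> x powr \<beta> / outdist \<Omega> x powr (s * p)
      = outdist \<Omega> x powr (\<beta> * (p - 1) - s * p)"
    by (simp only: powr_powr powr_add[symmetric] powr_diff[symmetric]) (simp add: algebra_simps)
  then show ?thesis by (simp add: hardy_integrand_def bdist_eq_outdist[OF \<Omega> x])
qed

text \<open>
  For a half-space \<open>inner_trunc\<close> is known exactly; for \<open>\<beta> \<ge> 0\<close> it is bounded below by its value for the
  supporting half-space at the nearest boundary point.
\<close>

lemma outdist_powr_weak_solution:
  fixes \<Omega> :: "(real ^ 'n) set"
  assumes p: "1 < p" and s: "0 < s" "s < 1" and \<Omega>: "open \<Omega>" "convex \<Omega>" "\<Omega> \<noteq> UNIV"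
    and \<beta>: "- 1 / (p - 1) < \<beta>" "\<beta> < s * p / (p - 1)" and sign: "0 \<le> \<beta> \<or> open_half_space \<Omega>"
  shows "local_weak_supersolution s p \<Omega> (C_const CARD('n) (s * p) * hardy_lambda s p \<beta>) (U_fun \<Omega> \<beta>)"
    and "open_half_space \<Omega> \<Longrightarrow> local_weak_subsolution s p \<Omega> (C_const CARD('n) (s * p) * hardy_lambda s p \<beta>) (U_fun \<Omega> \<beta>)"
proof -
  define C where "C = C_const CARD('n) (s * p)"
  define v where "v = (\<lambda>x. outdist \<Omega> x powr \<beta>)"
  have U: "U_fun \<Omega> \<beta> = v" using U_fun_eq_outdist[OF \<Omega>(1,3)] by (simp add: v_def)
  have \<sigma>: "0 < s * p" "s * p < p" using p s by simp_all
  have spaces: "v \<in> Wsp_loc s p \<Omega> \<inter> tail_space s p"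
    unfolding v_def using outdist_powr_Wsp_loc[OF p s \<Omega>(1,3)] U_tail_space(1)[OF p s \<Omega> \<beta> sign] by simp
  note tail = U_tail_space(2)[OF p s \<Omega> \<beta> sign]
  have main: "integrable lebesgue (energy_integrand s p v \<phi>) \<and>
     set_integrable lebesgue \<Omega> (hardy_integrand s p \<Omega> v \<phi>) \<and>
     C * hardy_lambda s p \<beta> * (LINT x:\<Omega>|lebesgue. hardy_integrand s p \<Omega> v \<phi> x)
       \<le> (LINT z|lebesgue. energy_integrand s p v \<phi> z) \<and>
     (open_half_space \<Omega> \<longrightarrow>
       (LINT z|lebesgue. energy_integrand s p v \<phi> z)
       = C * hardy_lambda s p \<beta> * (LINT x:\<Omega>|lebesgue. hardy_integrand s p \<Omega> v \<phi> x))"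
    if \<phi>: "\<phi> \<in> test_functions s p \<Omega>" for \<phi>
  proof -
    obtain \<psi> K where KO: "compact K" "K \<subseteq> \<Omega>" and \<psi>: "\<psi> \<in> borel_measurable borel" "\<And>x. 0 \<le> \<psi> x" "\<And>x. x \<notin> K \<Longrightarrow> \<psi> x = 0"
      "integrable lborel \<psi>" "(\<integral>\<^sup>+z. ennreal (\<bar>\<psi> (fst z) - \<psi> (snd z)\<bar> powr p / kden s p z) \<partial>lborel) < \<infinity>"
      and ae: "AE x in lborel. \<phi> x = \<psi> x"
      by (rule test_function_borel_version[OF p \<phi>]) (rule that)
    obtain m M where mM: "0 < m" "m \<le> M" "\<And>x. x \<in> K \<Longrightarrow> m \<le> outdist \<Omega> x \<and> outdist \<Omega> x \<le> M"
      using outdist_bounds_on_compact[OF \<Omega>(1,3) KO] by metis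
    interpret hardy_test s p \<beta> \<Omega> K \<psi> m M
      by unfold_locales (use p s KO mM tail \<psi> in auto)
    have u_eq: "u = v" by (simp add: v_def fun_eq_iff u_def)
    have [measurable]: "v \<in> borel_measurable borel" by (simp add: v_def)
    have [measurable]: "\<psi> \<in> borel_measurable borel" by fact
    have "AE z in lborel. energy_integrand s p v \<phi> z = energy_integrand s p v \<psi> z"
      using AE_lborel_fst_snd[OF ae] by eventually_elim (simp add: energy_integrand_def)
    note E = lebesgue_integral_cong_lborel[OF energy_integrand_measurable[unfolded u_eq] this]
    define I where "I = (LINT x|lborel. outdist \<Omega> x powr (\<beta> * (p - 1) - s * p) * \<psi> x)"
    have "AE x in lborel. indicator \<Omega> x *\<^sub>R hardy_integrand s p \<Omega> v \<phi> x = outdist \<Omega> x powr (\<beta> * (p - 1) - s * p) * \<psi> x"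
      using ae
    proof eventually_elim
      fix x assume "\<phi> x = \<psi> x"
      then show "indicator \<Omega> x *\<^sub>R hardy_integrand s p \<Omega> v \<phi> x = outdist \<Omega> x powr (\<beta> * (p - 1) - s * p) * \<psi> x"
        using hardy_integrand_eq[OF \<Omega>(1,3), of x s p \<beta> \<phi>] \<psi>(3)[of x] KO(2)
        by (cases "x \<in> \<Omega>") (auto simp: v_def)
    qed
    from lebesgue_integral_cong_lborel[OF _ this] have H:
      "set_integrable lebesgue \<Omega> (hardy_integrand s p \<Omega> v \<phi>)"
      "(LINT x:\<Omega>|lebesgue. hardy_integrand s p \<Omega> v \<phi> x) = I"
      using hardy_integrable by (simp_all add: set_integrable_def set_lebesgue_integral_def I_def)
    have half: "has_bochner_integral lborel
        (\<lambda>y. truncJ p \<beta> \<theta> (outdist \<Omega> x) (max 0 (outdist \<Omega> x + e \<bullet> (y - x))) / norm (x - y) powr (real CARD('n) + s * p))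
        (C * (outdist \<Omega> x powr (\<beta> * (p - 1) - s * p) * trunc_lambda (s * p) p \<beta> \<theta>))"
      if "0 < \<theta>" "\<theta> < 1" "x \<in> K" "norm e = 1" for \<theta> x e
      unfolding C_def using that KO(2) by (intro truncJ_half_space_integral p \<sigma> \<beta> outdist_pos \<Omega>) auto
    have eq: "inner_trunc \<theta> x = C * (outdist \<Omega> x powr (\<beta> * (p - 1) - s * p) * trunc_lambda (s * p) p \<beta> \<theta>)"
      if \<theta>: "0 < \<theta>" "\<theta> < 1" and x: "x \<in> K" and hs: "open_half_space \<Omega>" for \<theta> x
    proof -
      obtain e where e: "norm e = 1" "\<And>y. outdist \<Omega> y = max 0 (outdist \<Omega> x + e \<bullet> (y - x))"
        using outdist_half_space[OF hs] x KO(2) by (metis subsetD)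
      show ?thesis
        using half[OF \<theta> x e(1)] unfolding inner_trunc_def e(2)[symmetric] by (simp add: has_bochner_integral_iff)
    qed
    have le: "C * (outdist \<Omega> x powr (\<beta> * (p - 1) - s * p) * trunc_lambda (s * p) p \<beta> \<theta>) \<le> inner_trunc \<theta> x"
      if \<theta>: "0 < \<theta>" "\<theta> < 1" and x: "x \<in> K" for \<theta> x
    proof (cases "open_half_space \<Omega>")
      case True
      then show ?thesis using eq[OF that] by simp
    next
      case False
      then have \<beta>0: "0 \<le> \<beta>" using sign by simp
      have x\<Omega>: "x \<in> \<Omega>" using x KO by auto
      obtain e where e: "norm e = 1" "\<And>y. outdist \<Omega> y \<le> max 0 (outdist \<Omega> x + e \<bullet> (y - x))"
        using outdist_le_supporting_half_space[OF \<Omega> x\<Omega>] by blast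
      note h = half[OF \<theta> x e(1)]
      have "(LINT y|lborel. truncJ p \<beta> \<theta> (outdist \<Omega> x) (max 0 (outdist \<Omega> x + e \<bullet> (y - x))) / norm (x - y) powr (real CARD('n) + s * p))
          \<le> inner_trunc \<theta> x"
        unfolding inner_trunc_def
      proof (rule integral_mono)
        show "integrable lborel (\<lambda>y. truncJ p \<beta> \<theta> (outdist \<Omega> x) (max 0 (outdist \<Omega> x + e \<bullet> (y - x))) / norm (x - y) powr (real CARD('n) + s * p))"
          using h by (simp add: has_bochner_integral_iff)
        show "integrable lborel (\<lambda>y. truncJ p \<beta> \<theta> (outdist \<Omega> x) (outdist \<Omega> y) / norm (x - y) powr (real CARD('n) + s * p))"
          by (rule inner_trunc_integrable[OF \<theta> x])
        fix y
        show "truncJ p \<beta> \<theta> (outdist \<Omega> x) (max 0 (outdist \<Omega> x + e \<bullet> (y - x))) / norm (x - y) powr (real CARD('n) + s * p)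
            \<le> truncJ p \<beta> \<theta> (outdist \<Omega> x) (outdist \<Omega> y) / norm (x - y) powr (real CARD('n) + s * p)"
          by (intro divide_right_mono truncJ_antimono p \<beta>0 \<theta> e outdist_pos[OF \<Omega>(1,3) x\<Omega>] outdist_nonneg) simp
      qed
      then show ?thesis using h by (simp add: has_bochner_integral_iff)
    qed
    have L: "C * hardy_lambda s p \<beta> * I \<le> (LINT z|lborel. energy_integrand s p v \<psi> z)"
      unfolding I_def using energy_lower_bound[OF \<beta> le] by (simp only: u_eq)
    have Q: "(LINT z|lborel. energy_integrand s p v \<psi> z) = C * hardy_lambda s p \<beta> * I" if "open_half_space \<Omega>"
      unfolding I_def using energy_equality[OF \<beta> eq] that by (simp only: u_eq)
    show ?thesis
      using H L Q E energy_integrable by (auto simp: u_eq)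
  qed
  show "local_weak_supersolution s p \<Omega> (C_const CARD('n) (s * p) * hardy_lambda s p \<beta>) (U_fun \<Omega> \<beta>)"
    unfolding local_weak_supersolution_def U C_def[symmetric] using spaces main by blast
  show "local_weak_subsolution s p \<Omega> (C_const CARD('n) (s * p) * hardy_lambda s p \<beta>) (U_fun \<Omega> \<beta>)" if "open_half_space \<Omega>"
    unfolding local_weak_subsolution_def U C_def[symmetric] using spaces main that by (metis order_refl)
qed

theorem theorem5p2:
  fixes s p :: real and \<Omega> :: "(real ^ 'n) set"
  assumes "1 < p" and "0 < s" and "s < 1"
    and "open \<Omega>" and "convex \<Omega>" and "\<Omega> \<noteq> UNIV"
  shows "(\<forall>\<beta>. 0 \<le> \<beta> \<and> \<beta> < s * p / (p - 1) \<longrightarrow>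
            local_weak_supersolution s p \<Omega> (C_const CARD('n) (s * p) * hardy_lambda s p \<beta>)
              (U_fun \<Omega> \<beta>)) \<and>
         (open_half_space \<Omega> \<longrightarrow>
            (\<forall>\<beta>. - 1 / (p - 1) < \<beta> \<and> \<beta> < s * p / (p - 1) \<longrightarrow>
              local_weak_solution s p \<Omega> (C_const CARD('n) (s * p) * hardy_lambda s p \<beta>)
                (U_fun \<Omega> \<beta>)))"
proof (intro conjI allI impI)
  fix \<beta> assume \<beta>: "0 \<le> \<beta> \<and> \<beta> < s * p / (p - 1)"
  have "- 1 / (p - 1) < 0" using assms(1) by simp
  then have "- 1 / (p - 1) < \<beta>" using \<beta> by linarith
  then show "local_weak_supersolution s p \<Omega> (C_const CARD('n) (s * p) * hardy_lambda s p \<beta>) (U_fun \<Omega> \<beta>)"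
    using outdist_powr_weak_solution(1)[OF assms, of \<beta>] \<beta> by simp
next
  fix \<beta> assume "open_half_space \<Omega>" "- 1 / (p - 1) < \<beta> \<and> \<beta> < s * p / (p - 1)"
  then show "local_weak_solution s p \<Omega> (C_const CARD('n) (s * p) * hardy_lambda s p \<beta>) (U_fun \<Omega> \<beta>)"
    using outdist_powr_weak_solution[OF assms, of \<beta>] by (simp add: local_weak_solution_def)
qed

end
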